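(* Let $\Omega\subset\mathbb{R}^{n+1}$ be an open set with $n$-dimensional Ahlfors--David regular boundary $\partial\Omega$ such that $\Omega$ satisfies the local John condition and the exterior corkscrew condition. Then $\Omega$ satisfies the Harnack chain condition. In particular, if $\Omega\subset\mathbb{R}^{n+1}$ is an open set with $n$-dimensional Ahlfors--David regular boundary that satisfies the $2$-sided local John condition, then $\Omega$ is a $2$-sided chord-arc domain.
   Context: Let $n\ge 1$. For $x\in\partial\Omega$, $r>0$ write $\Delta(x,r)=B(x,r)\cap\partial\Omega$ ($B(x,r)$ open Euclidean ball), and for $X\in\mathbb{R}^{n+1}$ write $\delta(X)=\operatorname{dist}(X,\partial\Omega)$. Ahlfors--David regularity: a closed set $E\subset\mathbb{R}^{n+1}$ is $n$-dimensional Ahlfors--David regular ($n$-ADR) if there is $D\ge1$ with $D^{-1}r^n\le\mathcal{H}^n(B(x,r)\cap E)\le Dr^n$ for all $x\in E$, $r\in(0,\operatorname{diam}(E))$ ($\operatorname{diam}(E)$ may be infinite). Corkscrew condition for $\Omega$: there is $c\in(0,1)$ such that for every $x\in\partial\Omega$ and $0<r<\operatorname{diam}(\partial\Omega)$ there is $X$ with $B(X,cr)\subset B(x,r)\cap\Omega$. Exterior corkscrew condition: the same (with $x\in\partial\Omega$) with $\Omega$ replaced by the interior of $\Omega^{c}=\mathbb{R}^{n+1}\setminus\Omega$ in the inclusion. Paths: a path in $\Omega$ is a continuous $\gamma:[0,1]\to\overline\Omega$ with $\gamma(t)\in\Omega$ for all $t\in(0,1]$; it goes from $\gamma(0)$ to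 $\gamma(1)$; $\ell(\gamma)$ is its length, and for $Z\in\gamma$ (i.e. $Z=\gamma(t)$ for some $t$), $\gamma(\gamma(0),Z)$ is the piece of $\gamma$ from $\gamma(0)$ to $Z$. For $D\ge 1$, a path $\gamma$ from $X$ to $Y$ is $D$-non-tangential if $\ell(\gamma(X,Z))\le D\,\delta(Z)$ for every $Z\in\gamma$. Local John condition: there is $D_0\ge1$ such that for every $x\in\partial\Omega$ and every $r\in(0,\operatorname{diam}(\partial\Omega))$ there is a point $Y_x\in B(x,r)\cap\Omega$ with $B(Y_x,r/D_0)\subset\Omega$ such that for every $z\in\Delta(x,r)$ there is a $D_0$-non-tangential path $\gamma_z$ in $\Omega$ from $z$ to $Y_x$ with $\ell(\gamma_z)\le D_0r$. The $2$-sided local John condition: $\Omega$ satisfies it, and the same holds (for all $x\in\partial\Omega$, $z\in\Delta(x,r)$) with $\operatorname{int}(\Omega^c)$ in place of $\Omega$. Harnack chain condition for an open set $\Theta$: there is a constant $C\ge1$ and, for every $\Lambda\ge1$, a number $C(\Lambda)$, such that for every $\rho>0$, $\Lambda\ge1$ and $X,X'\in\Theta$ with $\operatorname{dist}(X,\partial\Theta),\operatorname{dist}(X',\partial\Theta)\ge\rho$ and $|X-X'|<\Lambda\rho$ there is a chain of open balls $B_1,\dots,B_N\subset\Theta$, $N\le C(\Lambda)$, with $X\in B_1$, $X'\in B_N$, $B_k\cap B_{k+1}\ne\emptyset$ and $C^{-1}\operatorname{diam}(B_k)\le\operatorname{dist}(B_k,\partial\Theta)\le C\operatorname{diam}(B_k)$.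 A chord-arc domain is an open set satisfying the Harnack chain condition, the corkscrew condition and the exterior corkscrew condition (i.e. a non-tangentially accessible (NTA) domain), whose boundary is $n$-ADR. $\Omega$ is a $2$-sided chord-arc domain if both $\Omega$ and $\operatorname{int}(\Omega^c)$ are chord-arc domains. *)

theory Defs
  imports "HOL-Analysis.Analysis"
begin

text \<open>Diameter with values in the extended half-line: the library's \<^const>\<open>diameter\<close> is
  meaningful only for bounded sets.\<close>

definition ediam :: "'a::metric_space set \<Rightarrow> ennreal" where
  "ediam S = (SUP x\<in>S. SUP y\<in>S. ennreal (dist x y))"

text \<open>Hausdorff (outer) measure, normalised by the volume of the \<open>n\<close>-dimensional ball of
  diameter 1. The case distinction only matters for \<open>n = 0\<close>, where
  \<open>ediam {} ^ 0 = 1\<close> but the empty set must not contribute.\<close>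

definition hausdorff_premeasure :: "nat \<Rightarrow> real \<Rightarrow> 'a::metric_space set \<Rightarrow> ennreal" where
  "hausdorff_premeasure n \<epsilon> A =
     (INF U \<in> {U :: nat \<Rightarrow> 'a set. A \<subseteq> (\<Union>i. U i) \<and> (\<forall>i. ediam (U i) \<le> ennreal \<epsilon>)}.
        \<Sum>i. if U i = {} then 0
             else ennreal (unit_ball_vol (real n) / 2 ^ n) * ediam (U i) ^ n)"

definition hausdorff_measure :: "nat \<Rightarrow> 'a::metric_space set \<Rightarrow> ennreal" where
  "hausdorff_measure n A = (SUP \<epsilon>\<in>{0<..}. hausdorff_premeasure n \<epsilon> A)"

definition ahlfors_david_regular :: "nat \<Rightarrow> 'a::euclidean_space set \<Rightarrow> bool" where
  "ahlfors_david_regular n E \<longleftrightarrow> closed E \<and>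
     (\<exists>D::real. D \<ge> 1 \<and>
       (\<forall>x\<in>E. \<forall>r>0. ennreal r < ediam E \<longrightarrow>
          ennreal (r ^ n / D) \<le> hausdorff_measure n (ball x r \<inter> E) \<and>
          hausdorff_measure n (ball x r \<inter> E) \<le> ennreal (D * r ^ n)))"

text \<open>In the exterior versions of the corkscrew and local John conditions the centres \<open>x\<close>, the
  scales and the distance \<open>\<delta>\<close> still refer to the boundary of \<open>\<Omega>\<close>, and only the set containing
  the balls and paths changes. Hence the boundary \<open>E\<close> is a separate parameter.\<close>

definition corkscrew_wrt :: "'a::euclidean_space set \<Rightarrow> 'a set \<Rightarrow> bool" where
  "corkscrew_wrt E U \<longleftrightarrow>
     (\<exists>c::real. 0 < c \<and> c < 1 \<and>
       (\<forall>x\<in>E. \<forall>r>0. ennreal r < ediam E \<longrightarrow>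
          (\<exists>X. ball X (c * r) \<subseteq> ball x r \<inter> U)))"

definition corkscrew :: "'a::euclidean_space set \<Rightarrow> bool" where
  "corkscrew \<Omega> \<longleftrightarrow> corkscrew_wrt (frontier \<Omega>) \<Omega>"

definition exterior_corkscrew :: "'a::euclidean_space set \<Rightarrow> bool" where
  "exterior_corkscrew \<Omega> \<longleftrightarrow> corkscrew_wrt (frontier \<Omega>) (interior (- \<Omega>))"

definition path_into :: "'a::euclidean_space set \<Rightarrow> (real \<Rightarrow> 'a) \<Rightarrow> 'a \<Rightarrow> 'a \<Rightarrow> bool" where
  "path_into U \<gamma> X Y \<longleftrightarrow> path \<gamma> \<and> path_image \<gamma> \<subseteq> closure U \<and> (\<forall>t\<in>{0<..1}. \<gamma> t \<in> U) \<and>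
     pathstart \<gamma> = X \<and> pathfinish \<gamma> = Y"

definition curve_length :: "(real \<Rightarrow> 'a::metric_space) \<Rightarrow> real \<Rightarrow> real \<Rightarrow> ennreal" where
  "curve_length \<gamma> a b =
     (SUP p \<in> {p. sorted p \<and> set p \<subseteq> {a..b}}.
        ennreal (\<Sum>i<length p - 1. dist (\<gamma> (p ! i)) (\<gamma> (p ! Suc i))))"

definition nontangential ::
  "'a::euclidean_space set \<Rightarrow> real \<Rightarrow> (real \<Rightarrow> 'a) \<Rightarrow> bool" where
  "nontangential E D \<gamma> \<longleftrightarrow>
     (\<forall>t\<in>{0..1}. curve_length \<gamma> 0 t \<le> ennreal (D * infdist (\<gamma> t) E))"

definition local_john_wrt :: "'a::euclidean_space set \<Rightarrow> 'a set \<Rightarrow> bool" where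
  "local_john_wrt E U \<longleftrightarrow>
     (\<exists>D::real. D \<ge> 1 \<and>
       (\<forall>x\<in>E. \<forall>r>0. ennreal r < ediam E \<longrightarrow>
          (\<exists>Y \<in> ball x r \<inter> U. ball Y (r / D) \<subseteq> U \<and>
             (\<forall>z \<in> ball x r \<inter> E. \<exists>\<gamma>. path_into U \<gamma> z Y \<and> nontangential E D \<gamma> \<and>
                curve_length \<gamma> 0 1 \<le> ennreal (D * r)))))"

definition local_john :: "'a::euclidean_space set \<Rightarrow> bool" where
  "local_john \<Omega> \<longleftrightarrow> local_john_wrt (frontier \<Omega>) \<Omega>"

definition two_sided_local_john :: "'a::euclidean_space set \<Rightarrow> bool" where
  "two_sided_local_john \<Omega> \<longleftrightarrow>
     local_john \<Omega> \<and> local_john_wrt (frontier \<Omega>) (interior (- \<Omega>))"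

text \<open>The distance to the boundary is \<^const>\<open>infdist\<close>, which is 0 for an empty boundary. The
  condition therefore holds vacuously for the whole space, which has no boundary.\<close>

definition harnack_chain :: "'a::euclidean_space set \<Rightarrow> bool" where
  "harnack_chain \<Theta> \<longleftrightarrow>
     (\<exists>C::real. C \<ge> 1 \<and> (\<exists>K :: real \<Rightarrow> real. \<forall>\<rho>>0. \<forall>\<Lambda>\<ge>1. \<forall>X\<in>\<Theta>. \<forall>X'\<in>\<Theta>.
        infdist X (frontier \<Theta>) \<ge> \<rho> \<and> infdist X' (frontier \<Theta>) \<ge> \<rho> \<and> dist X X' < \<Lambda> * \<rho> \<longrightarrow>
        (\<exists>(N::nat) (B :: nat \<Rightarrow> 'a set). 1 \<le> N \<and> real N \<le> K \<Lambda> \<and>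
           (\<forall>k\<in>{1..N}. (\<exists>y s. 0 < s \<and> B k = ball y s) \<and> B k \<subseteq> \<Theta> \<and>
              diameter (B k) / C \<le> setdist (B k) (frontier \<Theta>) \<and>
              setdist (B k) (frontier \<Theta>) \<le> C * diameter (B k)) \<and>
           X \<in> B 1 \<and> X' \<in> B N \<and>
           (\<forall>k\<in>{1..<N}. B k \<inter> B (Suc k) \<noteq> {}))))"

definition chord_arc_domain :: "nat \<Rightarrow> 'a::euclidean_space set \<Rightarrow> bool" where
  "chord_arc_domain n \<Omega> \<longleftrightarrow> open \<Omega> \<and> harnack_chain \<Omega> \<and> corkscrew \<Omega> \<and> exterior_corkscrew \<Omega> \<and>
     ahlfors_david_regular n (frontier \<Omega>)"

definition two_sided_chord_arc_domain :: "nat \<Rightarrow> 'a::euclidean_space set \<Rightarrow> bool" where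
  "two_sided_chord_arc_domain n \<Omega> \<longleftrightarrow>
     chord_arc_domain n \<Omega> \<and> chord_arc_domain n (interior (- \<Omega>))"

end

theory Submission
  imports Defs "HOL-Complex_Analysis.Great_Picard"
begin

text \<open>The heart of the matter is to join a point \<open>X\<close> of \<open>\<Omega>\<close> to a John centre \<open>Y\<close> at a comparable
  scale by a chain of bounded length. If this fails, blow up a sequence of counterexamples: the
  rescaled signed distances to the boundary converge along a subsequence to a 1-Lipschitz function
  \<open>f\<close>. Let \<open>V\<close> be the set of points of \<open>{f > 0}\<close> that are reached from \<open>X\<close> by chains of bounded
  length; it is open and relatively closed in \<open>{f > 0}\<close>. Ahlfors--David regularity bounds the
  covering numbers of \<open>{f = 0}\<close>, so by Fatou's lemma almost every line parallel to a coordinate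
  axis meets \<open>{f = 0}\<close> in finitely many points. Hence on a set of positive measure of parallel
  lines, going from \<open>V\<close> to an exterior corkscrew ball, there is an isolated point at which the line
  leaves \<open>V\<close>. Up to a countable decomposition, and because porous sets are negligible, such a point
  \<open>z\<close> can be chosen so that at all small scales every corkscrew ball near \<open>z\<close> is met by lines which
  near \<open>z\<close> lie in \<open>V\<close> on one side and in a single phase \<open>{f < 0}\<close> or \<open>{f > 0}\<close> on the other side.
  The exterior corkscrew condition excludes the phase \<open>{f > 0}\<close>, and then the corkscrew balls
  around the John path that starts at \<open>z\<close> have to meet \<open>V\<close>, which joins \<open>X\<close> to \<open>Y\<close> after all.

  At scales comparable to the diameter of a bounded boundary, compactness gives chains once all
  points of \<open>\<Omega>\<close> are joined by some chain. This holds near any two boundary points at a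
  distance less than the diameter. If it failed for a pair at a distance equal to the diameter, the
  boundary near one of them would lie on the intersection of two spheres.\<close>

section \<open>Porous sets\<close>


text \<open>Upper porosity: the hole is demanded only at arbitrarily small scales. Its failure is
  therefore strong: some point of \<open>S\<close> has the property that at every small scale
  \<open>d\<close> every ball of radius \<open>c * d\<close> inside the \<open>d\<close>-ball around
  it meets \<open>S\<close>.\<close>

definition porous :: "real \<Rightarrow> 'a::euclidean_space set \<Rightarrow> bool" where
  "porous c S \<longleftrightarrow> (\<forall>x\<in>S. \<forall>r>0. \<exists>d p. 0 < d \<and> d < r \<and> ball p (c * d) \<subseteq> ball x d \<and> ball p (c * d) \<inter> S = {})"

lemma porous_subset: "porous c S \<Longrightarrow> T \<subseteq> S \<Longrightarrow> porous c T"
  unfolding porous_def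
proof (intro ballI allI impI)
  fix x r assume S: "\<forall>x\<in>S. \<forall>r>0. \<exists>d p. 0 < d \<and> d < r \<and> ball p (c * d) \<subseteq> ball x d \<and> ball p (c * d) \<inter> S = {}"
    and T: "T \<subseteq> S" "x \<in> T" and r: "(0::real) < r"
  then obtain d p where "0 < d" "d < r" "ball p (c * d) \<subseteq> ball x d" "ball p (c * d) \<inter> S = {}" by blast
  then show "\<exists>d p. 0 < d \<and> d < r \<and> ball p (c * d) \<subseteq> ball x d \<and> ball p (c * d) \<inter> T = {}"
    using T(1) by blast
qed

lemma emeasure_ball_scale:
  fixes x p :: "'a::euclidean_space"
  assumes "0 < c" "0 < d"
  shows "emeasure lebesgue (ball p (c * d)) = ennreal (c ^ DIM('a)) * emeasure lebesgue (cball x d)"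
  using assms by (simp add: emeasure_ball emeasure_cball power_mult_distrib ennreal_mult' mult_ac)

text \<open>Vitali's theorem selects disjoint balls inside \<open>U\<close>, each with a hole, that
  cover almost all of \<open>S\<close>. The holes occupy the fraction \<open>c ^ DIM('a)\<close> of
  these balls and can be discarded.\<close>

lemma porous_shrink:
  fixes S U :: "'a::euclidean_space set"
  assumes c: "0 < c" "c < 1" and por: "porous c S" and U: "open U" "S \<subseteq> U" "U \<in> lmeasurable"
  obtains T where "S \<subseteq> T" "T \<in> lmeasurable" "measure lebesgue T \<le> (1 - c ^ DIM('a)) * measure lebesgue U"
proof -
  define K where "K = {(x,d,p). x \<in> S \<and> 0 < d \<and> ball p (c * d) \<subseteq> ball x d \<and> ball p (c * d) \<inter> S = {} \<and> cball x d \<subseteq> U}"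
  have cov: "\<exists>i. i \<in> K \<and> x \<in> cball (fst i) (fst (snd i)) \<and> fst (snd i) < d" if x: "x \<in> S" and d: "0 < d" for x d
  proof -
    obtain r where r: "r > 0" "cball x r \<subseteq> U" using U x open_contains_cball by blast
    obtain d' p where "0 < d'" "d' < min d r" "ball p (c * d') \<subseteq> ball x d'" "ball p (c * d') \<inter> S = {}"
      using por x d r unfolding porous_def by (metis min_less_iff_conj)
    then have "(x,d',p) \<in> K" using r x subset_cball[of d' r x] by (auto simp: K_def)
    then show ?thesis using \<open>0 < d'\<close> \<open>d' < min d r\<close> by force
  qed
  obtain C where C: "countable C" "C \<subseteq> K"
    and pw: "pairwise (\<lambda>i j. disjnt (cball (fst i) (fst (snd i))) (cball (fst j) (fst (snd j)))) C"
    and neg: "negligible (S - (\<Union>i\<in>C. cball (fst i) (fst (snd i))))"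
  proof (rule Vitali_covering_theorem_cballs[of K "\<lambda>i. fst (snd i)" S fst])
    show "0 < fst (snd i)" if "i \<in> K" for i using that by (auto simp: K_def)
  qed (use cov in blast)+
  define W H where "W = (\<Union>i\<in>C. cball (fst i) (fst (snd i)))" and "H = (\<Union>i\<in>C. ball (snd (snd i)) (c * fst (snd i)))"
  have CK: "0 < fst (snd i)" "ball (snd (snd i)) (c * fst (snd i)) \<inter> S = {}" "cball (fst i) (fst (snd i)) \<subseteq> U"
    if "i \<in> C" for i
    using subsetD[OF C(2) that] by (auto simp: K_def)
  have Kd: "ball (snd (snd i)) (c * fst (snd i)) \<subseteq> cball (fst i) (fst (snd i))" if "i \<in> C" for i
  proof -
    have "i \<in> K" using that C(2) by blast
    then have "ball (snd (snd i)) (c * fst (snd i)) \<subseteq> ball (fst i) (fst (snd i))" by (auto simp: K_def)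
    then show ?thesis using ball_subset_cball by blast
  qed
  have dW: "disjoint_family_on (\<lambda>i. cball (fst i) (fst (snd i))) C"
    using pw by (simp add: disjoint_family_on_def pairwise_def disjnt_def)
  have dH: "disjoint_family_on (\<lambda>i. ball (snd (snd i)) (c * fst (snd i))) C"
    unfolding disjoint_family_on_def
  proof (intro ballI impI)
    fix i j assume ij: "i \<in> C" "j \<in> C" "i \<noteq> j"
    then have "cball (fst i) (fst (snd i)) \<inter> cball (fst j) (fst (snd j)) = {}"
      using dW by (simp add: disjoint_family_on_def)
    then show "ball (snd (snd i)) (c * fst (snd i)) \<inter> ball (snd (snd j)) (c * fst (snd j)) = {}"
      using Kd[OF ij(1)] Kd[OF ij(2)] by blast
  qed
  have "emeasure lebesgue H = (\<integral>\<^sup>+i. emeasure lebesgue (ball (snd (snd i)) (c * fst (snd i))) \<partial>count_space C)"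
    unfolding H_def by (rule emeasure_UN_countable[OF _ C(1) dH]) auto
  also have "\<dots> = (\<integral>\<^sup>+i. ennreal (c ^ DIM('a)) * emeasure lebesgue (cball (fst i) (fst (snd i))) \<partial>count_space C)"
    by (rule nn_integral_cong, rule emeasure_ball_scale) (use CK c in auto)
  also have "\<dots> = ennreal (c ^ DIM('a)) * (\<integral>\<^sup>+i. emeasure lebesgue (cball (fst i) (fst (snd i))) \<partial>count_space C)"
    by (rule nn_integral_cmult) auto
  also have "(\<integral>\<^sup>+i. emeasure lebesgue (cball (fst i) (fst (snd i))) \<partial>count_space C) = emeasure lebesgue W"
    unfolding W_def by (rule emeasure_UN_countable[OF _ C(1) dW, symmetric]) auto
  finally have HW: "emeasure lebesgue H = ennreal (c ^ DIM('a)) * emeasure lebesgue W" .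
  have WU: "W \<subseteq> U" unfolding W_def using CK(3) by blast
  have Ws: "W \<in> sets lebesgue" unfolding W_def by (rule sets.countable_UN'[OF C(1)]) auto
  have Wm: "W \<in> lmeasurable" by (rule fmeasurableI2[OF U(3) WU Ws])
  have Ho: "open H" unfolding H_def by auto
  have HsW: "H \<subseteq> W" unfolding H_def W_def using Kd by blast
  have Hm: "H \<in> lmeasurable" by (rule fmeasurableI2[OF Wm HsW]) (use Ho in auto)
  have mH: "measure lebesgue H = c ^ DIM('a) * measure lebesgue W"
    using HW c by (simp add: measure_def enn2real_mult)
  have mD: "measure lebesgue (W - H) = (1 - c ^ DIM('a)) * measure lebesgue W"
    using measurable_measure_Diff[OF Wm _ HsW] Hm mH by (simp add: algebra_simps fmeasurableD)
  \<comment> \<open>The Vitali balls without their holes, together with the null part of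
    \<open>S\<close> that the balls miss.\<close>
  let ?T = "(W - H) \<union> (S - W)"
  have SH: "S \<inter> H = {}" unfolding H_def using CK(2) by blast
  show thesis
  proof
    show "S \<subseteq> ?T" using SH by auto
    have n: "negligible (S - W)" using neg by (simp add: W_def)
    show "?T \<in> lmeasurable" using fmeasurable.Un[OF fmeasurable_Diff[OF Wm] negligible_imp_measurable[OF n]] Hm by (simp add: fmeasurableD)
    have "measure lebesgue ?T \<le> measure lebesgue (W - H) + measure lebesgue (S - W)"
      by (rule measure_Un_le) (use Wm Hm negligible_imp_measurable[OF n] in \<open>auto intro!: sets.Diff fmeasurableD\<close>)
    also have "\<dots> = (1 - c ^ DIM('a)) * measure lebesgue W" using n mD by (simp add: negligible_imp_measure0)
    also have "\<dots> \<le> (1 - c ^ DIM('a)) * measure lebesgue U"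
    proof (rule mult_left_mono)
      show "measure lebesgue W \<le> measure lebesgue U" by (rule measure_mono_fmeasurable[OF WU Ws U(3)])
      show "0 \<le> 1 - c ^ DIM('a)" using c by (simp add: power_le_one)
    qed
    finally show "measure lebesgue ?T \<le> (1 - c ^ DIM('a)) * measure lebesgue U" .
  qed
qed

text \<open>For bounded \<open>S\<close>, let \<open>a\<close> be the infimum of the measures of
  measurable supersets. Shrinking nearly optimal supersets gives
  \<open>a \<le> (1 - c ^ DIM('a)) * a\<close> in the limit, so \<open>a = 0\<close>. The general
  case is a countable union.\<close>

lemma porous_negligible:
  fixes S :: "'a::euclidean_space set"
  assumes c: "0 < c" "c < 1" and por: "porous c S"
  shows "negligible S"
proof -
  have bdd: "negligible S" if por: "porous c S" and b: "bounded S" for S :: "'a set"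
  proof -
    define M where "M = {measure lebesgue T | T. S \<subseteq> T \<and> T \<in> lmeasurable}"
    define a where "a = Inf M"
    obtain R where "S \<subseteq> cball 0 R" using b unfolding bounded_iff by (auto simp: subset_iff)
    then have "measure lebesgue (cball 0 R :: 'a set) \<in> M" unfolding M_def mem_Collect_eq
      by (intro exI[of _ "cball 0 R"]) simp
    then have ne: "M \<noteq> {}" by auto
    have bb: "bdd_below M" unfolding M_def bdd_below_def by (intro exI[of _ 0]) auto
    have a0: "a \<ge> 0" unfolding a_def by (rule cInf_greatest[OF ne]) (auto simp: M_def)
    let ?k = "c ^ DIM('a)"
    have k: "0 < ?k" "?k \<le> 1" using c by (auto simp: power_le_one)
    have app: "\<exists>T. S \<subseteq> T \<and> T \<in> lmeasurable \<and> measure lebesgue T < a + e" if "e > 0" for e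
    proof -
      have "\<exists>x\<in>M. x < a + e" using cInf_lessD[OF ne, of "a + e"] that by (simp add: a_def)
      then show ?thesis by (auto simp: M_def)
    qed
    \<comment> \<open>One \<open>e\<close> pays for a nearly optimal superset, the other for an open
      set around it, as \<open>porous_shrink\<close> starts from an open set.\<close>
    have "a \<le> (1 - ?k) * (a + 2 * e)" if e: "e > 0" for e
    proof -
      obtain T where T: "S \<subseteq> T" "T \<in> lmeasurable" "measure lebesgue T < a + e" using app[OF e] by blast
      obtain U where U: "open U" "T \<subseteq> U" "(U - T) \<in> lmeasurable" "emeasure lebesgue (U - T) < ennreal e"
        using sets_lebesgue_outer_open[OF fmeasurableD[OF T(2)] e] .
      have Um: "U \<in> lmeasurable" using fmeasurable.Un[OF T(2) U(3)] U(2) by (simp add: Un_absorb1)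
      have "measure lebesgue U \<le> measure lebesgue T + measure lebesgue (U - T)"
        using measure_Un_le[of T lebesgue "U - T"] T(2) U(2,3) by (simp add: Un_absorb1 fmeasurableD)
      moreover have "measure lebesgue (U - T) < e"
        using U(4) e emeasure_eq_measure2[OF U(3)] by (simp add: ennreal_less_iff)
      ultimately have mU: "measure lebesgue U \<le> a + 2 * e" using T(3) by linarith
      obtain T' where T': "S \<subseteq> T'" "T' \<in> lmeasurable" "measure lebesgue T' \<le> (1 - ?k) * measure lebesgue U"
        using porous_shrink[OF c por U(1) _ Um] T(1) U(2) by blast
      have "a \<le> measure lebesgue T'" unfolding a_def by (rule cInf_lower[OF _ bb]) (use T' in \<open>auto simp: M_def\<close>)
      also have "\<dots> \<le> (1 - ?k) * (a + 2 * e)" using T'(3) mult_left_mono[OF mU, of "1 - ?k"] k by simp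
      finally show ?thesis .
    qed
    then have "a * ?k \<le> e" if e: "e > 0" for e
    proof -
      have "a \<le> (1 - ?k) * (a + 2 * (e/2))" using \<open>\<And>e. e > 0 \<Longrightarrow> a \<le> (1 - ?k) * (a + 2 * e)\<close>[of "e/2"] e by simp
      also have "\<dots> = a - a * ?k + (1 - ?k) * e" by (simp add: algebra_simps)
      finally have "a \<le> a - a * ?k + (1 - ?k) * e" .
      moreover have "(1 - ?k) * e \<le> 1 * e" by (rule mult_right_mono) (use k e in auto)
      ultimately show ?thesis by linarith
    qed
    then have "a * ?k \<le> 0" by (rule field_le_epsilon[where y=0, simplified])
    then have "a = 0" using a0 k by (simp add: mult_le_0_iff)
    then have "\<exists>T. S \<subseteq> T \<and> T \<in> lmeasurable \<and> measure lebesgue T \<le> e" if "e > 0" for e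
      using app[OF that] by (auto intro: less_imp_le)
    then show ?thesis unfolding negligible_outer_le by blast
  qed
  have "S = (\<Union>n::nat. S \<inter> ball 0 (real n))"
    by (auto simp: reals_Archimedean2)
  moreover have "negligible (S \<inter> ball 0 (real n))" for n
    by (rule bdd) (auto intro: porous_subset[OF por] bounded_subset[OF bounded_ball])
  ultimately show ?thesis by (metis negligible_Union_nat)
qed

section \<open>Separated families and Hausdorff measure\<close>


lemma ediam_mono: "S \<subseteq> T \<Longrightarrow> ediam S \<le> ediam T"
  unfolding ediam_def by (intro SUP_mono) (blast intro: SUP_subset_mono)

lemma dist_le_ediam: "x \<in> S \<Longrightarrow> y \<in> S \<Longrightarrow> ennreal (dist x y) \<le> ediam S"
  unfolding ediam_def by (meson SUP_upper2 order_refl)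

lemma hausdorff_premeasure_mono:
  "A \<subseteq> B \<Longrightarrow> hausdorff_premeasure n e A \<le> hausdorff_premeasure n e B"
  unfolding hausdorff_premeasure_def by (rule INF_superset_mono) auto

lemma hausdorff_premeasure_antimono:
  "e \<le> e' \<Longrightarrow> hausdorff_premeasure n e' A \<le> hausdorff_premeasure n e A"
  unfolding hausdorff_premeasure_def
  by (rule INF_superset_mono) (auto intro: order_trans ennreal_leI)

lemma hausdorff_measure_mono: "A \<subseteq> B \<Longrightarrow> hausdorff_measure n A \<le> hausdorff_measure n B"
  unfolding hausdorff_measure_def by (intro SUP_mono) (blast intro: hausdorff_premeasure_mono)

text \<open>A covering set of diameter at most \<open>e < g\<close> meets at most one of the
  \<open>g\<close>-separated sets, so a cover of the union splits into covers of the single sets at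
  no extra cost.\<close>

lemma hausdorff_premeasure_separated:
  fixes A :: "'i \<Rightarrow> 'a::metric_space set"
  assumes fin: "finite Z" and eg: "e < g" and g: "0 < g"
    and sep: "\<And>z z' x y. z \<in> Z \<Longrightarrow> z' \<in> Z \<Longrightarrow> z \<noteq> z' \<Longrightarrow> x \<in> A z \<Longrightarrow> y \<in> A z' \<Longrightarrow> g \<le> dist x y"
  shows "(\<Sum>z\<in>Z. hausdorff_premeasure n e (A z)) \<le> hausdorff_premeasure n e (\<Union>z\<in>Z. A z)"
proof -
  define h where "h = (\<lambda>S::'a set. if S = {} then 0 else ennreal (unit_ball_vol (real n) / 2 ^ n) * ediam S ^ n)"
  have hm: "h S \<le> h T" if "S \<subseteq> T" for S T
    using that unfolding h_def by (auto intro!: mult_left_mono power_mono ediam_mono)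
  have pre: "hausdorff_premeasure n e B = (INF U \<in> {U :: nat \<Rightarrow> 'a set. B \<subseteq> (\<Union>i. U i) \<and> (\<forall>i. ediam (U i) \<le> ennreal e)}. \<Sum>i. h (U i))" for B
    unfolding hausdorff_premeasure_def h_def ..
  show ?thesis
    unfolding pre[of "\<Union>z\<in>Z. A z"]
  proof (rule INF_greatest)
    fix U :: "nat \<Rightarrow> 'a set" assume "U \<in> {U. (\<Union>z\<in>Z. A z) \<subseteq> (\<Union>i. U i) \<and> (\<forall>i. ediam (U i) \<le> ennreal e)}"
    then have cov: "(\<Union>z\<in>Z. A z) \<subseteq> (\<Union>i. U i)" and ed: "\<And>i. ediam (U i) \<le> ennreal e" by auto
    have "(\<Sum>z\<in>Z. hausdorff_premeasure n e (A z)) \<le> (\<Sum>z\<in>Z. \<Sum>i. h (U i \<inter> A z))"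
    proof (rule sum_mono)
      fix z assume "z \<in> Z"
      show "hausdorff_premeasure n e (A z) \<le> (\<Sum>i. h (U i \<inter> A z))"
        unfolding pre
      proof (rule INF_lower)
        have "ediam (U i \<inter> A z) \<le> ennreal e" for i using ediam_mono[of "U i \<inter> A z" "U i"] ed[of i] by auto
        then show "(\<lambda>i. U i \<inter> A z) \<in> {U. A z \<subseteq> (\<Union>i. U i) \<and> (\<forall>i. ediam (U i) \<le> ennreal e)}"
          using cov \<open>z \<in> Z\<close> by auto
      qed
    qed
    also have "\<dots> = (\<Sum>i. \<Sum>z\<in>Z. h (U i \<inter> A z))"
      by (rule suminf_sum[symmetric]) simp
    also have "\<dots> \<le> (\<Sum>i. h (U i))"
    proof (intro suminf_le allI)
      fix i
      show "(\<Sum>z\<in>Z. h (U i \<inter> A z)) \<le> h (U i)"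
      proof (cases "\<exists>z\<in>Z. U i \<inter> A z \<noteq> {}")
        case True
        then obtain z x where z: "z \<in> Z" "x \<in> U i" "x \<in> A z" by blast
        have "U i \<inter> A z' = {}" if z': "z' \<in> Z" "z' \<noteq> z" for z'
        proof (rule ccontr)
          assume "U i \<inter> A z' \<noteq> {}"
          then obtain y where y: "y \<in> U i" "y \<in> A z'" by blast
          have "ennreal (dist x y) \<le> ennreal e" using dist_le_ediam[OF z(2) y(1)] ed[of i] by (rule order_trans)
          moreover have "g \<le> dist x y" using sep[OF z(1) z'(1) _ z(3) y(2)] z'(2) by auto
          ultimately show False using eg g by (cases "e \<ge> 0") (auto simp: ennreal_neg)
        qed
        then have "(\<Sum>z'\<in>Z. h (U i \<inter> A z')) = (\<Sum>z'\<in>Z. if z' = z then h (U i \<inter> A z) else 0)"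
          by (intro sum.cong) (auto simp: h_def)
        also have "\<dots> = h (U i \<inter> A z)" using fin z(1) by simp
        finally show ?thesis using hm[of "U i \<inter> A z" "U i"] by simp
      next
        case False
        then show ?thesis by (simp add: h_def)
      qed
    qed auto
    finally show "(\<Sum>z\<in>Z. hausdorff_premeasure n e (A z)) \<le> (\<Sum>i. h (U i))" .
  qed
qed

text \<open>The premeasures exceed half of the lower bound \<open>c\<close> from some scale on; for
  finitely many sets one such scale below the gap \<open>g\<close> serves all of them, and there the
  premeasure is superadditive. This is what costs the factor 2.\<close>

lemma hausdorff_measure_separated:
  fixes A :: "'i \<Rightarrow> 'a::metric_space set"
  assumes fin: "finite Z" and g: "0 < g" and c: "0 < c"
    and sep: "\<And>z z' x y. z \<in> Z \<Longrightarrow> z' \<in> Z \<Longrightarrow> z \<noteq> z' \<Longrightarrow> x \<in> A z \<Longrightarrow> y \<in> A z' \<Longrightarrow> g \<le> dist x y"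
    and low: "\<And>z. z \<in> Z \<Longrightarrow> ennreal c \<le> hausdorff_measure n (A z)"
  shows "ennreal (card Z * (c / 2)) \<le> hausdorff_measure n (\<Union>z\<in>Z. A z)"
proof -
  have "\<exists>e>0. ennreal (c/2) < hausdorff_premeasure n e (A z)" if "z \<in> Z" for z
  proof -
    have "ennreal (c/2) < ennreal c" using c by (simp add: ennreal_less_iff)
    then have "ennreal (c/2) < hausdorff_measure n (A z)" using low[OF that] by (rule less_le_trans)
    then show ?thesis unfolding hausdorff_measure_def less_SUP_iff by auto
  qed
  then obtain \<epsilon> where \<epsilon>: "\<And>z. z \<in> Z \<Longrightarrow> \<epsilon> z > 0" "\<And>z. z \<in> Z \<Longrightarrow> ennreal (c/2) < hausdorff_premeasure n (\<epsilon> z) (A z)"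
    by metis
  \<comment> \<open>The halved gap makes \<open>e < g\<close> strict; inserting it also keeps
    \<open>Min\<close> meaningful when \<open>Z\<close> is empty.\<close>
  define e where "e = Min (insert (g/2) (\<epsilon> ` Z))"
  have e: "e > 0" "e < g" "\<And>z. z \<in> Z \<Longrightarrow> e \<le> \<epsilon> z"
  proof -
    show "e > 0" unfolding e_def using fin g \<epsilon>(1) by (subst Min_gr_iff) auto
    have "e \<le> g/2" unfolding e_def using fin by (intro Min_le) auto
    then show "e < g" using g by simp
    show "e \<le> \<epsilon> z" if "z \<in> Z" for z unfolding e_def using fin that by (intro Min_le) auto
  qed
  have "ennreal (card Z * (c / 2)) = (\<Sum>z\<in>Z. ennreal (c/2))"
    using c ennreal_mult[of "card Z" "c/2"] by (simp add: ennreal_of_nat_eq_real_of_nat)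
  also have "\<dots> \<le> (\<Sum>z\<in>Z. hausdorff_premeasure n e (A z))"
    by (intro sum_mono) (meson \<epsilon>(2) e(3) hausdorff_premeasure_antimono less_imp_le order_trans)
  also have "\<dots> \<le> hausdorff_premeasure n e (\<Union>z\<in>Z. A z)"
    using fin e(2) g sep by (rule hausdorff_premeasure_separated)
  also have "\<dots> \<le> hausdorff_measure n (\<Union>z\<in>Z. A z)"
    unfolding hausdorff_measure_def using e(1) by (intro SUP_upper) auto
  finally show ?thesis .
qed

text \<open>The Ahlfors-David condition with its constant exposed, because the packing bounds must
  be uniform along a blow-up sequence.\<close>

definition adr_const :: "nat \<Rightarrow> real \<Rightarrow> 'a::euclidean_space set \<Rightarrow> bool" where
  "adr_const n D E \<longleftrightarrow> (\<forall>x\<in>E. \<forall>r>0. ennreal r < ediam E \<longrightarrow>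
          ennreal (r ^ n / D) \<le> hausdorff_measure n (ball x r \<inter> E) \<and>
          hausdorff_measure n (ball x r \<inter> E) \<le> ennreal (D * r ^ n))"

text \<open>Volume comparison: the pieces of \<open>E\<close> in the balls of radius
  \<open>s/4\<close> around the points of \<open>Z\<close> are \<open>s/4\<close> apart, each has
  mass at least \<open>(s/4) ^ n / D\<close>, and all lie in \<open>ball x (2 * R)\<close>, where
  the mass is at most \<open>D * (2 * R) ^ n\<close>.\<close>

lemma adr_packing:
  fixes E :: "'a::euclidean_space set" and D R s :: real
  assumes adr: "adr_const n D E" and D: "D \<ge> 1" and x: "x \<in> E" and R: "ennreal (2 * R) < ediam E"
    and Z: "finite Z" "Z \<subseteq> E \<inter> ball x R" and s: "0 < s" "s \<le> R"
    and sep: "\<And>z z'. z \<in> Z \<Longrightarrow> z' \<in> Z \<Longrightarrow> z \<noteq> z' \<Longrightarrow> s \<le> dist z z'"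
  shows "card Z * s ^ n \<le> 2 * D\<^sup>2 * (8 * R) ^ n"
proof -
  have R0: "R > 0" using s by simp
  have s4: "ennreal (s/4) < ediam E"
    by (rule le_less_trans[OF _ R]) (use s in \<open>auto intro: ennreal_leI\<close>)
  have "ennreal (card Z * ((s/4) ^ n / D / 2)) \<le> hausdorff_measure n (\<Union>z\<in>Z. ball z (s/4) \<inter> E)"
  proof (rule hausdorff_measure_separated[OF Z(1)])
    show "0 < s/4" "0 < (s/4)^n / D" using s D by auto
    show "ennreal ((s/4)^n / D) \<le> hausdorff_measure n (ball z (s/4) \<inter> E)" if "z \<in> Z" for z
      using adr[unfolded adr_const_def, rule_format, of z "s/4"] that Z s s4 by auto
    fix z z' x y assume *: "z \<in> Z" "z' \<in> Z" "z \<noteq> z'" "x \<in> ball z (s/4) \<inter> E" "y \<in> ball z' (s/4) \<inter> E"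
    have "dist z z' \<le> dist z x + dist x y + dist y z'"
      by (meson add_le_cancel_right dist_triangle order_trans)
    then show "s/4 \<le> dist x y" using sep[OF *(1-3)] *(4,5) s by (auto simp: dist_commute)
  qed
  also have "\<dots> \<le> hausdorff_measure n (ball x (2 * R) \<inter> E)"
  proof (rule hausdorff_measure_mono, rule subsetI)
    fix y assume "y \<in> (\<Union>z\<in>Z. ball z (s/4) \<inter> E)"
    then obtain z where z: "z \<in> Z" "dist z y < s/4" "y \<in> E" by auto
    then have "dist x z < R" using Z by auto
    then show "y \<in> ball x (2 * R) \<inter> E" using z s dist_triangle[of x y z] by auto
  qed
  also have "\<dots> \<le> ennreal (D * (2 * R) ^ n)"
    using adr[unfolded adr_const_def, rule_format, OF x, of "2 * R"] R R0 by auto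
  finally have "card Z * ((s/4) ^ n / D / 2) \<le> D * (2 * R) ^ n"
    using D R0 by (subst (asm) ennreal_le_iff) auto
  then have "card Z * s ^ n \<le> (2 * D * 4 ^ n) * (D * (2 * R) ^ n)"
    using D by (simp add: field_simps power_divide)
  also have "\<dots> = 2 * D\<^sup>2 * (8 * R) ^ n"
  proof -
    have "(4::real) ^ n * 2 ^ n = 8 ^ n" by (simp flip: power_mult_distrib)
    then show ?thesis by (simp add: power2_eq_square power_mult_distrib mult_ac)
  qed
  finally show ?thesis .
qed

section \<open>Signed distance and Harnack chains\<close>


text \<open>Arzela-Ascoli for 1-Lipschitz functions vanishing at the origin: a diagonal subsequence
  converges on a countable dense set, and the common Lipschitz bound carries convergence to all
  points.\<close>

lemma lipschitz_pointwise_subseq: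
  fixes F :: "nat \<Rightarrow> 'a::euclidean_space \<Rightarrow> real"
  assumes lip: "\<And>k x y. \<bar>F k x - F k y\<bar> \<le> dist x y" and F0: "\<And>k. F k 0 = 0"
  obtains \<phi> f where "strict_mono \<phi>" "\<And>x. (\<lambda>k. F (\<phi> k) x) \<longlonglongrightarrow> f x"
    "\<And>x y. \<bar>f x - f y\<bar> \<le> dist x y"
proof -
  obtain Q :: "'a set" where Q: "countable Q" "\<And>U. open U \<Longrightarrow> U \<noteq> {} \<Longrightarrow> \<exists>q\<in>Q. q \<in> U"
    using countable_dense_setE by blast
  \<comment> \<open>Dividing by \<open>1 + norm x\<close> makes the family uniformly bounded, as the
    diagonal selection requires.\<close>
  define G where "G = (\<lambda>k x. F k x / (1 + norm x))"
  have "norm (G k x) \<le> 1" for k x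
  proof -
    have "\<bar>F k x\<bar> \<le> norm x" using lip[of k x 0] F0[of k] by simp
    then show ?thesis by (simp add: G_def divide_simps)
  qed
  then obtain \<phi> where \<phi>: "strict_mono \<phi>" and lim: "\<And>x. x \<in> Q \<Longrightarrow> \<exists>l. (\<lambda>k. G (\<phi> k) x) \<longlonglongrightarrow> l"
    using function_convergent_subsequence[OF Q(1), of G 1] by blast
  have "Cauchy (\<lambda>k. F (\<phi> k) x)" for x
  proof (rule metric_CauchyI)
    fix e :: real assume e: "e > 0"
    obtain q where q: "q \<in> Q" "dist x q < e/4" using Q(2)[of "ball x (e/4)"] e by auto
    obtain l where "(\<lambda>k. G (\<phi> k) q) \<longlonglongrightarrow> l" using lim q by blast
    then have "(\<lambda>k. (1 + norm q) * G (\<phi> k) q) \<longlonglongrightarrow> (1 + norm q) * l" by (rule tendsto_mult_left)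
    moreover have "(1 + norm q) * G (\<phi> k) q = F (\<phi> k) q" for k
      unfolding G_def using norm_ge_zero[of q] by (simp add: add_nonneg_eq_0_iff)
    ultimately have "Cauchy (\<lambda>k. F (\<phi> k) q)" using LIMSEQ_imp_Cauchy by simp
    then obtain M where M: "\<And>m n. m \<ge> M \<Longrightarrow> n \<ge> M \<Longrightarrow> dist (F (\<phi> m) q) (F (\<phi> n) q) < e/4"
      using metric_CauchyD[of _ "e/4"] e by (metis divide_pos_pos zero_less_numeral)
    have "dist (F (\<phi> m) x) (F (\<phi> n) x) < e" if "m \<ge> M" "n \<ge> M" for m n
      using M[OF that] lip[of "\<phi> m" x q] lip[of "\<phi> n" x q] q(2) unfolding dist_real_def by linarith
    then show "\<exists>M. \<forall>m\<ge>M. \<forall>n\<ge>M. dist (F (\<phi> m) x) (F (\<phi> n) x) < e" by blast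
  qed
  then have "\<exists>l. (\<lambda>k. F (\<phi> k) x) \<longlonglongrightarrow> l" for x by (simp add: Cauchy_convergent_iff convergent_def)
  then obtain f where f: "\<And>x. (\<lambda>k. F (\<phi> k) x) \<longlonglongrightarrow> f x" by metis
  have "\<bar>f x - f y\<bar> \<le> dist x y" for x y
    by (rule LIMSEQ_le_const2[OF tendsto_rabs[OF tendsto_diff[OF f[of x] f[of y]]]]) (use lip in auto)
  with \<phi> f show thesis using that by blast
qed

lemma lipschitz_pointwise_diag:
  fixes F :: "nat \<Rightarrow> 'a::metric_space \<Rightarrow> real"
  assumes lip: "\<And>k x y. \<bar>F k x - F k y\<bar> \<le> dist x y" and lim: "(\<lambda>k. F k w) \<longlonglongrightarrow> l" and w: "v \<longlonglongrightarrow> w"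
  shows "(\<lambda>k. F k (v k)) \<longlonglongrightarrow> l"
proof -
  have "(\<lambda>k. F k (v k) - F k w) \<longlonglongrightarrow> 0"
    by (rule Lim_null_comparison[of _ "\<lambda>k. dist (v k) w"])
       (use lip w in \<open>auto simp: tendsto_dist_iff[symmetric]\<close>)
  from tendsto_add[OF this lim] show ?thesis by simp
qed

text \<open>The sign lets a limit of rescaled distances remember on which side of the boundary a
  point lies, while the function stays 1-Lipschitz across the boundary.\<close>

definition sdist :: "'a::euclidean_space set \<Rightarrow> 'a \<Rightarrow> real" where
  "sdist \<Omega> x = (if x \<in> \<Omega> then infdist x (frontier \<Omega>) else - infdist x (frontier \<Omega>))"

lemma abs_sdist: "\<bar>sdist \<Omega> x\<bar> = infdist x (frontier \<Omega>)"
  by (simp add: sdist_def infdist_nonneg)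

text \<open>The segment from inside to outside crosses the frontier, and the crossing point bounds
  both distances.\<close>

lemma frontier_between:
  fixes x y :: "'a::euclidean_space"
  assumes "x \<in> \<Omega>" "y \<notin> \<Omega>"
  shows "infdist x (frontier \<Omega>) + infdist y (frontier \<Omega>) \<le> dist x y"
proof -
  have "closed_segment x y \<inter> frontier \<Omega> \<noteq> {}"
    using assms by (intro connected_Int_frontier) auto
  then obtain q where q: "q \<in> closed_segment x y" "q \<in> frontier \<Omega>" by blast
  have "dist x y = dist x q + dist q y" using q(1) by (simp add: between[symmetric] between_mem_segment)
  then show ?thesis using infdist_le[OF q(2), of x] infdist_le[OF q(2), of y] by (simp add: dist_commute)
qed

lemma sdist_lipschitz: "\<bar>sdist \<Omega> x - sdist \<Omega> y\<bar> \<le> dist x y"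
proof -
  have "infdist x (frontier \<Omega>) \<le> infdist y (frontier \<Omega>) + dist x y"
       "infdist y (frontier \<Omega>) \<le> infdist x (frontier \<Omega>) + dist x y"
    using infdist_triangle[of x "frontier \<Omega>" y] infdist_triangle[of y "frontier \<Omega>" x] by (auto simp: dist_commute)
  moreover have "infdist x (frontier \<Omega>) + infdist y (frontier \<Omega>) \<le> dist x y" if "(x \<in> \<Omega>) \<noteq> (y \<in> \<Omega>)"
    using that frontier_between[of x \<Omega> y] frontier_between[of y \<Omega> x] by (cases "x \<in> \<Omega>") (auto simp: dist_commute)
  ultimately show ?thesis
    using infdist_nonneg[of x "frontier \<Omega>"] infdist_nonneg[of y "frontier \<Omega>"]
    unfolding sdist_def by (cases "x \<in> \<Omega>"; cases "y \<in> \<Omega>") auto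
qed

lemma sdist_pos_iff:
  fixes \<Omega> :: "'a::euclidean_space set"
  assumes "open \<Omega>" "frontier \<Omega> \<noteq> {}"
  shows "sdist \<Omega> x > 0 \<longleftrightarrow> x \<in> \<Omega>"
proof -
  have "infdist x (frontier \<Omega>) > 0" if "x \<in> \<Omega>"
  proof -
    have "x \<notin> frontier \<Omega>" using that assms(1) by (simp add: frontier_def interior_open)
    then have "infdist x (frontier \<Omega>) \<noteq> 0"
      using in_closed_iff_infdist_zero[OF frontier_closed assms(2)] by blast
    then show ?thesis using infdist_nonneg[of x "frontier \<Omega>"] by linarith
  qed
  then show ?thesis using infdist_nonneg[of x "frontier \<Omega>"] by (auto simp: sdist_def)
qed

lemma infdist_frontier_pos:
  fixes \<Omega> :: "'a::euclidean_space set"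
  assumes "open \<Omega>" "frontier \<Omega> \<noteq> {}" "x \<in> \<Omega>"
  shows "infdist x (frontier \<Omega>) > 0"
  using sdist_pos_iff[OF assms(1,2), of x] assms(3) by (simp add: sdist_def)

lemma mem_of_dist_less:
  fixes \<Omega> :: "'a::euclidean_space set"
  assumes "x \<in> \<Omega>" "dist x y < infdist x (frontier \<Omega>)"
  shows "y \<in> \<Omega>"
  using frontier_between[OF assms(1), of y] assms(2) infdist_nonneg[of y "frontier \<Omega>"] by force

lemma frontier_nearest:
  fixes \<Omega> :: "'a::euclidean_space set"
  assumes "frontier \<Omega> \<noteq> {}"
  obtains z where "z \<in> frontier \<Omega>" "dist x z = infdist x (frontier \<Omega>)"
  using infdist_attains_inf[OF frontier_closed assms, of x] by metis

lemma sdist_exterior_ball: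
  fixes \<Omega> :: "'a::euclidean_space set"
  assumes "frontier \<Omega> \<noteq> {}" "0 < \<rho>" "ball w \<rho> \<subseteq> interior (- \<Omega>)"
  shows "sdist \<Omega> w \<le> - \<rho>"
proof -
  obtain z where z: "z \<in> frontier \<Omega>" "dist w z = infdist w (frontier \<Omega>)" using frontier_nearest[OF assms(1)] .
  have "z \<notin> interior (- \<Omega>)" using z(1) by (simp add: frontier_def interior_closure)
  then have "infdist w (frontier \<Omega>) \<ge> \<rho>" using assms(3) z by (metis mem_ball not_le subsetD)
  moreover have "w \<in> interior (- \<Omega>)" using assms(2,3) centre_in_ball[of w \<rho>] by blast
  then have "w \<notin> \<Omega>" using interior_subset by blast
  ultimately show ?thesis by (simp add: sdist_def)
qed

text \<open>One step of a discrete Harnack chain: consecutive points \<open>p\<close>,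
  \<open>q\<close> are such that the ball of half the boundary distance around one of them contains
  the other. The \<open>max\<close> makes the relation symmetric.\<close>

definition hstep :: "'a::euclidean_space set \<Rightarrow> 'a \<Rightarrow> 'a \<Rightarrow> bool" where
  "hstep \<Omega> p q \<longleftrightarrow> p \<in> \<Omega> \<and> q \<in> \<Omega> \<and> dist p q < max (infdist p (frontier \<Omega>)) (infdist q (frontier \<Omega>)) / 2"

text \<open>Both memberships are stated because a chain of length 0 says nothing about its end; the
  length is only bounded by \<open>N\<close>, which makes the relation monotone in
  \<open>N\<close>.\<close>

definition hconn :: "'a::euclidean_space set \<Rightarrow> nat \<Rightarrow> 'a \<Rightarrow> 'a \<Rightarrow> bool" where
  "hconn \<Omega> N p q \<longleftrightarrow> p \<in> \<Omega> \<and> q \<in> \<Omega> \<and> (\<exists>k\<le>N. (hstep \<Omega> ^^ k) p q)"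

lemma hconn_mem: "hconn \<Omega> N p q \<Longrightarrow> p \<in> \<Omega>" "hconn \<Omega> N p q \<Longrightarrow> q \<in> \<Omega>"
  by (auto simp: hconn_def)

lemma hconn_refl: "p \<in> \<Omega> \<Longrightarrow> hconn \<Omega> N p p"
  unfolding hconn_def by (auto intro!: exI[of _ 0])

lemma hconn_mono: "hconn \<Omega> N p q \<Longrightarrow> N \<le> M \<Longrightarrow> hconn \<Omega> M p q"
  unfolding hconn_def by (meson order_trans)

lemma hconn_trans: "hconn \<Omega> N p q \<Longrightarrow> hconn \<Omega> M q r \<Longrightarrow> hconn \<Omega> (N + M) p r"
  unfolding hconn_def by (metis (no_types, opaque_lifting) add_mono relpowp_trans)

lemma hconn_step: "hstep \<Omega> p q \<Longrightarrow> hconn \<Omega> 1 p q"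
  unfolding hconn_def using relpowp_1[of "hstep \<Omega>"] by (metis hstep_def order_refl)

lemma hstep_sym: "hstep \<Omega> p q \<Longrightarrow> hstep \<Omega> q p"
  by (simp add: hstep_def dist_commute max.commute)

lemma relpowp_sym:
  assumes "\<And>x y. R x y \<Longrightarrow> R y x"
  shows "(R ^^ k) x y \<Longrightarrow> (R ^^ k) y x"
proof (induction k arbitrary: y)
  case (Suc k)
  then obtain z where "(R ^^ k) x z" "R z y" by auto
  then show ?case using Suc.IH assms relpowp_Suc_I2 by metis
qed auto

lemma hconn_sym: "hconn \<Omega> N p q \<Longrightarrow> hconn \<Omega> N q p"
  unfolding hconn_def using relpowp_sym[of "hstep \<Omega>", OF hstep_sym] by blast

lemma hstepI: "p \<in> \<Omega> \<Longrightarrow> dist p q < infdist p (frontier \<Omega>) / 2 \<Longrightarrow> hstep \<Omega> p q"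
  unfolding hstep_def using mem_of_dist_less[of p \<Omega> q] infdist_nonneg[of p "frontier \<Omega>"] by auto

section \<open>Lengths of curves, and chains along non-tangential paths\<close>

lemma curve_length_cons:
  assumes t: "t \<le> \<tau>" "\<tau> \<le> b" and len: "curve_length \<gamma> t b \<le> ennreal (h + L)" and h: "h \<le> dist (\<gamma> t) (\<gamma> \<tau>)" and L: "L \<ge> 0" "h \<ge> 0"
  shows "curve_length \<gamma> \<tau> b \<le> ennreal L"
  unfolding curve_length_def
proof (rule SUP_least)
  fix p assume "p \<in> {p. sorted p \<and> set p \<subseteq> {\<tau>..b}}"
  then have p: "sorted p" "set p \<subseteq> {\<tau>..b}" by auto
  let ?S = "\<lambda>p. \<Sum>i<length p - 1. dist (\<gamma> (p ! i)) (\<gamma> (p ! Suc i))"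
  \<comment> \<open>Prepending \<open>t\<close> and \<open>\<tau>\<close> to a partition of the tail
    adds at least the chord from \<open>\<gamma> t\<close> to
    \<open>\<gamma> \<tau>\<close>.\<close>
  have "?S p + h \<le> ?S (t # \<tau> # p)"
  proof (cases p)
    case Nil
    then show ?thesis using h by simp
  next
    case (Cons a p')
    have "?S (t # \<tau> # p) = dist (\<gamma> t) (\<gamma> \<tau>) + (dist (\<gamma> \<tau>) (\<gamma> a) + ?S p)"
      using Cons by (simp add: sum.lessThan_Suc_shift del: sum.lessThan_Suc)
    then show ?thesis using h zero_le_dist[of "\<gamma> \<tau>" "\<gamma> a"] by linarith
  qed
  moreover have "ennreal (?S (t # \<tau> # p)) \<le> curve_length \<gamma> t b"
    unfolding curve_length_def
    by (rule SUP_upper) (use p t in \<open>auto simp: subset_iff; force\<close>)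
  then have "ennreal (?S (t # \<tau> # p)) \<le> ennreal (h + L)" using len by (rule order_trans)
  then have "?S (t # \<tau> # p) \<le> h + L" using L by (subst (asm) ennreal_le_iff) auto
  ultimately have "?S p \<le> L" by linarith
  then show "ennreal (?S p) \<le> ennreal L" by (rule ennreal_leI)
qed

lemma dist_le_curve_length:
  assumes "a \<le> s" "s \<le> t" "t \<le> b"
  shows "ennreal (dist (\<gamma> s) (\<gamma> t)) \<le> curve_length \<gamma> a b"
  unfolding curve_length_def
  by (rule SUP_upper2[of "[s,t]"]) (use assms in auto)

text \<open>The length up to \<open>t\<close> dominates the chord up to the earlier parameter
  \<open>s\<close>. Hence a path that has once been \<open>\<sigma>\<close> away from its start
  keeps distance \<open>\<sigma> / D\<close> from the boundary ever after.\<close>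

lemma nontangential_lower:
  assumes nt: "nontangential E D \<gamma>" and D: "D \<ge> 1" and t: "0 \<le> s" "s \<le> t" "t \<le> 1"
    and \<sigma>: "\<sigma> \<le> dist (\<gamma> 0) (\<gamma> s)"
  shows "\<sigma> / D \<le> infdist (\<gamma> t) E"
proof -
  have "ennreal \<sigma> \<le> ennreal (dist (\<gamma> 0) (\<gamma> s))" using \<sigma> by (rule ennreal_leI)
  also have "\<dots> \<le> curve_length \<gamma> 0 t" using t by (intro dist_le_curve_length) auto
  also have "\<dots> \<le> ennreal (D * infdist (\<gamma> t) E)" using nt t unfolding nontangential_def by auto
  finally have "\<sigma> \<le> D * infdist (\<gamma> t) E"
    using D infdist_nonneg[of "\<gamma> t" E] by (subst (asm) ennreal_le_iff) auto
  then show ?thesis using D by (simp add: field_simps)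
qed

text \<open>Walk along the path with chords of length \<open>\<sigma> / (4 * D)\<close>. Each is
  shorter than half the boundary distance, which is at least \<open>\<sigma> / D\<close> from
  \<open>t0\<close> on, and each uses up at least its own length of the curve, so \<open>m\<close>
  bounds their number.\<close>

lemma nontangential_hconn:
  assumes op: "open \<Omega>" "frontier \<Omega> \<noteq> {}" and g: "path_into \<Omega> \<gamma> z Y" and nt: "nontangential (frontier \<Omega>) D \<gamma>"
    and D: "D \<ge> 1" and \<sigma>: "0 < \<sigma>" and t0: "t0 \<in> {0..1}" "\<sigma> \<le> dist z (\<gamma> t0)"
  shows "t \<in> {t0..1} \<Longrightarrow> curve_length \<gamma> t 1 \<le> ennreal (m * (\<sigma> / (4 * D))) \<Longrightarrow> hconn \<Omega> m (\<gamma> t) Y"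
proof (induction m arbitrary: t)
  have g0: "\<gamma> 0 = z" "\<gamma> 1 = Y" "path \<gamma>" "\<And>t. t \<in> {0<..1} \<Longrightarrow> \<gamma> t \<in> \<Omega>"
    using g by (auto simp: path_into_def pathstart_def pathfinish_def)
  have t0p: "t0 > 0" using t0 g0 \<sigma> by (cases "t0 = 0") auto
  have del: "\<sigma> / D \<le> infdist (\<gamma> \<tau>) (frontier \<Omega>)" if "\<tau> \<in> {t0..1}" for \<tau>
    by (rule nontangential_lower[OF nt D, of t0]) (use that t0 g0 in auto)
  let ?h = "\<sigma> / (4 * D)"
  have h: "?h > 0" "?h < \<sigma> / D / 2" using \<sigma> D by (auto simp: field_simps)
  {
    case 0
    have "ennreal (dist (\<gamma> t) (\<gamma> 1)) \<le> curve_length \<gamma> t 1" using 0 by (intro dist_le_curve_length) auto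
    also have "\<dots> \<le> 0" using 0 by simp
    finally have "\<gamma> t = Y" using g0 by (simp add: ennreal_eq_0_iff)
    then show ?case using hconn_refl g0 by (metis greaterThanAtMost_iff zero_less_one order_refl)
  next
    case (Suc m)
    have tO: "\<gamma> t \<in> \<Omega>" using g0(4) t0p Suc.prems by auto
    show ?case
    proof (cases "\<forall>\<tau>\<in>{t..1}. dist (\<gamma> t) (\<gamma> \<tau>) \<le> ?h")
      case True
      then have "dist (\<gamma> t) Y \<le> ?h" using Suc.prems(1) g0(2) by force
      then have "hstep \<Omega> (\<gamma> t) Y" using del[OF Suc.prems(1)] h by (intro hstepI tO) auto
      then show ?thesis using hconn_step hconn_mono by (metis Suc_le_mono le0 One_nat_def)
    next
      case False
      then obtain \<tau> where \<tau>: "\<tau> \<in> {t..1}" "dist (\<gamma> t) (\<gamma> \<tau>) > ?h" by force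
      have "continuous_on {0..1} \<gamma>" using g0(3) by (simp add: path_def)
      then have "continuous_on {t..\<tau>} (\<lambda>s. dist (\<gamma> t) (\<gamma> s))"
        using Suc.prems(1) \<tau> t0p by (intro continuous_intros) (auto elim: continuous_on_subset)
      \<comment> \<open>A chord of length exactly \<open>?h\<close> is one \<open>hstep\<close> and
        lowers the remaining length by one unit of the induction.\<close>
      then obtain s where s: "t \<le> s" "s \<le> \<tau>" "dist (\<gamma> t) (\<gamma> s) = ?h"
        using IVT'[of "\<lambda>s. dist (\<gamma> t) (\<gamma> s)" t ?h \<tau>] \<tau> h by auto
      have "curve_length \<gamma> s 1 \<le> ennreal (m * ?h)"
        by (rule curve_length_cons[of t s 1 \<gamma> ?h]) (use s \<tau> Suc.prems h \<sigma> D in \<open>auto simp: algebra_simps add_divide_distrib\<close>)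
      then have "hconn \<Omega> m (\<gamma> s) Y" using Suc.IH s \<tau> Suc.prems by auto
      moreover have "hstep \<Omega> (\<gamma> t) (\<gamma> s)" using del[OF Suc.prems(1)] h s by (intro hstepI tO) auto
      ultimately show ?thesis using hconn_trans[OF hconn_step] by (metis plus_1_eq_Suc)
    qed
  }
qed

section \<open>Lines meet a set of finite upper content in finitely many points\<close>


lemma finite_gap:
  fixes T :: "real set"
  assumes "finite T"
  obtains \<mu> where "\<mu> > 0" "\<And>t t'. t \<in> T \<Longrightarrow> t' \<in> T \<Longrightarrow> t \<noteq> t' \<Longrightarrow> \<mu> \<le> \<bar>t - t'\<bar>"
proof
  let ?D = "(\<lambda>(t,t'). \<bar>t - t'\<bar>) ` {(t,t'). t \<in> T \<and> t' \<in> T \<and> t \<noteq> t'}"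
  have fin: "finite ?D" by (rule finite_imageI, rule finite_subset[of _ "T \<times> T"]) (use assms in auto)
  show "Min (insert 1 ?D) > 0" using fin by (subst Min_gr_iff) auto
  show "Min (insert 1 ?D) \<le> \<bar>t - t'\<bar>" if "t \<in> T" "t' \<in> T" "t \<noteq> t'" for t t'
    by (rule Min_le) (use fin that in auto)
qed

text \<open>The packing bound provides a separated subset of largest cardinality; a point that it
  failed to cover could be added to it.\<close>

lemma maximal_separated_cover:
  fixes Z :: "'a::metric_space set"
  assumes pack: "\<And>P. finite P \<Longrightarrow> P \<subseteq> Z \<Longrightarrow> (\<And>x y. x \<in> P \<Longrightarrow> y \<in> P \<Longrightarrow> x \<noteq> y \<Longrightarrow> s \<le> dist x y) \<Longrightarrow> real (card P) \<le> K"
    and s: "s > 0"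
  obtains P where "finite P" "Z \<subseteq> (\<Union>p\<in>P. ball p s)" "real (card P) \<le> K"
proof -
  define \<P> where "\<P> = {P. finite P \<and> P \<subseteq> Z \<and> (\<forall>x\<in>P. \<forall>y\<in>P. x \<noteq> y \<longrightarrow> s \<le> dist x y)}"
  have bd: "card P \<le> nat \<lfloor>K\<rfloor>" if "P \<in> \<P>" for P
    using pack[of P] that unfolding \<P>_def by (auto simp: le_nat_floor)
  have "{} \<in> \<P>" by (auto simp: \<P>_def)
  then obtain P where P: "P \<in> \<P>" "\<And>Q. Q \<in> \<P> \<Longrightarrow> card Q \<le> card P"
    using ex_has_greatest_nat[of "\<lambda>P. P \<in> \<P>" "{}" card "Suc (nat \<lfloor>K\<rfloor>)"] bd by (auto simp: less_Suc_eq_le)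
  have "Z \<subseteq> (\<Union>p\<in>P. ball p s)"
  proof (rule ccontr)
    assume "\<not> ?thesis"
    then obtain z where z: "z \<in> Z" "\<And>p. p \<in> P \<Longrightarrow> s \<le> dist p z"
      unfolding subset_iff UN_iff mem_ball by (meson not_less)
    then have "z \<notin> P" using s by force
    moreover have "insert z P \<in> \<P>" using P(1) z by (auto simp: \<P>_def dist_commute)
    then have "card (insert z P) \<le> card P" by (rule P(2))
    ultimately show False using P(1) by (auto simp: \<P>_def)
  qed
  with P(1) show thesis using that[of P] pack[of P] by (auto simp: \<P>_def)
qed

text \<open>The box is a tube in direction \<open>e\<close> around \<open>p\<close>. It contains
  every point of norm at most \<open>R\<close> whose parallel to \<open>e\<close> passes within
  \<open>s\<close> of \<open>p\<close>.\<close>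

lemma emeasure_tube:
  fixes e p :: "'a::euclidean_space"
  assumes e: "e \<in> Basis" and dim: "DIM('a) = Suc n" and R: "R \<ge> 0" and s: "s \<ge> 0"
  defines "l \<equiv> (\<Sum>b\<in>Basis. (if b = e then - R else p \<bullet> b - s) *\<^sub>R b)"
    and "u \<equiv> (\<Sum>b\<in>Basis. (if b = e then R else p \<bullet> b + s) *\<^sub>R b)"
  shows "emeasure lborel (cbox l u) = ennreal (2 * R * (2 * s) ^ n)"
    and "x \<in> cbox l u \<longleftrightarrow> \<bar>x \<bullet> e\<bar> \<le> R \<and> (\<forall>b\<in>Basis - {e}. \<bar>x \<bullet> b - p \<bullet> b\<bar> \<le> s)"
proof -
  have lb: "l \<bullet> b = (if b = e then - R else p \<bullet> b - s)" "u \<bullet> b = (if b = e then R else p \<bullet> b + s)" if "b \<in> Basis" for b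
    using that by (auto simp: l_def u_def)
  have "emeasure lborel (cbox l u) = ennreal (\<Prod>b\<in>Basis. (u - l) \<bullet> b)"
    by (rule emeasure_lborel_cbox) (use lb R s in auto)
  also have "(\<Prod>b\<in>Basis. (u - l) \<bullet> b) = (\<Prod>b\<in>Basis. if b = e then 2 * R else 2 * s)"
    by (rule prod.cong) (auto simp: inner_diff_left lb)
  also have "\<dots> = 2 * R * (\<Prod>b\<in>Basis - {e}. if b = e then 2 * R else 2 * s)"
    using e by (subst prod.remove[of _ e]) auto
  also have "(\<Prod>b\<in>Basis - {e}. if b = e then 2 * R else 2 * s) = (\<Prod>b\<in>Basis - {e}. 2 * s)"
    by (rule prod.cong) auto
  also have "\<dots> = (2 * s) ^ n" using e dim by (simp add: card_Diff_singleton)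
  finally show "emeasure lborel (cbox l u) = ennreal (2 * R * (2 * s) ^ n)" .
  show "x \<in> cbox l u \<longleftrightarrow> \<bar>x \<bullet> e\<bar> \<le> R \<and> (\<forall>b\<in>Basis - {e}. \<bar>x \<bullet> b - p \<bullet> b\<bar> \<le> s)"
    unfolding mem_box using e lb by (auto simp: abs_le_iff algebra_simps split: if_splits; force)
qed

text \<open>Let \<open>g j\<close> count the tubes over an \<open>s j\<close>-net of
  \<open>Z\<close>. The packing bound makes the integrals of \<open>g j\<close> bounded in
  \<open>j\<close>, so by Fatou the lower limit is finite almost everywhere; on a line with
  infinitely many points of \<open>Z\<close> it is infinite.\<close>

lemma negligible_infinite_fibres:
  fixes Z :: "'a::euclidean_space set" and C R :: real
  assumes e: "e \<in> Basis" and dim: "DIM('a) = Suc n"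
    and pack: "\<And>(s::real) P. 0 < s \<Longrightarrow> s \<le> 1 \<Longrightarrow> finite P \<Longrightarrow> P \<subseteq> Z \<Longrightarrow>
      (\<And>x y. x \<in> P \<Longrightarrow> y \<in> P \<Longrightarrow> x \<noteq> y \<Longrightarrow> s \<le> dist x y) \<Longrightarrow> card P * s ^ n \<le> C"
  shows "negligible {x \<in> cball 0 R. infinite {t. x + t *\<^sub>R e \<in> Z}}" (is "negligible ?N")
proof (cases "R \<ge> 0")
  case False
  then show ?thesis by simp
next
  case R: True
  define s where "s = (\<lambda>j::nat. 1 / (real j + 1))"
  have s: "0 < s j" "s j \<le> 1" for j by (auto simp: s_def)
  have "\<exists>P. finite P \<and> Z \<subseteq> (\<Union>p\<in>P. ball p (s j)) \<and> card P * s j ^ n \<le> C" for j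
  proof -
    have "real (card P) \<le> C / s j ^ n" if "finite P" "P \<subseteq> Z" "\<And>x y. x \<in> P \<Longrightarrow> y \<in> P \<Longrightarrow> x \<noteq> y \<Longrightarrow> s j \<le> dist x y" for P
      using pack[OF s that] s[of j] by (simp add: pos_le_divide_eq)
    then obtain P where "finite P" "Z \<subseteq> (\<Union>p\<in>P. ball p (s j))" "real (card P) \<le> C / s j ^ n"
      using maximal_separated_cover[OF _ s(1)[of j], of Z "C / s j ^ n"] by blast
    then show ?thesis using s[of j] by (auto simp: pos_le_divide_eq)
  qed
  then obtain P where P: "\<And>j. finite (P j)" "\<And>j. Z \<subseteq> (\<Union>p\<in>P j. ball p (s j))" "\<And>j. card (P j) * s j ^ n \<le> C"
    by metis
  define l where "l = (\<lambda>j p. (\<Sum>b\<in>Basis. (if b = e then - R else p \<bullet> b - s j) *\<^sub>R b))"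
  define u where "u = (\<lambda>j p. (\<Sum>b\<in>Basis. (if b = e then R else p \<bullet> b + s j) *\<^sub>R b))"
  have em: "emeasure lborel (cbox (l j p) (u j p)) = ennreal (2 * R * (2 * s j) ^ n)" for j p
    unfolding l_def u_def by (rule emeasure_tube(1)[OF e dim R less_imp_le[OF s(1)]])
  have mem: "x \<in> cbox (l j p) (u j p) \<longleftrightarrow> \<bar>x \<bullet> e\<bar> \<le> R \<and> (\<forall>b\<in>Basis - {e}. \<bar>x \<bullet> b - p \<bullet> b\<bar> \<le> s j)" for x j p
    unfolding l_def u_def by (rule emeasure_tube(2)[OF e dim R less_imp_le[OF s(1)]])
  define g :: "nat \<Rightarrow> 'a \<Rightarrow> ennreal" where "g = (\<lambda>j x. \<Sum>p\<in>P j. indicator (cbox (l j p) (u j p)) x)"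
  have gm: "g j \<in> borel_measurable lborel" for j unfolding g_def by measurable
  have gint: "(\<integral>\<^sup>+x. g j x \<partial>lborel) \<le> ennreal (2 * R * 2 ^ n * C)" for j
  proof -
    have "(\<integral>\<^sup>+x. g j x \<partial>lborel) = (\<Sum>p\<in>P j. emeasure lborel (cbox (l j p) (u j p)))"
      unfolding g_def by (subst nn_integral_sum) auto
    also have "\<dots> = ennreal (card (P j)) * ennreal (2 * R * (2 * s j) ^ n)"
      by (simp add: em ennreal_of_nat_eq_real_of_nat)
    also have "\<dots> = ennreal (2 * R * 2 ^ n * (card (P j) * s j ^ n))"
      using R s[of j] by (subst ennreal_mult[symmetric]) (auto simp: power_mult_distrib mult_ac)
    also have "\<dots> \<le> ennreal (2 * R * 2 ^ n * C)"
      using R P(3)[of j] by (intro ennreal_leI mult_left_mono) auto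
    finally show ?thesis .
  qed
  have lm: "(\<lambda>x. liminf (\<lambda>j. g j x)) \<in> borel_measurable lborel" using gm by measurable
  have "(\<integral>\<^sup>+x. liminf (\<lambda>j. g j x) \<partial>lborel) \<le> liminf (\<lambda>j. \<integral>\<^sup>+x. g j x \<partial>lborel)"
    by (rule nn_integral_liminf[OF gm])
  also have "\<dots> \<le> liminf (\<lambda>j. ennreal (2 * R * 2 ^ n * C))"
    by (rule Liminf_mono) (use gint in auto)
  also have "\<dots> = ennreal (2 * R * 2 ^ n * C)" by (simp add: Liminf_const)
  finally have "(\<integral>\<^sup>+x. liminf (\<lambda>j. g j x) \<partial>lborel) \<noteq> \<infinity>" by (auto simp: top_unique)
  then have "AE x in lborel. liminf (\<lambda>j. g j x) \<noteq> \<infinity>" by (rule nn_integral_PInf_AE[OF lm])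
  then obtain N where N: "\<And>x. x \<in> space lborel - N \<Longrightarrow> liminf (\<lambda>j. g j x) \<noteq> \<infinity>" "N \<in> null_sets lborel"
    by (rule AE_E3) blast
  have "?N \<subseteq> N"
  proof
    fix x assume x: "x \<in> ?N"
    \<comment> \<open>Among the points of the fibre choose \<open>m\<close>. As soon as
      \<open>2 * s j\<close> is below their smallest gap, they belong to different net points, whose
      \<open>m\<close> tubes all contain \<open>x\<close>.\<close>
    have "of_nat m \<le> liminf (\<lambda>j. g j x)" for m :: nat
    proof (rule Liminf_bounded)
      obtain T where T: "finite T" "card T = m" "T \<subseteq> {t. x + t *\<^sub>R e \<in> Z}"
        using infinite_arbitrarily_large x by blast
      obtain \<mu> where \<mu>: "\<mu> > 0" "\<And>t t'. t \<in> T \<Longrightarrow> t' \<in> T \<Longrightarrow> t \<noteq> t' \<Longrightarrow> \<mu> \<le> \<bar>t - t'\<bar>" using finite_gap[OF T(1)] by blast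
      obtain J :: nat where J: "2 / \<mu> < real J" using reals_Archimedean2 by blast
      show "\<forall>\<^sub>F j in sequentially. of_nat m \<le> g j x"
        unfolding eventually_sequentially
      proof (intro exI allI impI)
        fix j assume j: "J \<le> j"
        have "2 / \<mu> < real j + 1" using J j by linarith
        then have sm: "2 * s j < \<mu>" using \<mu>(1) unfolding s_def by (simp add: field_simps)
        have "\<forall>t\<in>T. \<exists>p\<in>P j. dist p (x + t *\<^sub>R e) < s j" using T(3) P(2)[of j] by fastforce
        then obtain h where h: "\<And>t. t \<in> T \<Longrightarrow> h t \<in> P j" "\<And>t. t \<in> T \<Longrightarrow> dist (h t) (x + t *\<^sub>R e) < s j" by metis
        have inj: "inj_on h T"
        proof (rule inj_onI, rule ccontr)
          fix t t' assume t: "t \<in> T" "t' \<in> T" "h t = h t'" "t \<noteq> t'"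
          have "dist (x + t *\<^sub>R e) (x + t' *\<^sub>R e) \<le> dist (h t) (x + t *\<^sub>R e) + dist (h t) (x + t' *\<^sub>R e)"
            by (rule dist_triangle3)
          also have "\<dots> < 2 * s j" using h(2)[OF t(1)] h(2)[OF t(2)] t(3) by simp
          finally have "norm ((t - t') *\<^sub>R e) < 2 * s j" by (simp add: dist_norm algebra_simps)
          then show False using \<mu>(2)[OF t(1,2,4)] sm e by simp
        qed
        have hin: "x \<in> cbox (l j (h t)) (u j (h t))" if "t \<in> T" for t
          unfolding mem
        proof (intro conjI ballI)
          show "\<bar>x \<bullet> e\<bar> \<le> R" using x Basis_le_norm[OF e, of x] by simp
          fix b assume b: "b \<in> Basis - {e}"
          then have "(x + t *\<^sub>R e - h t) \<bullet> b = x \<bullet> b - h t \<bullet> b" using e by (auto simp: inner_diff_left inner_add_left inner_Basis)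
          moreover have "\<bar>(x + t *\<^sub>R e - h t) \<bullet> b\<bar> \<le> norm (x + t *\<^sub>R e - h t)" using b by (intro Basis_le_norm) auto
          ultimately show "\<bar>x \<bullet> b - h t \<bullet> b\<bar> \<le> s j" using h(2)[OF that] by (simp add: dist_norm norm_minus_commute)
        qed
        have "of_nat m = (\<Sum>t\<in>T. 1 :: ennreal)" using T by simp
        also have "\<dots> = (\<Sum>t\<in>T. indicator (cbox (l j (h t)) (u j (h t))) x)" using hin by (intro sum.cong) auto
        also have "\<dots> = (\<Sum>p\<in>h ` T. indicator (cbox (l j p) (u j p)) x)" by (simp add: sum.reindex[OF inj])
        also have "\<dots> \<le> g j x" unfolding g_def using h(1) P(1) by (intro sum_mono2) auto
        finally show "of_nat m \<le> g j x" .
      qed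
    qed
    then have "liminf (\<lambda>j. g j x) = \<infinity>"
      using ennreal_Ex_less_of_nat[of "liminf (\<lambda>j. g j x)"] by (metis infinity_ennreal_def leD top.not_eq_extremum)
    then show "x \<in> N" using N(1)[of x] by auto
  qed
  moreover have "negligible N" using null_sets_completionI[OF N(2)] by (simp add: negligible_iff_null_sets)
  ultimately show ?thesis using negligible_subset by blast
qed

section \<open>Clean crossings\<close>


text \<open>Move from \<open>u\<close> to \<open>v\<close> one coordinate at a time. If each move
  left \<open>V\<close> only on a null set, almost all of \<open>ball u \<tau>\<close> translated by
  \<open>v - u\<close> would stay in \<open>V\<close>; but this translate is
  \<open>ball v \<tau>\<close>, which avoids \<open>V\<close>.\<close>

lemma axis_step:
  fixes u v :: "'a::euclidean_space"
  assumes \<tau>: "\<tau> > 0" and uV: "ball u \<tau> \<subseteq> V" and vV: "ball v \<tau> \<inter> V = {}" and uv: "norm u \<le> 1" "norm v \<le> 1" "\<tau> \<le> 1"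
  obtains e a where "e \<in> Basis" "\<bar>a\<bar> \<le> 2"
    "\<not> negligible {y \<in> cball 0 (2 + 2 * real DIM('a)). y \<in> V \<and> y + a *\<^sub>R e \<notin> V}"
proof -
  define w where "w = (\<lambda>S. \<Sum>b\<in>S. ((v - u) \<bullet> b) *\<^sub>R b)"
  have a2: "\<bar>(v - u) \<bullet> b\<bar> \<le> 2" if "b \<in> Basis" for b
    using Basis_le_norm[OF that, of "v - u"] norm_triangle_ineq4[of v u] uv by linarith
  \<comment> \<open>The radius contains all intermediate positions: the start has norm below 2 and
    every coordinate move has length at most 2.\<close>
  let ?N = "\<lambda>e. {y \<in> cball 0 (2 + 2 * real DIM('a)). y \<in> V \<and> y + ((v - u) \<bullet> e) *\<^sub>R e \<notin> V}"
  have "\<exists>e\<in>Basis. \<not> negligible (?N e)"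
  proof (rule ccontr)
    assume "\<not> ?thesis"
    then have neg: "\<And>e. e \<in> Basis \<Longrightarrow> negligible (?N e)" by blast
    have "negligible {x \<in> ball u \<tau>. x + w S \<notin> V}" if "S \<subseteq> Basis" for S
      using finite_subset[OF that finite_Basis] that
    proof (induction S rule: finite_induct)
      case empty
      have "{x \<in> ball u \<tau>. x + w {} \<notin> V} = {}" using uV by (auto simp: w_def)
      then show ?case by (simp only: negligible_empty)
    next
      case (insert e S)
      have we: "w (insert e S) = w S + ((v - u) \<bullet> e) *\<^sub>R e" using insert.hyps by (simp add: w_def)
      have "norm (w S) \<le> real (card S) * 2"
        unfolding w_def by (rule sum_norm_bound) (use a2 insert.prems in auto)
      also have "\<dots> \<le> real DIM('a) * 2" using card_mono[OF finite_Basis, of S] insert.prems by simp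
      finally have nw: "norm (w S) \<le> 2 * real DIM('a)" by simp
      have "{x \<in> ball u \<tau>. x + w (insert e S) \<notin> V} \<subseteq> {x \<in> ball u \<tau>. x + w S \<notin> V} \<union> (+) (- w S) ` ?N e"
      proof
        fix x assume x: "x \<in> {x \<in> ball u \<tau>. x + w (insert e S) \<notin> V}"
        have "norm x < 2" using x uv norm_triangle_sub[of x u] by (auto simp: dist_norm norm_minus_commute)
        then have "norm (x + w S) \<le> 2 + 2 * real DIM('a)" using nw norm_triangle_ineq[of x "w S"] by linarith
        then have "x + w S \<in> ?N e" if "x + w S \<in> V" using that x we by (auto simp: add.assoc)
        moreover have "x = - w S + (x + w S)" by simp
        ultimately show "x \<in> {x \<in> ball u \<tau>. x + w S \<notin> V} \<union> (+) (- w S) ` ?N e" using x by blast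
      qed
      moreover have "negligible ({x \<in> ball u \<tau>. x + w S \<notin> V} \<union> (+) (- w S) ` ?N e)"
        using insert neg[of e] by (intro negligible_Un negligible_translation) auto
      ultimately show ?case using negligible_subset by blast
    qed
    then have "negligible {x \<in> ball u \<tau>. x + w Basis \<notin> V}" by blast
    moreover have "x + w Basis \<notin> V" if "x \<in> ball u \<tau>" for x
    proof -
      have "w Basis = v - u" unfolding w_def by (rule euclidean_representation)
      then have "v - (x + w Basis) = u - x" by simp
      then have "x + w Basis \<in> ball v \<tau>" using that unfolding mem_ball dist_norm by metis
      then show ?thesis using vV by blast
    qed
    then have "{x \<in> ball u \<tau>. x + w Basis \<notin> V} = ball u \<tau>" by blast
    ultimately have "negligible (ball u \<tau>)" by simp
    then show False using \<tau> open_not_negligible[of "ball u \<tau>"] by simp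
  qed
  then show thesis using that a2 by blast
qed

text \<open>Take the first parameter at which the line is outside \<open>V\<close>. Since
  \<open>V\<close> is open and relatively closed in \<open>{f > 0}\<close>, \<open>f\<close>
  vanishes there; since the line has finitely many zeros, \<open>f\<close> has constant sign shortly
  afterwards.\<close>

lemma isolated_crossing:
  fixes f :: "'a::euclidean_space \<Rightarrow> real"
  assumes cont: "continuous_on UNIV f" and V: "open V" "V \<subseteq> {x. f x > 0}" "open ({x. f x > 0} - V)"
    and y: "y \<in> V" "y + w \<notin> V" and fin: "finite {t \<in> {0..2}. f (y + t *\<^sub>R w) = 0}"
  obtains t \<sigma> where "t \<in> {0..1}" "\<sigma> > 0" "f (y + t *\<^sub>R w) = 0"
    "\<And>r. t - \<sigma> < r \<Longrightarrow> r < t \<Longrightarrow> y + r *\<^sub>R w \<in> V"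
    "(\<forall>r\<in>{t<..<t+\<sigma>}. f (y + r *\<^sub>R w) < 0) \<or> (\<forall>r\<in>{t<..<t+\<sigma>}. f (y + r *\<^sub>R w) > 0)"
proof -
  define L where "L = (\<lambda>t. y + t *\<^sub>R w)"
  have cL: "continuous_on A L" for A unfolding L_def by (intro continuous_intros)
  have cf: "continuous_on A (\<lambda>t. f (L t))" for A
    by (rule continuous_on_compose2[OF cont cL]) auto
  define T where "T = {0..1} \<inter> L -` (- V)"
  have "closed T" unfolding T_def by (intro continuous_closed_preimage cL) (use V in auto)
  then have "compact T" by (metis T_def bounded_closed_interval bounded_Int compact_eq_bounded_closed)
  moreover have "1 \<in> T" using y by (simp add: T_def L_def)
  ultimately obtain t where t: "t \<in> T" "\<And>r. r \<in> T \<Longrightarrow> t \<le> r" using compact_attains_inf[of T] by blast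
  have t01: "t \<in> {0..1}" "L t \<notin> V" using t by (auto simp: T_def)
  have before: "L r \<in> V" if "0 \<le> r" "r < t" for r using t(2)[of r] that t01 by (auto simp: T_def)
  have t0: "t > 0" using t01 y by (cases "t = 0") (auto simp: L_def)
  have ft: "f (L t) = 0"
  proof (rule ccontr)
    assume nz: "f (L t) \<noteq> 0"
    \<comment> \<open>The part of the complement of \<open>V\<close> where \<open>f\<close> is not
      zero. It is open, so entering it from \<open>V\<close> at the first exit is
      impossible.\<close>
    define O' where "O' = {x. f x < 0} \<union> ({x. f x > 0} - V)"
    have "open {x. f x < 0}" using cont by (intro open_Collect_less) auto
    then have "open O'" unfolding O'_def using V(3) by auto
    then have "open (L -` O')" using cL[of UNIV] by (simp add: open_vimage)
    moreover have "t \<in> L -` O'" using nz t01 by (auto simp: O'_def)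
    ultimately obtain d where d: "d > 0" "ball t d \<subseteq> L -` O'" by (meson open_contains_ball)
    let ?r = "max 0 (t - d/2)"
    have "?r \<in> ball t d" using d t0 by (auto simp: dist_real_def)
    then have "L ?r \<in> O'" using d by auto
    moreover have "L ?r \<in> V" using before[of ?r] t0 d by auto
    ultimately show False using V(2) by (auto simp: O'_def)
  qed
  define F where "F = {r. t < r \<and> r \<le> 2 \<and> f (L r) = 0}"
  have finF: "finite F" by (rule finite_subset[OF _ fin]) (use t01 in \<open>auto simp: F_def L_def\<close>)
  \<comment> \<open>The cap 1 keeps \<open>t + s\<close> within \<open>{0..2}\<close>, where the
    zeros are known to be finite, and keeps \<open>Min\<close> meaningful when there is no later
    zero.\<close>
  define s where "s = Min (insert 1 ((\<lambda>r. r - t) ` F))"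
  have s: "s > 0" "s \<le> 1" "\<And>r. r \<in> F \<Longrightarrow> s \<le> r - t"
    unfolding s_def using finF by (auto simp: F_def)
  have nz: "f (L r) \<noteq> 0" if "r \<in> {t<..<t+s}" for r
    using s(3)[of r] that s(2) t01 by (auto simp: F_def)
  have sign: "(\<forall>r\<in>{t<..<t+s}. f (L r) < 0) \<or> (\<forall>r\<in>{t<..<t+s}. f (L r) > 0)"
  proof (rule ccontr)
    assume "\<not> ?thesis"
    then obtain r r' where r: "r \<in> {t<..<t+s}" "r' \<in> {t<..<t+s}" "f (L r) > 0" "f (L r') < 0"
      using nz by (metis linorder_neqE_linordered_idom)
    have "connected ((\<lambda>r. f (L r)) ` {t<..<t+s})" by (intro connected_continuous_image cf) auto
    then have "0 \<in> (\<lambda>r. f (L r)) ` {t<..<t+s}"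
      using connectedD_interval[of _ "f (L r')" "f (L r)" 0] r by (auto simp: less_imp_le)
    then show False using nz by force
  qed
  show thesis
  \<comment> \<open>The bound by \<open>t\<close> keeps the parameters before the crossing
    nonnegative, as \<open>before\<close> requires.\<close>
  proof (rule that[of t "min s t"])
    show "(\<forall>r\<in>{t<..<t+min s t}. f (y + r *\<^sub>R w) < 0) \<or> (\<forall>r\<in>{t<..<t+min s t}. f (y + r *\<^sub>R w) > 0)"
      using sign unfolding L_def by (meson greaterThanLessThan_iff less_le_trans add_left_mono min.cobounded1)
  qed (use t01 t0 s ft before in \<open>auto simp: L_def\<close>)
qed

text \<open>Non-negligibly many parallel lines leave \<open>V\<close> at an isolated crossing.
  Sorted into countably many classes of similar crossings, some class is not negligible, hence not
  porous. At a point where porosity fails, every ball of relative size \<open>c\<close> meets lines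
  of that class, and moving along them by the parameter \<open>t\<close> of the crossing transports
  this to the zero \<open>z\<close>. Exterior balls near \<open>z\<close> then exclude crossings
  with a positive phase behind them.\<close>

lemma clean_crossing:
  fixes f :: "'a::euclidean_space \<Rightarrow> real" and C c R \<tau> :: real
  assumes dim: "DIM('a) = Suc n" and cont: "continuous_on UNIV f"
    and V: "open V" "V \<subseteq> {x. f x > 0}" "open ({x. f x > 0} - V)"
    and \<tau>: "\<tau> > 0" "\<tau> \<le> 1" and uV: "ball u \<tau> \<subseteq> V" and vV: "ball v \<tau> \<inter> V = {}" and uv: "norm u \<le> 1" "norm v \<le> 1"
    and R: "R = 6 + 2 * real DIM('a)" and c: "0 < c" "c < 1"
    and pack: "\<And>(s::real) P. 0 < s \<Longrightarrow> s \<le> 1 \<Longrightarrow> finite P \<Longrightarrow> P \<subseteq> {x. f x = 0} \<inter> cball 0 R \<Longrightarrow>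
      (\<And>x y. x \<in> P \<Longrightarrow> y \<in> P \<Longrightarrow> x \<noteq> y \<Longrightarrow> s \<le> dist x y) \<Longrightarrow> card P * s ^ n \<le> C"
    and ext: "\<And>z s. z \<in> cball 0 R \<Longrightarrow> f z = 0 \<Longrightarrow> 0 < s \<Longrightarrow> s \<le> 1 \<Longrightarrow> \<exists>p. ball p (c * s) \<subseteq> ball z s \<and> (\<forall>q\<in>ball p (c * s). f q < 0)"
  obtains z s1 where "z \<in> cball 0 R" "f z = 0" "s1 > 0"
    "\<And>s p. 0 < s \<Longrightarrow> s < s1 \<Longrightarrow> ball p (c * s) \<subseteq> ball z s \<Longrightarrow> (\<forall>q\<in>ball p (c * s). f q > 0) \<Longrightarrow> ball p (c * s) \<inter> V \<noteq> {}"
proof -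
  obtain e a where e: "e \<in> Basis" and a: "\<bar>a\<bar> \<le> 2"
    and neg0: "\<not> negligible {y \<in> cball 0 (2 + 2 * real DIM('a)). y \<in> V \<and> y + a *\<^sub>R e \<notin> V}" (is "\<not> negligible ?B0")
    using axis_step[OF \<tau>(1) uV vV uv \<tau>(2)] by blast
  have a0: "a \<noteq> 0" using neg0 by (cases "a = 0") auto
  define w where "w = a *\<^sub>R e"
  have nw: "norm w \<le> 2" using a e by (simp add: w_def)
  define B where "B = {y \<in> ?B0. finite {t. y + t *\<^sub>R e \<in> {x. f x = 0} \<inter> cball 0 R}}"
  have "negligible {x \<in> cball 0 R. infinite {t. x + t *\<^sub>R e \<in> {x. f x = 0} \<inter> cball 0 R}}" (is "negligible ?I")
    by (rule negligible_infinite_fibres[OF e dim]) (use pack in blast)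
  moreover have "?B0 \<subseteq> B \<union> ?I" unfolding B_def using R by auto
  ultimately have negB: "\<not> negligible B" using neg0 negligible_subset[of "B \<union> ?I" ?B0] negligible_Un[of B ?I] by auto
  \<comment> \<open>This explains \<open>R\<close>: start points have norm at most
    \<open>2 + 2 * DIM('a)\<close>, and parameters up to 2 move them by at most 4.\<close>
  have nR: "norm (y + t *\<^sub>R w) \<le> R" if "y \<in> B" "t \<in> {0..2}" for y t
  proof -
    have "norm (t *\<^sub>R w) \<le> 2 * 2" unfolding norm_scaleR using that nw by (intro mult_mono) auto
    moreover have "norm y \<le> 2 + 2 * real DIM('a)" using that by (auto simp: B_def)
    ultimately show ?thesis using norm_triangle_ineq[of y "t *\<^sub>R w"] R by linarith
  qed
  \<comment> \<open>\<open>i\<close> is the phase behind the crossing, \<open>q\<close> a rational approximation of its parameter,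
    and \<open>1 / Suc m\<close> the size of the gap to the other zeros on the line.\<close>
  define G where "G = (\<lambda>(i::bool, q::real, m::nat). {y \<in> B. \<exists>t\<in>{0..1}. \<bar>t - q\<bar> < 1 / (2 * real (Suc m)) \<and> f (y + t *\<^sub>R w) = 0 \<and>
     (\<forall>r. t - 1 / real (Suc m) < r \<and> r < t \<longrightarrow> y + r *\<^sub>R w \<in> V) \<and>
     (\<forall>r. t < r \<and> r < t + 1 / real (Suc m) \<longrightarrow> (if i then f (y + r *\<^sub>R w) < 0 else f (y + r *\<^sub>R w) > 0))})"
  have "B \<subseteq> (\<Union>j\<in>UNIV \<times> \<rat> \<times> UNIV. G j)"
  proof
    fix y assume y: "y \<in> B"
    have yV: "y \<in> V" "y + w \<notin> V" using y by (auto simp: B_def w_def)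
    have "(\<lambda>t. t * a) ` {t \<in> {0..2}. f (y + t *\<^sub>R w) = 0} \<subseteq> {t. y + t *\<^sub>R e \<in> {x. f x = 0} \<inter> cball 0 R}"
      using nR[OF y] by (auto simp: w_def)
    then have im: "finite ((\<lambda>t. t * a) ` {t \<in> {0..2}. f (y + t *\<^sub>R w) = 0})"
      using y unfolding B_def by (auto intro: finite_subset)
    have fin: "finite {t \<in> {0..2}. f (y + t *\<^sub>R w) = 0}"
      by (rule finite_imageD[OF im]) (use a0 in \<open>auto simp: inj_on_def\<close>)
    obtain t \<sigma> where t: "t \<in> {0..1}" "\<sigma> > 0" "f (y + t *\<^sub>R w) = 0"
      "\<And>r. t - \<sigma> < r \<Longrightarrow> r < t \<Longrightarrow> y + r *\<^sub>R w \<in> V"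
      "(\<forall>r\<in>{t<..<t+\<sigma>}. f (y + r *\<^sub>R w) < 0) \<or> (\<forall>r\<in>{t<..<t+\<sigma>}. f (y + r *\<^sub>R w) > 0)"
      using isolated_crossing[OF cont V yV fin] by metis
    obtain m :: nat where m: "1 / real (Suc m) < \<sigma>" using nat_approx_posE[OF t(2)] by (metis of_nat_Suc)
    have "t < t + 1 / (2 * real (Suc m))" by simp
    from Rats_dense_in_real[OF this] obtain q where q': "q \<in> \<rat>" "t < q" "q < t + 1 / (2 * real (Suc m))" by auto
    then have q: "q \<in> \<rat>" "\<bar>t - q\<bar> < 1 / (2 * real (Suc m))" by linarith+
    have "\<exists>i. y \<in> G (i, q, m)" using t(5)
    proof
      assume "\<forall>r\<in>{t<..<t+\<sigma>}. f (y + r *\<^sub>R w) < 0"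
      then have "y \<in> G (True, q, m)" unfolding G_def using y t(1-4) q m by (auto intro!: bexI[of _ t])
      then show ?thesis ..
    next
      assume "\<forall>r\<in>{t<..<t+\<sigma>}. f (y + r *\<^sub>R w) > 0"
      then have "y \<in> G (False, q, m)" unfolding G_def using y t(1-4) q m by (auto intro!: bexI[of _ t])
      then show ?thesis ..
    qed
    then show "y \<in> (\<Union>j\<in>UNIV \<times> \<rat> \<times> UNIV. G j)" using q by auto
  qed
  moreover have "countable (UNIV \<times> \<rat> \<times> UNIV :: (bool \<times> real \<times> nat) set)"
    by (intro countable_SIGMA countable_rat) auto
  ultimately have "\<exists>j. \<not> negligible (G j)"
    using negB negligible_countable_Union[of "G ` (UNIV \<times> \<rat> \<times> UNIV)"] negligible_subset by (metis (no_types, lifting) countable_image imageE)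
  then obtain i q m where "\<not> negligible (G (i, q, m))" by auto
  then have "\<not> porous c (G (i, q, m))" using porous_negligible c by blast
  then obtain y r where y: "y \<in> G (i, q, m)" "r > 0"
    and hit: "\<And>d p. 0 < d \<Longrightarrow> d < r \<Longrightarrow> ball p (c * d) \<subseteq> ball y d \<Longrightarrow> ball p (c * d) \<inter> G (i, q, m) \<noteq> {}"
    unfolding porous_def by blast
  have yB: "y \<in> B" using y by (auto simp: G_def)
  obtain t where t: "t \<in> {0..1}" "\<bar>t - q\<bar> < 1 / (2 * real (Suc m))" "f (y + t *\<^sub>R w) = 0"
    using y(1) by (auto simp: G_def)
  define z where "z = y + t *\<^sub>R w"
  \<comment> \<open>Both \<open>t\<close> and the crossing parameter \<open>t'\<close> of a line met
    by the translated ball are within \<open>1 / (2 * Suc m)\<close> of \<open>q\<close>. So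
    \<open>t\<close> lies in the stretch around \<open>t'\<close> where that line is in
    \<open>V\<close>, at its zero, or in the phase \<open>i\<close>.\<close>
  have key: "\<exists>x\<in>ball p (c * d). x \<in> V \<or> f x = 0 \<or> (if i then f x < 0 else f x > 0)"
    if d: "0 < d" "d < r" "ball p (c * d) \<subseteq> ball z d" for d p
  proof -
    have bt: "x + t *\<^sub>R w \<in> ball p' d' \<longleftrightarrow> x \<in> ball (p' - t *\<^sub>R w) d'" for x p' d'
      by (simp add: dist_norm algebra_simps)
    have "ball (p - t *\<^sub>R w) (c * d) \<subseteq> ball y d"
    proof
      fix x assume "x \<in> ball (p - t *\<^sub>R w) (c * d)"
      then have "x + t *\<^sub>R w \<in> ball z d" using bt[of x p] d(3) by blast
      then show "x \<in> ball y d" using bt[of x z] by (simp add: z_def)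
    qed
    then obtain x where x: "x \<in> G (i, q, m)" "x + t *\<^sub>R w \<in> ball p (c * d)" using hit[OF d(1,2)] bt by blast
    then obtain t' where t': "\<bar>t' - q\<bar> < 1 / (2 * real (Suc m))" "f (x + t' *\<^sub>R w) = 0"
     "\<And>r. t' - 1 / real (Suc m) < r \<Longrightarrow> r < t' \<Longrightarrow> x + r *\<^sub>R w \<in> V"
     "\<And>r. t' < r \<Longrightarrow> r < t' + 1 / real (Suc m) \<Longrightarrow> (if i then f (x + r *\<^sub>R w) < 0 else f (x + r *\<^sub>R w) > 0)"
      unfolding G_def by blast
    have "\<bar>t - t'\<bar> < 1 / (2 * real (Suc m)) + 1 / (2 * real (Suc m))" using t(2) t'(1) by linarith
    also have "\<dots> = 1 / real (Suc m)" by (simp add: field_simps)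
    finally have tt: "\<bar>t - t'\<bar> < 1 / real (Suc m)" .
    have "x + t *\<^sub>R w \<in> V \<or> f (x + t *\<^sub>R w) = 0 \<or> (if i then f (x + t *\<^sub>R w) < 0 else f (x + t *\<^sub>R w) > 0)"
    proof (cases t t' rule: linorder_cases)
      case less then show ?thesis using t'(3)[of t] tt by auto
    next
      case equal then show ?thesis using t'(2) by auto
    next
      case greater
      then have "t < t' + 1 / real (Suc m)" using tt by linarith
      then show ?thesis using t'(4)[of t] greater by blast
    qed
    then show ?thesis using x(2) by blast
  qed
  have zR: "z \<in> cball 0 R" using nR[OF yB, of t] t(1) by (simp add: z_def)
  have fz: "f z = 0" using t by (simp add: z_def)
  \<comment> \<open>For the positive phase, every small ball of relative size \<open>c\<close> near
    \<open>z\<close> would contain a point with \<open>f \<ge> 0\<close>, contrary to the exterior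
    ball.\<close>
  have i: "i"
  proof (rule ccontr)
    assume ni: "\<not> i"
    define s where "s = min 1 (r/2)"
    have s: "0 < s" "s \<le> 1" "s < r" using y(2) by (auto simp: s_def)
    obtain p where p: "ball p (c * s) \<subseteq> ball z s" "\<forall>q\<in>ball p (c * s). f q < 0" using ext[OF zR fz s(1,2)] by blast
    obtain x where "x \<in> ball p (c * s)" "x \<in> V \<or> f x = 0 \<or> f x > 0" using key[OF s(1,3) p(1)] ni by auto
    then have "f x \<ge> 0" "f x < 0" using V(2) p(2) by auto
    then show False by simp
  qed
  show thesis
  proof (rule that[OF zR fz y(2)])
    fix s p assume sp: "0 < s" "s < r" "ball p (c * s) \<subseteq> ball z s" "\<forall>q\<in>ball p (c * s). f q > 0"
    obtain x where "x \<in> ball p (c * s)" "x \<in> V \<or> f x = 0 \<or> f x < 0" using key[OF sp(1-3)] i by auto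
    then show "ball p (c * s) \<inter> V \<noteq> {}" using sp(4) by force
  qed
qed

section \<open>Blow-up sequences\<close>


lemma curve_length_mono: "a \<le> a' \<Longrightarrow> b' \<le> b \<Longrightarrow> curve_length \<gamma> a' b' \<le> curve_length \<gamma> a b"
  unfolding curve_length_def by (rule SUP_subset_mono) auto

lemma bounded_subseq:
  fixes w :: "nat \<Rightarrow> 'a::heine_borel"
  assumes "bounded (range w)"
  obtains \<rho> l where "strict_mono \<rho>" "(\<lambda>k. w (\<rho> k)) \<longlonglongrightarrow> l"
  using bounded_imp_convergent_subsequence[OF assms] by (auto simp: o_def)

lemma eventually_subseq:
  assumes "strict_mono (\<rho> :: nat \<Rightarrow> nat)" "eventually Q sequentially"
  shows "\<forall>\<^sub>F k in sequentially. Q (\<rho> k)"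
  using assms by (metis filterlim_subseq filterlim_iff)

lemma eventually_hconn_step:
  assumes "\<forall>\<^sub>F k in F. hconn \<Omega> N (X k) (A k)" "\<forall>\<^sub>F k in F. hstep \<Omega> (A k) (B k)"
  shows "\<forall>\<^sub>F k in F. hconn \<Omega> (N + 1) (X k) (B k)"
  using assms by eventually_elim (erule hconn_trans, erule hconn_step)

text \<open>The maps \<open>P k\<close> place rescaled coordinates around the boundary point
  \<open>x k\<close> at scale \<open>r k\<close>; \<open>f\<close> is the limit of the rescaled
  signed distances \<open>G k\<close>. The scales may shrink, grow or stay bounded.\<close>

locale blowup =
  fixes \<Omega> :: "'a::euclidean_space set" and x :: "nat \<Rightarrow> 'a" and r :: "nat \<Rightarrow> real" and f :: "'a \<Rightarrow> real"
  assumes opn: "open \<Omega>" and xE: "\<And>k. x k \<in> frontier \<Omega>" and r: "\<And>k. 0 < r k"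
    and lim: "\<And>u. (\<lambda>k. sdist \<Omega> (x k + r k *\<^sub>R u) / r k) \<longlonglongrightarrow> f u"
begin

abbreviation P :: "nat \<Rightarrow> 'a \<Rightarrow> 'a" where "P k u \<equiv> x k + r k *\<^sub>R u"
abbreviation G :: "nat \<Rightarrow> 'a \<Rightarrow> real" where "G k u \<equiv> sdist \<Omega> (P k u) / r k"

lemma ne: "frontier \<Omega> \<noteq> {}" using xE by blast

lemma subseq: "strict_mono \<rho> \<Longrightarrow> blowup \<Omega> (\<lambda>k. x (\<rho> k)) (\<lambda>k. r (\<rho> k)) f"
  by unfold_locales (use opn xE r LIMSEQ_subseq_LIMSEQ[OF lim, of \<rho>] in \<open>auto simp: o_def\<close>)

lemma dist_P: "dist (P k u) (P k v) = r k * dist u v"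
proof -
  have "P k u - P k v = r k *\<^sub>R (u - v)" by (simp add: scaleR_diff_right)
  then show ?thesis using r[of k] by (simp add: dist_norm)
qed

lemma P_inverse: "P k ((y - x k) /\<^sub>R r k) = y"
  using r[of k] by simp

lemma G_lipschitz: "\<bar>G k u - G k v\<bar> \<le> dist u v"
proof -
  have "\<bar>G k u - G k v\<bar> = \<bar>sdist \<Omega> (P k u) - sdist \<Omega> (P k v)\<bar> / r k"
    using r[of k] by (simp add: diff_divide_distrib[symmetric])
  also have "\<dots> \<le> dist (P k u) (P k v) / r k" using r[of k] by (intro divide_right_mono sdist_lipschitz) simp
  finally show ?thesis using r[of k] dist_P by simp
qed

lemma f_lipschitz: "\<bar>f u - f v\<bar> \<le> dist u v"
  by (rule LIMSEQ_le_const2[OF tendsto_rabs[OF tendsto_diff[OF lim[of u] lim[of v]]]]) (use G_lipschitz in auto)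

lemma continuous_f: "continuous_on A f"
  unfolding continuous_on_iff
proof (intro ballI allI impI)
  fix u and e :: real assume "e > 0"
  then show "\<exists>d>0. \<forall>v\<in>A. dist v u < d \<longrightarrow> dist (f v) (f u) < e"
    using f_lipschitz by (intro exI[of _ e]) (auto simp: dist_real_def intro: le_less_trans)
qed

lemma G_diag: "w \<longlonglongrightarrow> u \<Longrightarrow> (\<lambda>k. G k (w k)) \<longlonglongrightarrow> f u"
  by (rule lipschitz_pointwise_diag[of G, OF G_lipschitz lim])

lemma infdist_P: "infdist (P k u) (frontier \<Omega>) = r k * \<bar>G k u\<bar>"
  using r[of k] by (simp add: abs_sdist[symmetric] abs_divide)

lemma P_mem_iff: "P k u \<in> \<Omega> \<longleftrightarrow> G k u > 0"
  using sdist_pos_iff[OF opn ne, of "P k u"] r[of k] by (simp add: zero_less_divide_iff)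

text \<open>In the limit \<open>G k p\<close> exceeds \<open>f p / 2\<close>, so half of the
  rescaled boundary distance of \<open>P k p\<close> exceeds \<open>f p / 4\<close>. The second
  point may vary with \<open>k\<close>, which lets limits of corkscrew or John points stand in for
  the points themselves.\<close>

lemma hstep_diag:
  assumes "f p > 0" "w \<longlonglongrightarrow> q" "dist p q < f p / 4"
  shows "\<forall>\<^sub>F k in sequentially. hstep \<Omega> (P k p) (P k (w k))"
proof -
  have "(\<lambda>k. dist p (w k)) \<longlonglongrightarrow> dist p q" using assms(2) by (intro tendsto_intros)
  then have "\<forall>\<^sub>F k in sequentially. dist p (w k) < f p / 4" using assms(3) by (rule order_tendstoD)
  moreover have "\<forall>\<^sub>F k in sequentially. f p / 2 < G k p" using lim[of p] by (rule order_tendstoD) (use assms in auto)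
  ultimately show ?thesis
  proof eventually_elim
    case (elim k)
    then have "G k p > 0" using assms(1) by linarith
    then have "P k p \<in> \<Omega>" using P_mem_iff by blast
    moreover have "dist (P k p) (P k (w k)) < infdist (P k p) (frontier \<Omega>) / 2"
    proof -
      have "dist p (w k) < \<bar>G k p\<bar> / 2" unfolding abs_of_pos[OF \<open>G k p > 0\<close>]
      proof -
        have "a < c / 2" if "a < b / 4" "b / 2 < c" for a b c :: real using that by linarith
        from this[OF elim] show "dist p (w k) < G k p / 2" .
      qed
      from mult_strict_left_mono[OF this r[of k]] show ?thesis unfolding dist_P infdist_P by simp
    qed
    ultimately show ?case by (rule hstepI)
  qed
qed

text \<open>The bound \<open>N\<close> may depend on \<open>p\<close> but not on
  \<open>k\<close>.\<close>

definition reach :: "(nat \<Rightarrow> 'a) \<Rightarrow> 'a set" where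
  "reach X = {p. f p > 0 \<and> (\<exists>N. \<forall>\<^sub>F k in sequentially. hconn \<Omega> N (X k) (P k p))}"

lemma f_pos_near: "f p > 0 \<Longrightarrow> dist p q < f p / 4 \<Longrightarrow> f q > 0"
  using f_lipschitz[of p q] by linarith

text \<open>One additional step joins \<open>P k p\<close> and \<open>P k q\<close> for all large
  \<open>k\<close>. Being an equivalence, this makes both \<open>reach X\<close> and its complement
  in \<open>{f > 0}\<close> open.\<close>

lemma reach_iff:
  assumes "f p > 0" "dist p q < f p / 4"
  shows "p \<in> reach X \<longleftrightarrow> q \<in> reach X"
proof -
  have st: "\<forall>\<^sub>F k in sequentially. hstep \<Omega> (P k p) (P k q)" by (rule hstep_diag) (use assms in auto)
  have "f q > 0" using f_pos_near assms by blast
  moreover have "\<exists>N. \<forall>\<^sub>F k in sequentially. hconn \<Omega> N (X k) (P k q)" if N: "\<forall>\<^sub>F k in sequentially. hconn \<Omega> N (X k) (P k p)" for N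
    using eventually_hconn_step[OF N st] by blast
  moreover have "\<exists>N. \<forall>\<^sub>F k in sequentially. hconn \<Omega> N (X k) (P k p)" if N: "\<forall>\<^sub>F k in sequentially. hconn \<Omega> N (X k) (P k q)" for N
    using eventually_hconn_step[OF N, of "\<lambda>k. P k p"] eventually_mono[OF st, of "\<lambda>k. hstep \<Omega> (P k q) (P k p)"] hstep_sym by blast
  ultimately show ?thesis using assms(1) unfolding reach_def by blast
qed

lemma open_reach: "open (reach X)"
  unfolding open_contains_ball
proof
  fix p assume p: "p \<in> reach X"
  then have "f p > 0" by (simp add: reach_def)
  then show "\<exists>e>0. ball p e \<subseteq> reach X" using reach_iff p by (intro exI[of _ "f p / 4"]) auto
qed

lemma open_not_reach: "open ({p. f p > 0} - reach X)"
  unfolding open_contains_ball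
proof
  fix p assume p: "p \<in> {p. f p > 0} - reach X"
  then have "f p > 0" by simp
  then show "\<exists>e>0. ball p e \<subseteq> {p. f p > 0} - reach X" using reach_iff f_pos_near p by (intro exI[of _ "f p / 4"]) auto
qed

text \<open>At one late index \<open>k\<close> all points of the finite set \<open>Q\<close> are,
  after rescaling, within \<open>s/4\<close> of the boundary. Nearest boundary points then form an
  \<open>r k * s / 2\<close>-separated set to which \<open>adr_packing\<close> applies, and the
  factor \<open>r k ^ n\<close> cancels.\<close>

lemma zeros_packing:
  fixes s R D :: real
  assumes adr: "adr_const n D (frontier \<Omega>)" and D: "D \<ge> 1" and R: "R \<ge> 1"
    and small: "\<And>k. ennreal (4 * R * r k) < ediam (frontier \<Omega>)"
    and s: "0 < s" "s \<le> 1" and Q: "finite Q" "Q \<subseteq> {u. f u = 0} \<inter> cball 0 R"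
    and sep: "\<And>u v. u \<in> Q \<Longrightarrow> v \<in> Q \<Longrightarrow> u \<noteq> v \<Longrightarrow> s \<le> dist u v"
  shows "card Q * s ^ n \<le> 2 * D\<^sup>2 * (32 * R) ^ n"
proof -
  have "\<forall>\<^sub>F k in sequentially. \<bar>G k u\<bar> < s / 4" if "u \<in> Q" for u
  proof -
    have "f u = 0" using that Q(2) by auto
    then have "(\<lambda>k. \<bar>G k u\<bar>) \<longlonglongrightarrow> 0" using tendsto_rabs[OF lim[of u]] by simp
    then show ?thesis by (rule order_tendstoD) (use s in auto)
  qed
  then have "\<forall>\<^sub>F k in sequentially. \<forall>u\<in>Q. \<bar>G k u\<bar> < s / 4" using Q(1) by (simp add: eventually_ball_finite)
  then obtain k where k: "\<And>u. u \<in> Q \<Longrightarrow> \<bar>G k u\<bar> < s / 4" by (auto simp: eventually_sequentially)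
  note rk = r[of k]
  have "\<exists>z\<in>frontier \<Omega>. dist (P k u) z < r k * (s/4)" if "u \<in> Q" for u
  proof -
    obtain z where "z \<in> frontier \<Omega>" "dist (P k u) z = infdist (P k u) (frontier \<Omega>)" using frontier_nearest[OF ne] .
    moreover have "infdist (P k u) (frontier \<Omega>) < r k * (s/4)" unfolding infdist_P using k[OF that] rk by (intro mult_strict_left_mono)
    ultimately show ?thesis by metis
  qed
  then obtain z where z: "\<And>u. u \<in> Q \<Longrightarrow> z u \<in> frontier \<Omega>" "\<And>u. u \<in> Q \<Longrightarrow> dist (P k u) (z u) < r k * (s/4)" by metis
  have zs: "r k * s / 2 \<le> dist (z u) (z v)" if uv: "u \<in> Q" "v \<in> Q" "u \<noteq> v" for u v
  proof -
    have "dist (P k u) (P k v) \<le> dist (P k u) (z u) + dist (z u) (z v) + dist (z v) (P k v)"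
      by (meson add_le_cancel_right dist_triangle order_trans)
    moreover have "r k * s \<le> dist (P k u) (P k v)" unfolding dist_P using sep[OF uv] rk by simp
    ultimately show ?thesis using z(2)[OF uv(1)] z(2)[OF uv(2)] by (simp add: dist_commute)
  qed
  have inj: "inj_on z Q"
    using zs s rk by (intro inj_onI) (metis dist_self half_gt_zero mult_pos_pos not_le)
  have "card (z ` Q) * (r k * s / 2) ^ n \<le> 2 * D\<^sup>2 * (8 * (2 * R * r k)) ^ n"
  proof (rule adr_packing[OF adr D xE[of k]])
    show "ennreal (2 * (2 * R * r k)) < ediam (frontier \<Omega>)" using small[of k] by (simp add: mult.assoc)
    show "0 < r k * s / 2" using rk s by simp
    have "s / 2 \<le> 2 * R" using s R by linarith
    from mult_left_mono[OF this, of "r k"] show "r k * s / 2 \<le> 2 * R * r k" using rk by (simp add: mult_ac)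
    show "finite (z ` Q)" using Q by simp
    show "z ` Q \<subseteq> frontier \<Omega> \<inter> ball (x k) (2 * R * r k)"
    proof safe
      fix u assume u: "u \<in> Q"
      show "z u \<in> frontier \<Omega>" by (rule z(1)[OF u])
      have "dist (x k) (P k u) = r k * norm u" using rk by (simp add: dist_norm)
      also have "\<dots> \<le> r k * R" using u Q(2) rk by (intro mult_left_mono) auto
      finally have "dist (x k) (z u) < r k * R + r k * (s/4)" using z(2)[OF u] dist_triangle[of "x k" "z u" "P k u"] by linarith
      also have "\<dots> \<le> r k * R + r k * R" using s R rk by (intro add_left_mono mult_left_mono) auto
      finally show "z u \<in> ball (x k) (2 * R * r k)" by (simp add: mult_ac)
    qed
  next
    fix z1 z2 assume "z1 \<in> z ` Q" "z2 \<in> z ` Q" "z1 \<noteq> z2"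
    then show "r k * s / 2 \<le> dist z1 z2" using zs by blast
  qed
  moreover have "(2::real) ^ n * 16 ^ n = 32 ^ n" by (simp flip: power_mult_distrib)
  ultimately have "(r k) ^ n * (card Q * s ^ n) \<le> (r k) ^ n * (2 * D\<^sup>2 * (32 * R) ^ n)"
    unfolding card_image[OF inj] by (simp add: power_mult_distrib power_divide field_simps)
  then show ?thesis using rk by simp
qed

text \<open>The boundary point nearest to \<open>P k z\<close> is at rescaled distance tending to 0.
  Exterior corkscrew centres there at scale \<open>r k * (s/2)\<close>, rescaled, stay bounded and
  have a limit point \<open>p\<close>.\<close>

lemma exterior_corkscrew_limit:
  assumes c: "0 < c" "c < 1"
    and ext: "\<And>y \<rho>. y \<in> frontier \<Omega> \<Longrightarrow> 0 < \<rho> \<Longrightarrow> ennreal \<rho> < ediam (frontier \<Omega>) \<Longrightarrow> \<exists>X. ball X (c * \<rho>) \<subseteq> ball y \<rho> \<inter> interior (- \<Omega>)"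
    and small: "\<And>k. ennreal (r k) < ediam (frontier \<Omega>)"
    and z: "f z = 0" and s: "0 < s" "s \<le> 1"
  obtains p where "dist z p \<le> s / 2" "f p \<le> - c * (s / 2)"
proof -
  have "\<exists>w. dist z w \<le> \<bar>G k z\<bar> + s / 2 \<and> G k w \<le> - c * (s/2)" for k
  proof -
    obtain y where y: "y \<in> frontier \<Omega>" "dist (P k z) y = infdist (P k z) (frontier \<Omega>)" using frontier_nearest[OF ne] .
    have "ennreal (r k * (s/2)) < ediam (frontier \<Omega>)"
      by (rule le_less_trans[OF ennreal_leI small[of k]]) (use s r[of k] in auto)
    then obtain w where w: "ball w (c * (r k * (s/2))) \<subseteq> ball y (r k * (s/2)) \<inter> interior (- \<Omega>)"
      using ext[OF y(1), of "r k * (s/2)"] s r[of k] by auto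
    have pos: "0 < c * (r k * (s/2))" using c s r[of k] by simp
    have sw: "sdist \<Omega> w \<le> - (c * (r k * (s/2)))"
      by (rule sdist_exterior_ball[OF ne pos]) (use w in auto)
    have "w \<in> ball y (r k * (s/2))" using w pos centre_in_ball by blast
    then have "dist (P k z) w \<le> r k * \<bar>G k z\<bar> + r k * (s/2)"
      using dist_triangle[of "P k z" w y] y(2) unfolding infdist_P by simp
    moreover have "dist (P k z) w = r k * dist z ((w - x k) /\<^sub>R r k)"
      using dist_P[of k z "(w - x k) /\<^sub>R r k"] unfolding P_inverse .
    ultimately have "r k * dist z ((w - x k) /\<^sub>R r k) \<le> r k * (\<bar>G k z\<bar> + s/2)"
      unfolding distrib_left by simp
    then have "dist z ((w - x k) /\<^sub>R r k) \<le> \<bar>G k z\<bar> + s/2" using r[of k] by simp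
    moreover have "G k ((w - x k) /\<^sub>R r k) \<le> - c * (s/2)"
      unfolding P_inverse using sw r[of k] by (simp add: field_simps)
    ultimately show ?thesis by blast
  qed
  then obtain w where w: "\<And>k. dist z (w k) \<le> \<bar>G k z\<bar> + s / 2" "\<And>k. G k (w k) \<le> - c * (s/2)" by metis
  have Gz: "(\<lambda>k. \<bar>G k z\<bar>) \<longlonglongrightarrow> 0" using tendsto_rabs[OF lim[of z]] z by simp
  then have "Bseq (\<lambda>k. \<bar>G k z\<bar>)" by (rule convergent_imp_Bseq[OF convergentI])
  then obtain K where K: "\<And>k. \<bar>G k z\<bar> \<le> K" by (auto simp: Bseq_def)
  have "bounded (range w)"
  proof (rule bounded_subset[OF bounded_cball])
    have "dist z (w k) \<le> K + s/2" for k using w(1)[of k] K[of k] by linarith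
    then show "range w \<subseteq> cball z (K + s/2)" by auto
  qed
  then obtain \<rho> p where \<rho>: "strict_mono \<rho>" "(\<lambda>k. w (\<rho> k)) \<longlonglongrightarrow> p" using bounded_subseq by blast
  interpret S: blowup \<Omega> "\<lambda>k. x (\<rho> k)" "\<lambda>k. r (\<rho> k)" f by (rule subseq[OF \<rho>(1)])
  show thesis
  proof
    have "(\<lambda>k. \<bar>G (\<rho> k) z\<bar> + s/2) \<longlonglongrightarrow> 0 + s/2"
      using LIMSEQ_subseq_LIMSEQ[OF Gz \<rho>(1)] by (intro tendsto_intros) (simp add: o_def)
    moreover have "(\<lambda>k. dist z (w (\<rho> k))) \<longlonglongrightarrow> dist z p" using \<rho>(2) by (intro tendsto_intros)
    ultimately have "dist z p \<le> 0 + s/2" using w(1) by (intro LIMSEQ_le) auto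
    then show "dist z p \<le> s/2" by simp
    show "f p \<le> - c * (s/2)"
      by (rule LIMSEQ_le_const2[OF S.G_diag[OF \<rho>(2)]]) (use w(2) in auto)
  qed
qed

end

section \<open>Chains to the John centre\<close>


text \<open>The length bound \<open>L\<close> is independent of the radius \<open>\<rho>\<close>, so
  that a John centre of a large ball also serves smaller balls with other centres inside it.\<close>

definition john_target :: "'a::euclidean_space set \<Rightarrow> real \<Rightarrow> 'a \<Rightarrow> real \<Rightarrow> real \<Rightarrow> 'a \<Rightarrow> bool" where
  "john_target \<Omega> D x \<rho> L Y \<longleftrightarrow> Y \<in> \<Omega> \<and>
     (\<forall>z \<in> ball x \<rho> \<inter> frontier \<Omega>. \<exists>\<gamma>. path_into \<Omega> \<gamma> z Y \<and> nontangential (frontier \<Omega>) D \<gamma> \<and>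
        curve_length \<gamma> 0 1 \<le> ennreal L)"

text \<open>The path passes through distance \<open>\<sigma>\<close> from its start; beyond this
  point \<open>nontangential_hconn\<close> turns the remaining length, at most \<open>L\<close>,
  into at most \<open>m\<close> steps.\<close>

lemma john_path_point:
  assumes op: "open \<Omega>" "frontier \<Omega> \<noteq> {}" and g: "path_into \<Omega> \<gamma> z Y" and nt: "nontangential (frontier \<Omega>) D \<gamma>"
    and len: "curve_length \<gamma> 0 1 \<le> ennreal L"
    and D: "D \<ge> 1" and \<sigma>: "0 < \<sigma>" "\<sigma> \<le> dist z Y" and m: "L \<le> real m * (\<sigma> / (4 * D))"
  obtains p where "dist z p = \<sigma>" "p \<in> \<Omega>" "\<sigma> / D \<le> infdist p (frontier \<Omega>)" "hconn \<Omega> m p Y"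
proof -
  have g0: "\<gamma> 0 = z" "\<gamma> 1 = Y" "path \<gamma>" using g by (auto simp: path_into_def pathstart_def pathfinish_def)
  have "continuous_on {0..1} (\<lambda>s. dist z (\<gamma> s))" using g0(3) by (auto simp: path_def intro!: continuous_intros)
  then obtain t where t: "0 \<le> t" "t \<le> 1" "dist z (\<gamma> t) = \<sigma>"
    using IVT'[of "\<lambda>s. dist z (\<gamma> s)" 0 \<sigma> 1] g0 \<sigma> by auto
  have "curve_length \<gamma> t 1 \<le> curve_length \<gamma> 0 1" using t by (intro curve_length_mono) auto
  also have "\<dots> \<le> ennreal (real m * (\<sigma> / (4 * D)))" using len m by (meson ennreal_leI order_trans)
  finally have h: "hconn \<Omega> m (\<gamma> t) Y"
    using t by (intro nontangential_hconn[OF op g nt D \<sigma>(1), of t t]) auto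
  show thesis
  proof
    show "\<sigma> / D \<le> infdist (\<gamma> t) (frontier \<Omega>)" by (rule nontangential_lower[OF nt D, of t]) (use t g0 in auto)
  qed (use t h hconn_mem[OF h] in auto)
qed

context blowup
begin

text \<open>John paths start at boundary points approaching \<open>z\<close> in rescaled
  coordinates. Their points at rescaled distance \<open>s/2\<close> from the start accumulate at
  some \<open>p\<close>, so a chain to \<open>P k p\<close> continues to \<open>Y k\<close>. As
  \<open>p\<close> comes from a subsequence, the conclusion holds only for infinitely many
  \<open>k\<close>.\<close>

lemma john_limit:
  assumes D: "D \<ge> 1" and jt: "\<And>k. john_target \<Omega> D (x k) (A * r k) (L * r k) (Y k)"
    and Y: "\<And>k. b * r k \<le> infdist (Y k) (frontier \<Omega>)" and zA: "norm z < A" and z: "f z = 0"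
    and s: "0 < s" "s \<le> b"
  obtains p m where "dist z p \<le> s / 2" "f p \<ge> s / (2 * D)"
    "\<And>N. (\<forall>\<^sub>F k in sequentially. hconn \<Omega> N (X k) (P k p)) \<Longrightarrow> \<exists>\<^sub>F k in sequentially. hconn \<Omega> (N + 1 + m) (X k) (Y k)"
proof -
  \<comment> \<open>With \<open>\<sigma> = r k * (s / 2)\<close>, this is the bound
    \<open>L * r k \<le> m * (\<sigma> / (4 * D))\<close> of \<open>john_path_point\<close>, free of
    \<open>k\<close>.\<close>
  obtain m :: nat where m: "L * (8 * D) / s \<le> real m" using real_arch_simple by blast
  have Gz: "(\<lambda>k. \<bar>G k z\<bar>) \<longlonglongrightarrow> 0" using tendsto_rabs[OF lim[of z]] z by simp
  then have "\<forall>\<^sub>F k in sequentially. \<bar>G k z\<bar> < min 1 (A - norm z)" by (rule order_tendstoD) (use zA in auto)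
  then obtain K where K: "\<And>k. k \<ge> K \<Longrightarrow> \<bar>G k z\<bar> < min 1 (A - norm z)" by (auto simp: eventually_sequentially)
  have "\<exists>p. dist z p \<le> \<bar>G k z\<bar> + s / 2 \<and> G k p \<ge> s / (2 * D) \<and> hconn \<Omega> m (P k p) (Y k)" if k: "k \<ge> K" for k
  proof -
    note rk = r[of k]
    obtain y where y: "y \<in> frontier \<Omega>" "dist (P k z) y = infdist (P k z) (frontier \<Omega>)" using frontier_nearest[OF ne] .
    have "dist (x k) y \<le> dist (x k) (P k z) + dist (P k z) y" by (rule dist_triangle)
    also have "\<dots> = r k * (norm z + \<bar>G k z\<bar>)" unfolding y(2) infdist_P using rk by (simp add: dist_norm distrib_left)
    also have "\<dots> < r k * A" using K[OF k] rk by (intro mult_strict_left_mono) auto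
    finally have "y \<in> ball (x k) (A * r k) \<inter> frontier \<Omega>" using y(1) by (simp add: mult.commute)
    then obtain \<gamma> where \<gamma>: "path_into \<Omega> \<gamma> y (Y k)" "nontangential (frontier \<Omega>) D \<gamma>" "curve_length \<gamma> 0 1 \<le> ennreal (L * r k)"
      using jt[of k] unfolding john_target_def by blast
    define \<sigma> where "\<sigma> = r k * (s / 2)"
    have \<sigma>: "0 < \<sigma>" using rk s by (simp add: \<sigma>_def)
    have "\<sigma> \<le> b * r k" using rk s by (simp add: \<sigma>_def)
    also have "\<dots> \<le> infdist (Y k) (frontier \<Omega>)" by (rule Y)
    also have "\<dots> \<le> dist y (Y k)" using infdist_le[OF y(1), of "Y k"] by (simp add: dist_commute)
    finally have \<sigma>Y: "\<sigma> \<le> dist y (Y k)" .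
    have "L \<le> real m * (s / (8 * D))" using m s D by (simp add: field_simps)
    then have "L * r k \<le> real m * (s / (8 * D)) * r k" using rk by (intro mult_right_mono) auto
    also have "\<dots> = real m * (\<sigma> / (4 * D))" by (simp add: \<sigma>_def field_simps)
    finally obtain p where p: "dist y p = \<sigma>" "p \<in> \<Omega>" "\<sigma> / D \<le> infdist p (frontier \<Omega>)" "hconn \<Omega> m p (Y k)"
      using john_path_point[OF opn ne \<gamma> D \<sigma> \<sigma>Y] by blast
    let ?p = "(p - x k) /\<^sub>R r k"
    have "dist (P k z) p \<le> r k * \<bar>G k z\<bar> + r k * (s/2)"
      using dist_triangle[of "P k z" p y] y(2) p(1) unfolding infdist_P \<sigma>_def by simp
    moreover have "dist (P k z) p = r k * dist z ?p"
      using dist_P[of k z ?p] unfolding P_inverse .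
    ultimately have "r k * dist z ?p \<le> r k * (\<bar>G k z\<bar> + s/2)"
      unfolding distrib_left by simp
    then have "dist z ?p \<le> \<bar>G k z\<bar> + s/2" using rk by simp
    moreover have "G k ?p \<ge> s / (2 * D)"
    proof -
      have "s / (2 * D) = \<sigma> / D / r k" using rk by (simp add: \<sigma>_def)
      also have "\<dots> \<le> infdist p (frontier \<Omega>) / r k" using p(3) rk by (intro divide_right_mono) auto
      finally show ?thesis unfolding P_inverse using p(2) by (simp add: sdist_def)
    qed
    moreover have "hconn \<Omega> m (P k ?p) (Y k)" unfolding P_inverse by (rule p(4))
    ultimately show ?thesis by blast
  qed
  then obtain w where w: "\<And>k. k \<ge> K \<Longrightarrow> dist z (w k) \<le> \<bar>G k z\<bar> + s / 2" "\<And>k. k \<ge> K \<Longrightarrow> G k (w k) \<ge> s / (2 * D)"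
    "\<And>k. k \<ge> K \<Longrightarrow> hconn \<Omega> m (P k (w k)) (Y k)" by metis
  have "bounded (range (\<lambda>k. w (k + K)))"
  proof (rule bounded_subset[OF bounded_cball])
    have "dist z (w (k + K)) \<le> 1 + s/2" for k using w(1)[of "k + K"] K[of "k + K"] by auto
    then show "range (\<lambda>k. w (k + K)) \<subseteq> cball z (1 + s/2)" by auto
  qed
  then obtain \<rho>' p where \<rho>': "strict_mono \<rho>'" "(\<lambda>k. w (\<rho>' k + K)) \<longlonglongrightarrow> p" using bounded_subseq by blast
  define \<rho> where "\<rho> = (\<lambda>k. \<rho>' k + K)"
  have \<rho>: "strict_mono \<rho>" "(\<lambda>k. w (\<rho> k)) \<longlonglongrightarrow> p" "\<And>k. \<rho> k \<ge> K" using \<rho>' by (auto simp: \<rho>_def strict_mono_def)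
  interpret S: blowup \<Omega> "\<lambda>k. x (\<rho> k)" "\<lambda>k. r (\<rho> k)" f by (rule subseq[OF \<rho>(1)])
  have fp: "f p \<ge> s / (2 * D)"
    by (rule LIMSEQ_le_const[OF S.G_diag[OF \<rho>(2)]]) (use w(2) \<rho>(3) in auto)
  show thesis
  proof (rule that)
    have "(\<lambda>k. \<bar>G (\<rho> k) z\<bar> + s/2) \<longlonglongrightarrow> 0 + s/2"
      using LIMSEQ_subseq_LIMSEQ[OF Gz \<rho>(1)] by (intro tendsto_intros) (simp add: o_def)
    moreover have "(\<lambda>k. dist z (w (\<rho> k))) \<longlonglongrightarrow> dist z p" using \<rho>(2) by (intro tendsto_intros)
    ultimately have "dist z p \<le> 0 + s/2" using w(1) \<rho>(3) by (intro LIMSEQ_le) auto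
    then show "dist z p \<le> s/2" by simp
    show "f p \<ge> s / (2 * D)" by (rule fp)
    fix N assume N: "\<forall>\<^sub>F k in sequentially. hconn \<Omega> N (X k) (P k p)"
    have "f p > 0" using fp s D by (meson divide_pos_pos less_le_trans mult_pos_pos zero_less_numeral zero_less_one)
    then have st: "\<forall>\<^sub>F k in sequentially. hstep \<Omega> (P (\<rho> k) p) (P (\<rho> k) (w (\<rho> k)))"
      by (intro S.hstep_diag[OF _ \<rho>(2)]) auto
    have "\<forall>\<^sub>F k in sequentially. hconn \<Omega> (N + 1 + m) (X (\<rho> k)) (Y (\<rho> k))"
      using eventually_hconn_step[OF eventually_subseq[OF \<rho>(1) N] st]
      by eventually_elim (erule hconn_trans, rule w(3)[OF \<rho>(3)])
    then obtain K' where K': "\<And>k. k \<ge> K' \<Longrightarrow> hconn \<Omega> (N + 1 + m) (X (\<rho> k)) (Y (\<rho> k))" by (auto simp: eventually_sequentially)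
    show "\<exists>\<^sub>F k in sequentially. hconn \<Omega> (N + 1 + m) (X k) (Y k)"
      unfolding frequently_sequentially
    proof
      fix M
      have "\<rho> (max M K') \<ge> M" using seq_suble[OF \<rho>(1), of "max M K'"] by simp
      then show "\<exists>k\<ge>M. hconn \<Omega> (N + 1 + m) (X k) (Y k)" using K'[of "max M K'"] by auto
    qed
  qed
qed

end

text \<open>A sequence of pairs needing more than \<open>N\<close> steps is blown up, and
  \<open>john_limit\<close> at a clean crossing joins infinitely many of the pairs with a fixed
  number of steps. The value of \<open>A\<close> is four times the radius of
  \<open>clean_crossing\<close>, which is the range of scales that \<open>zeros_packing\<close>
  consumes.\<close>

lemma harnack_to_john_target:
  fixes \<Omega> :: "'a::euclidean_space set"
  assumes dim: "DIM('a) = Suc n" and opn: "open \<Omega>"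
    and adr: "adr_const n Da (frontier \<Omega>)" "Da \<ge> 1"
    and c: "0 < c" "c < 1"
    and ext: "\<And>y \<rho>. y \<in> frontier \<Omega> \<Longrightarrow> 0 < \<rho> \<Longrightarrow> ennreal \<rho> < ediam (frontier \<Omega>) \<Longrightarrow> \<exists>X. ball X (c * \<rho>) \<subseteq> ball y \<rho> \<inter> interior (- \<Omega>)"
    and D: "D \<ge> 1" and b: "0 < b" and A: "A = 4 * (6 + 2 * real DIM('a))"
  shows "\<exists>N. \<forall>x\<in>frontier \<Omega>. \<forall>r>0. \<forall>X Y. ennreal (A * r) < ediam (frontier \<Omega>) \<longrightarrow> X \<in> \<Omega> \<longrightarrow> dist x X \<le> r \<longrightarrow>
      b * r \<le> infdist X (frontier \<Omega>) \<longrightarrow> b * r \<le> infdist Y (frontier \<Omega>) \<longrightarrow> john_target \<Omega> D x (A * r) (L * r) Y \<longrightarrow> hconn \<Omega> N X Y"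
proof (rule ccontr)
  assume "\<not> ?thesis"
  then have "\<forall>N. \<exists>x r X Y. x \<in> frontier \<Omega> \<and> r > 0 \<and> ennreal (A * r) < ediam (frontier \<Omega>) \<and> X \<in> \<Omega> \<and> dist x X \<le> r \<and>
      b * r \<le> infdist X (frontier \<Omega>) \<and> b * r \<le> infdist Y (frontier \<Omega>) \<and> john_target \<Omega> D x (A * r) (L * r) Y \<and> \<not> hconn \<Omega> N X Y"
    by blast
  then obtain x r X Y where seq0: "\<And>N. x N \<in> frontier \<Omega>" "\<And>N. r N > 0" "\<And>N. ennreal (A * r N) < ediam (frontier \<Omega>)"
     "\<And>N. X N \<in> \<Omega>" "\<And>N. dist (x N) (X N) \<le> r N" "\<And>N. b * r N \<le> infdist (X N) (frontier \<Omega>)" "\<And>N. b * r N \<le> infdist (Y N) (frontier \<Omega>)"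
     "\<And>N. john_target \<Omega> D (x N) (A * r N) (L * r N) (Y N)" "\<And>N. \<not> hconn \<Omega> N (X N) (Y N)"
    by metis
  define R where "R = 6 + 2 * real DIM('a)"
  have R1: "R \<ge> 1" "A = 4 * R" using A by (auto simp: R_def)
  define F where "F = (\<lambda>k u. sdist \<Omega> (x k + r k *\<^sub>R u) / r k)"
  have F_lip: "\<bar>F k u - F k v\<bar> \<le> dist u v" for k u v
  proof -
    have "dist (x k + r k *\<^sub>R u) (x k + r k *\<^sub>R v) = r k * dist u v"
    proof -
      have "(x k + r k *\<^sub>R u) - (x k + r k *\<^sub>R v) = r k *\<^sub>R (u - v)" by (simp add: scaleR_diff_right)
      then show ?thesis using seq0(2)[of k] by (simp add: dist_norm)
    qed
    then have "\<bar>sdist \<Omega> (x k + r k *\<^sub>R u) - sdist \<Omega> (x k + r k *\<^sub>R v)\<bar> / r k \<le> r k * dist u v / r k"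
      using sdist_lipschitz[of \<Omega> "x k + r k *\<^sub>R u" "x k + r k *\<^sub>R v"] seq0(2)[of k] by (intro divide_right_mono) auto
    then show ?thesis using seq0(2)[of k] by (simp add: F_def diff_divide_distrib[symmetric])
  qed
  have F0: "F k 0 = 0" for k using seq0(1)[of k] by (simp add: F_def sdist_def)
  obtain \<phi> f where \<phi>: "strict_mono \<phi>" "\<And>u. (\<lambda>k. F (\<phi> k) u) \<longlonglongrightarrow> f u"
    by (rule lipschitz_pointwise_subseq[of F, OF F_lip F0]) (rule that)
  let ?X = "\<lambda>k. (X (\<phi> k) - x (\<phi> k)) /\<^sub>R r (\<phi> k)"
  have nX: "norm ((X k - x k) /\<^sub>R r k) \<le> 1" for k
    unfolding norm_scaleR using seq0(5)[of k] seq0(2)[of k] by (simp add: dist_norm norm_minus_commute field_simps)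
  have "bounded (range ?X)" unfolding bounded_iff using nX by blast
  then obtain \<psi>' u where \<psi>': "strict_mono \<psi>'" "(\<lambda>k. ?X (\<psi>' k)) \<longlonglongrightarrow> u" using bounded_subseq by blast
  define \<psi> where "\<psi> = \<phi> \<circ> \<psi>'"
  have \<psi>: "strict_mono \<psi>" using \<phi>(1) \<psi>'(1) by (simp add: \<psi>_def strict_mono_o)
  define X' where "X' = (\<lambda>k. X (\<psi> k))"
  define Y' where "Y' = (\<lambda>k. Y (\<psi> k))"
  interpret B: blowup \<Omega> "\<lambda>k. x (\<psi> k)" "\<lambda>k. r (\<psi> k)" f
  proof
    show "(\<lambda>k. sdist \<Omega> (x (\<psi> k) + r (\<psi> k) *\<^sub>R u) / r (\<psi> k)) \<longlonglongrightarrow> f u" for u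
      using LIMSEQ_subseq_LIMSEQ[OF \<phi>(2)[of u] \<psi>'(1)] by (simp add: \<psi>_def o_def F_def)
  qed (use opn seq0 in auto)
  have small: "ennreal (t * r (\<psi> k)) < ediam (frontier \<Omega>)" if "t \<le> A" for t k
    by (rule le_less_trans[OF ennreal_leI seq0(3)[of "\<psi> k"]]) (use that seq0(2)[of "\<psi> k"] in auto)
  have small1: "ennreal (r (\<psi> k)) < ediam (frontier \<Omega>)" for k using small[of 1 k] R1 by simp
  define V where "V = B.reach X'"
  have Vpos: "V \<subseteq> {p. f p > 0}" by (auto simp: V_def B.reach_def)
  define w where "w = (\<lambda>k. (X (\<psi> k) - x (\<psi> k)) /\<^sub>R r (\<psi> k))"
  have wu: "w \<longlonglongrightarrow> u" using \<psi>'(2) by (simp add: w_def \<psi>_def)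
  have Pw: "x (\<psi> k) + r (\<psi> k) *\<^sub>R w k = X' k" for k unfolding w_def X'_def by (rule B.P_inverse)
  have nu: "norm u \<le> 1" by (rule LIMSEQ_le_const2[OF tendsto_norm[OF wu]]) (use nX in \<open>auto simp: w_def\<close>)
  have fu: "f u \<ge> b"
  proof (rule LIMSEQ_le_const[OF B.G_diag[OF wu]])
    have "b \<le> sdist \<Omega> (X' k) / r (\<psi> k)" for k
      using seq0(4,6)[of "\<psi> k"] seq0(2)[of "\<psi> k"] by (simp add: X'_def sdist_def field_simps)
    then show "\<exists>N. \<forall>k\<ge>N. b \<le> sdist \<Omega> (x (\<psi> k) + r (\<psi> k) *\<^sub>R w k) / r (\<psi> k)" unfolding Pw by blast
  qed
  then have fu0: "f u > 0" using b by simp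
  have uV: "u \<in> V"
  proof -
    have "\<forall>\<^sub>F k in sequentially. hstep \<Omega> (x (\<psi> k) + r (\<psi> k) *\<^sub>R u) (X' k)"
      using B.hstep_diag[OF fu0 wu] fu0 unfolding Pw by simp
    then have "\<forall>\<^sub>F k in sequentially. hconn \<Omega> 1 (X' k) (x (\<psi> k) + r (\<psi> k) *\<^sub>R u)"
      by eventually_elim (rule hconn_step, erule hstep_sym)
    then show ?thesis unfolding V_def B.reach_def using fu0 by blast
  qed
  have f0: "f 0 = 0"
    using LIMSEQ_unique[OF \<phi>(2)[of 0]] by (simp add: F0)
  \<comment> \<open>The exterior corkscrew at the origin supplies the endpoint outside
    \<open>V\<close> of the crossing argument; \<open>u\<close>, the limit of the rescaled
    \<open>X\<close>, is the endpoint inside.\<close>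
  obtain v where v: "dist 0 v \<le> 1 / 2" "f v \<le> - c * (1 / 2)"
    using B.exterior_corkscrew_limit[OF c ext small1 f0, of 1] by auto
  define \<tau> where "\<tau> = min 1 (min (f u / 4) (c / 2))"
  have \<tau>: "\<tau> > 0" "\<tau> \<le> 1" "\<tau> \<le> f u / 4" "\<tau> \<le> c / 2" using fu0 c by (auto simp: \<tau>_def)
  \<comment> \<open>One ratio for two kinds of balls: \<open>c / 4\<close> keeps \<open>f\<close>
    negative around exterior corkscrew points, and \<open>1 / (16 * D)\<close> makes the radius at
    most \<open>f p / 8\<close> around John points, where
    \<open>f p \<ge> s / (2 * D)\<close>.\<close>
  define cc where "cc = min (c / 4) (1 / (16 * D))"
  have cc: "0 < cc" "cc < 1" "cc \<le> c / 4" "cc \<le> 1 / (16 * D)" using c D by (auto simp: cc_def)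
  have cc4: "cc \<le> 1/4" using cc(3) c by linarith
  have inb: "ball p (cc * s) \<subseteq> ball z s" if "dist z p \<le> s / 2" "0 < s" for p z and s :: real
  proof
    fix q assume "q \<in> ball p (cc * s)"
    then have "dist p q < cc * s" by simp
    moreover have "cc * s \<le> 1/4 * s" using cc4 that by (intro mult_right_mono) auto
    ultimately have "dist z q < s" using dist_triangle[of z q p] that by linarith
    then show "q \<in> ball z s" by simp
  qed
  obtain z s1 where z: "z \<in> cball 0 R" "f z = 0" "s1 > 0"
    and hit: "\<And>s p. 0 < s \<Longrightarrow> s < s1 \<Longrightarrow> ball p (cc * s) \<subseteq> ball z s \<Longrightarrow> (\<forall>q\<in>ball p (cc * s). f q > 0) \<Longrightarrow> ball p (cc * s) \<inter> V \<noteq> {}"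
  proof (rule clean_crossing[OF dim B.continuous_f _ Vpos _ \<tau>(1,2) _ _ nu _ R_def cc(1,2), of v "2 * Da\<^sup>2 * (32 * R) ^ n"])
    show "open V" "open ({x. 0 < f x} - V)" unfolding V_def by (rule B.open_reach, rule B.open_not_reach)
    show "ball u \<tau> \<subseteq> V"
    proof
      fix q assume "q \<in> ball u \<tau>"
      then have "dist u q < f u / 4" using \<tau>(3) by auto
      then show "q \<in> V" using B.reach_iff[OF fu0, of q X'] uV by (simp add: V_def)
    qed
    show "ball v \<tau> \<inter> V = {}"
    proof -
      have "f q < 0" if "q \<in> ball v \<tau>" for q
        using that \<tau>(4) v(2) B.f_lipschitz[of q v] by (auto simp: dist_commute)
      then show ?thesis using Vpos by fastforce
    qed
    show "norm v \<le> 1" using v(1) by simp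
    show "real (card Q) * s ^ n \<le> 2 * Da\<^sup>2 * (32 * R) ^ n"
      if "0 < s" "s \<le> 1" "finite Q" "Q \<subseteq> {x. f x = 0} \<inter> cball 0 R" "\<And>x y. x \<in> Q \<Longrightarrow> y \<in> Q \<Longrightarrow> x \<noteq> y \<Longrightarrow> s \<le> dist x y" for s Q
      using B.zeros_packing[OF adr R1(1) _ that] small R1(2) by simp
    show "\<exists>p. ball p (cc * s) \<subseteq> ball z s \<and> (\<forall>q\<in>ball p (cc * s). f q < 0)" if zs: "z \<in> cball 0 R" "f z = 0" "0 < s" "s \<le> 1" for z s
    proof -
      obtain p where p: "dist z p \<le> s / 2" "f p \<le> - c * (s / 2)"
        using B.exterior_corkscrew_limit[OF c ext small1 zs(2-4)] by blast
      have "f q < 0" if "q \<in> ball p (cc * s)" for q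
      proof -
        have "cc * s \<le> c / 4 * s" using cc zs by (intro mult_right_mono) auto
        moreover have "c / 4 * s > 0" using c zs by simp
        ultimately show ?thesis using that p(2) B.f_lipschitz[of q p] by (auto simp: dist_commute)
      qed
      then show ?thesis using inb[OF p(1)] zs by blast
    qed
  qed (rule that; assumption)
  \<comment> \<open>\<open>s < s1\<close> is the range of the crossing lemma;
    \<open>s \<le> b\<close> makes the John paths long enough to reach distance \<open>s/2\<close>
    from their start.\<close>
  define s where "s = min (s1 / 2) b"
  have s: "0 < s" "s < s1" "s \<le> b" using z(3) b by (auto simp: s_def)
  have jt: "\<And>k. john_target \<Omega> D (x (\<psi> k)) (A * r (\<psi> k)) (L * r (\<psi> k)) (Y' k)"
   "\<And>k. b * r (\<psi> k) \<le> infdist (Y' k) (frontier \<Omega>)" unfolding Y'_def by (rule seq0)+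
  have zA: "norm z < A" using z(1) R1 by auto
  obtain p m where p: "dist z p \<le> s / 2" "f p \<ge> s / (2 * D)"
    and fr: "\<And>N. (\<forall>\<^sub>F k in sequentially. hconn \<Omega> N (X' k) (x (\<psi> k) + r (\<psi> k) *\<^sub>R p)) \<Longrightarrow> \<exists>\<^sub>F k in sequentially. hconn \<Omega> (N + 1 + m) (X' k) (Y' k)"
    by (rule B.john_limit[OF D jt zA z(2) s(1,3), of X']) (rule that)
  have fp0: "f p > 0" using p(2) s D by (meson divide_pos_pos less_le_trans mult_pos_pos zero_less_numeral zero_less_one)
  have near: "dist p q < f p / 4" if "q \<in> ball p (cc * s)" for q
  proof -
    have "cc * s \<le> 1 / (16 * D) * s" using cc s by (intro mult_right_mono) auto
    also have "\<dots> = s / (2 * D) / 8" by simp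
    also have "\<dots> \<le> f p / 8" using p(2) by simp
    finally show ?thesis using that fp0 by auto
  qed
  \<comment> \<open>The whole ball is one chain step away from \<open>p\<close>, so meeting
    \<open>V\<close> anywhere puts \<open>p\<close> itself into \<open>V\<close>.\<close>
  have "ball p (cc * s) \<inter> V \<noteq> {}"
    by (rule hit[OF s(1,2) inb[OF p(1) s(1)]]) (use near B.f_pos_near fp0 in blast)
  then have "p \<in> V" using near B.reach_iff[OF fp0] unfolding V_def by blast
  then obtain N where "\<forall>\<^sub>F k in sequentially. hconn \<Omega> N (X' k) (x (\<psi> k) + r (\<psi> k) *\<^sub>R p)"
    unfolding V_def B.reach_def by blast
  \<comment> \<open>An index beyond the length of the chain contradicts the choice of the pair,
    which admits no chain of length \<open>\<psi> k \<ge> k\<close>.\<close>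
  from fr[OF this] obtain k where k: "k \<ge> N + 1 + m" "hconn \<Omega> (N + 1 + m) (X' k) (Y' k)"
    unfolding frequently_sequentially by blast
  have "N + 1 + m \<le> \<psi> k" using seq_suble[OF \<psi>, of k] k(1) by linarith
  then show False using hconn_mono[OF k(2)] seq0(9)[of "\<psi> k"] by (auto simp: X'_def Y'_def)
qed

section \<open>Chains far from the boundary and two geometric lemmas\<close>


text \<open>Balls of half the boundary distance \<open>\<delta>\<close> around the chain points have
  diameter \<open>\<delta>\<close> and lie at distance between \<open>\<delta> / 2\<close> and
  \<open>\<delta>\<close> from the frontier. A chain of \<open>k\<close> steps has
  \<open>k + 1\<close> points.\<close>

lemma hconn_ball_chain:
  fixes \<Omega> :: "'a::euclidean_space set"
  assumes opn: "open \<Omega>" and ne: "frontier \<Omega> \<noteq> {}" and h: "hconn \<Omega> N X X'"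
  shows "\<exists>(M::nat) (B :: nat \<Rightarrow> 'a set). 1 \<le> M \<and> M \<le> N + 1 \<and>
           (\<forall>k\<in>{1..M}. (\<exists>y s. 0 < s \<and> B k = ball y s) \<and> B k \<subseteq> \<Omega> \<and>
              diameter (B k) / 2 \<le> setdist (B k) (frontier \<Omega>) \<and>
              setdist (B k) (frontier \<Omega>) \<le> 2 * diameter (B k)) \<and>
           X \<in> B 1 \<and> X' \<in> B M \<and>
           (\<forall>k\<in>{1..<M}. B k \<inter> B (Suc k) \<noteq> {})"
proof -
  obtain k where k: "k \<le> N" "(hstep \<Omega> ^^ k) X X'" using h by (auto simp: hconn_def)
  obtain g where g: "g 0 = X" "g k = X'" "\<And>i. i < k \<Longrightarrow> hstep \<Omega> (g i) (g (Suc i))"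
    using k(2) unfolding relpowp_fun_conv by blast
  have gO: "g i \<in> \<Omega>" if "i \<le> k" for i
    using that g(2,3) hconn_mem(2)[OF h] by (cases "i = k") (auto simp: hstep_def)
  define \<delta> where "\<delta> = (\<lambda>i. infdist (g i) (frontier \<Omega>))"
  have \<delta>: "\<delta> i > 0" if "i \<le> k" for i unfolding \<delta>_def by (rule infdist_frontier_pos[OF opn ne gO[OF that]])
  define B where "B = (\<lambda>j. ball (g (j - 1)) (\<delta> (j - 1) / 2))"
  have dia: "diameter (ball (g i) (\<delta> i / 2)) = \<delta> i" if "i \<le> k" for i
    using \<delta>[OF that] by simp
  have inO: "ball (g i) (\<delta> i / 2) \<subseteq> \<Omega>" if "i \<le> k" for i
  proof
    fix y assume "y \<in> ball (g i) (\<delta> i / 2)"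
    then have "dist (g i) y < infdist (g i) (frontier \<Omega>)" using \<delta>[OF that] by (simp add: \<delta>_def)
    then show "y \<in> \<Omega>" by (rule mem_of_dist_less[OF gO[OF that]])
  qed
  have lo: "\<delta> i / 2 \<le> setdist (ball (g i) (\<delta> i / 2)) (frontier \<Omega>)" if "i \<le> k" for i
  proof (rule le_setdistI)
    fix y z assume "y \<in> ball (g i) (\<delta> i / 2)" "z \<in> frontier \<Omega>"
    then show "\<delta> i / 2 \<le> dist y z"
      using infdist_le[of z "frontier \<Omega>" "g i"] dist_triangle[of "g i" z y] by (simp add: \<delta>_def)
  qed (use ne \<delta>[OF that] in auto)
  have up: "setdist (ball (g i) (\<delta> i / 2)) (frontier \<Omega>) \<le> \<delta> i" if "i \<le> k" for i
  proof -
    obtain z where "z \<in> frontier \<Omega>" "dist (g i) z = infdist (g i) (frontier \<Omega>)" using frontier_nearest[OF ne] .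
    moreover have "g i \<in> ball (g i) (\<delta> i / 2)" using \<delta>[OF that] by simp
    ultimately show ?thesis using setdist_le_dist unfolding \<delta>_def by metis
  qed
  have int: "ball (g i) (\<delta> i / 2) \<inter> ball (g (Suc i)) (\<delta> (Suc i) / 2) \<noteq> {}" if i: "i < k" for i
  proof (cases "\<delta> i \<le> \<delta> (Suc i)")
    case True
    then have "g i \<in> ball (g (Suc i)) (\<delta> (Suc i) / 2)" using g(3)[OF i] by (simp add: hstep_def \<delta>_def dist_commute)
    moreover have "g i \<in> ball (g i) (\<delta> i / 2)" using \<delta>[of i] i by simp
    ultimately show ?thesis by blast
  next
    case False
    then have "g (Suc i) \<in> ball (g i) (\<delta> i / 2)" using g(3)[OF i] by (simp add: hstep_def \<delta>_def)
    moreover have "g (Suc i) \<in> ball (g (Suc i)) (\<delta> (Suc i) / 2)" using \<delta>[of "Suc i"] i by simp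
    ultimately show ?thesis by blast
  qed
  show ?thesis
  proof (intro exI[of _ "k + 1"] exI[of _ B] conjI ballI)
    fix j assume j: "j \<in> {1..k+1}"
    then have jk: "j - 1 \<le> k" by auto
    show "\<exists>y s. 0 < s \<and> B j = ball y s" unfolding B_def using \<delta>[OF jk] by (intro exI[of _ "g (j-1)"] exI[of _ "\<delta> (j-1) / 2"]) auto
    show "B j \<subseteq> \<Omega>" unfolding B_def by (rule inO[OF jk])
    show "diameter (B j) / 2 \<le> setdist (B j) (frontier \<Omega>)" unfolding B_def dia[OF jk] by (rule lo[OF jk])
    show "setdist (B j) (frontier \<Omega>) \<le> 2 * diameter (B j)" unfolding B_def dia[OF jk] using up[OF jk] \<delta>[OF jk] by linarith
  next
    fix j assume j: "j \<in> {1..<k+1}"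
    then have "j - 1 < k" "Suc (j - 1) = j" by auto
    then show "B j \<inter> B (Suc j) \<noteq> {}" unfolding B_def using int[of "j - 1"] by simp
  qed (use k \<delta>[of 0] \<delta>[of k] g in \<open>auto simp: B_def\<close>)
qed

lemma harnack_chainI:
  fixes \<Omega> :: "'a::euclidean_space set"
  assumes opn: "open \<Omega>" and ne: "frontier \<Omega> \<noteq> {}"
    and h: "\<And>\<Lambda>. \<Lambda> \<ge> 1 \<Longrightarrow> \<exists>N. \<forall>\<rho>>0. \<forall>X\<in>\<Omega>. \<forall>X'\<in>\<Omega>.
        infdist X (frontier \<Omega>) \<ge> \<rho> \<and> infdist X' (frontier \<Omega>) \<ge> \<rho> \<and> dist X X' < \<Lambda> * \<rho> \<longrightarrow> hconn \<Omega> N X X'"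
  shows "harnack_chain \<Omega>"
proof -
  obtain N where N: "\<And>\<Lambda> \<rho> X X'. \<Lambda> \<ge> 1 \<Longrightarrow> \<rho> > 0 \<Longrightarrow> X \<in> \<Omega> \<Longrightarrow> X' \<in> \<Omega> \<Longrightarrow>
        infdist X (frontier \<Omega>) \<ge> \<rho> \<and> infdist X' (frontier \<Omega>) \<ge> \<rho> \<and> dist X X' < \<Lambda> * \<rho> \<Longrightarrow> hconn \<Omega> (N \<Lambda>) X X'"
    using h by metis
  show ?thesis
    unfolding harnack_chain_def
  proof (rule exI[of _ 2], rule conjI, simp, rule exI[of _ "\<lambda>\<Lambda>. real (N \<Lambda> + 1)"], intro allI impI ballI)
    fix \<rho> \<Lambda> X X' assume *: "0 < \<rho>" "1 \<le> \<Lambda>" "X \<in> \<Omega>" "X' \<in> \<Omega>" "infdist X (frontier \<Omega>) \<ge> \<rho> \<and> infdist X' (frontier \<Omega>) \<ge> \<rho> \<and> dist X X' < \<Lambda> * \<rho>"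
    show "\<exists>(M::nat) (B :: nat \<Rightarrow> 'a set). 1 \<le> M \<and> real M \<le> real (N \<Lambda> + 1) \<and>
           (\<forall>k\<in>{1..M}. (\<exists>y s. 0 < s \<and> B k = ball y s) \<and> B k \<subseteq> \<Omega> \<and>
              diameter (B k) / 2 \<le> setdist (B k) (frontier \<Omega>) \<and>
              setdist (B k) (frontier \<Omega>) \<le> 2 * diameter (B k)) \<and>
           X \<in> B 1 \<and> X' \<in> B M \<and> (\<forall>k\<in>{1..<M}. B k \<inter> B (Suc k) \<noteq> {})"
      unfolding of_nat_le_iff by (rule hconn_ball_chain[OF opn ne N[OF *(2,1,3,4,5)]])
  qed
qed

text \<open>Finitely many neighbourhoods cover \<open>C\<close>; a chain to the centre of one of
  them and a single further step reach every point.\<close>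

lemma compact_uniform_chain:
  fixes S :: "'a::topological_space \<Rightarrow> 'a \<Rightarrow> bool"
  assumes C: "compact C" and lnk: "\<And>v. v \<in> C \<Longrightarrow> \<exists>k. (S ^^ k) u v"
    and loc: "\<And>p. p \<in> C \<Longrightarrow> \<exists>U. open U \<and> p \<in> U \<and> (\<forall>q\<in>U \<inter> C. S p q)"
  shows "\<exists>N. \<forall>v\<in>C. \<exists>k\<le>N. (S ^^ k) u v"
proof -
  obtain n where n: "\<And>v. v \<in> C \<Longrightarrow> (S ^^ n v) u v" using lnk by metis
  obtain U where U: "\<And>p. p \<in> C \<Longrightarrow> open (U p)" "\<And>p. p \<in> C \<Longrightarrow> p \<in> U p" "\<And>p q. p \<in> C \<Longrightarrow> q \<in> U p \<Longrightarrow> q \<in> C \<Longrightarrow> S p q"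
    using loc by (metis IntI)
  obtain T where T: "T \<subseteq> C" "finite T" "C \<subseteq> (\<Union>p\<in>T. U p)"
  proof (rule compactE_image[OF C, of C U])
    show "C \<subseteq> (\<Union>p\<in>C. U p)" using U(2) by blast
  qed (use U(1) in auto)
  show ?thesis
  proof (rule exI, rule ballI)
    fix v assume v: "v \<in> C"
    then obtain p where p: "p \<in> T" "v \<in> U p" using T by blast
    then have "(S ^^ Suc (n p)) u v" using n[of p] U(3)[of p v] T(1) v by auto
    moreover have "Suc (n p) \<le> Suc (Max (n ` T))" using T(2) p(1) by simp
    ultimately show "\<exists>k\<le>Suc (Max (n ` T)). (S ^^ k) u v" by blast
  qed
qed

section \<open>Chains of unspecified length, and chains around a bounded boundary\<close>

definition hlinked :: "'a::euclidean_space set \<Rightarrow> 'a \<Rightarrow> 'a \<Rightarrow> bool" where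
  "hlinked \<Omega> p q \<longleftrightarrow> (\<exists>N. hconn \<Omega> N p q)"

lemma hlinked_sym: "hlinked \<Omega> p q \<Longrightarrow> hlinked \<Omega> q p"
  unfolding hlinked_def using hconn_sym by blast

lemma hlinked_trans: "hlinked \<Omega> p q \<Longrightarrow> hlinked \<Omega> q r \<Longrightarrow> hlinked \<Omega> p r"
  unfolding hlinked_def using hconn_trans by blast

lemma hconn_near: "p \<in> \<Omega> \<Longrightarrow> dist p q < infdist p (frontier \<Omega>) / 2 \<Longrightarrow> hconn \<Omega> 1 p q"
  by (intro hconn_step hstepI)

lemma hlinked_connected:
  fixes \<Omega> :: "'a::euclidean_space set"
  assumes opn: "open \<Omega>" and ne: "frontier \<Omega> \<noteq> {}" and T: "connected T" "T \<subseteq> \<Omega>" and ab: "a \<in> T" "b \<in> T"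
  shows "hlinked \<Omega> a b"
proof (rule connected_equivalence_relation[OF T(1) ab])
  show "hlinked \<Omega> x y" if "hlinked \<Omega> y x" for x y using hlinked_sym[OF that] .
  show "hlinked \<Omega> x z" if "hlinked \<Omega> x y" "hlinked \<Omega> y z" for x y z using hlinked_trans[OF that] .
  fix a assume a: "a \<in> T"
  let ?U = "T \<inter> ball a (infdist a (frontier \<Omega>) / 2)"
  have "a \<in> ?U" using a infdist_frontier_pos[OF opn ne, of a] T(2) by auto
  moreover have "openin (top_of_set T) ?U" by (intro openin_open_Int) simp
  moreover have "\<forall>x\<in>?U. hlinked \<Omega> a x" using hconn_near a T(2) unfolding hlinked_def by (metis IntE mem_ball subsetD)
  ultimately show "\<exists>U. openin (top_of_set T) U \<and> a \<in> U \<and> (\<forall>x\<in>U. hlinked \<Omega> a x)" by blast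
qed

text \<open>Seen from scale \<open>\<rho>\<close>, the boundary is a small set near
  \<open>p\<close>, and the rescaled points lie in the compact annulus
  \<open>1 \<le> norm u \<le> M\<close>, connected in dimension at least 2. The chains are built in
  this annulus, so \<open>N\<close> depends only on \<open>M\<close> and the dimension.\<close>

lemma annulus_chain:
  assumes dim: "2 \<le> DIM('a::euclidean_space)" and M: "M \<ge> (1::real)"
  shows "\<exists>N. \<forall>(\<Omega>::'a set) p d \<rho> X X'. frontier \<Omega> \<noteq> {} \<longrightarrow> frontier \<Omega> \<subseteq> cball p d \<longrightarrow> 8 * d \<le> \<rho> \<longrightarrow> 0 < \<rho> \<longrightarrow>
    X \<in> \<Omega> \<longrightarrow> \<rho> \<le> dist p X \<longrightarrow> dist p X \<le> M * \<rho> \<longrightarrow> \<rho> \<le> dist p X' \<longrightarrow> dist p X' \<le> M * \<rho> \<longrightarrow> hconn \<Omega> N X X'"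
proof -
  define K where "K = {x::'a. 1 \<le> norm (x - 0) \<and> norm (x - 0) \<le> M}"
  have conK: "connected K" unfolding K_def by (rule connected_annulus(4)[OF dim])
  have K': "K = cball 0 M - ball 0 1" by (auto simp: K_def)
  have comK: "compact K" unfolding K' by (intro compact_diff) auto
  define S where "S = (\<lambda>u v. u \<in> K \<and> v \<in> K \<and> dist u v < 1/8)"
  have Ssym: "S u v \<Longrightarrow> S v u" for u v by (simp add: S_def dist_commute)
  have link: "\<exists>k. (S ^^ k) a b" if ab: "a \<in> K" "b \<in> K" for a b
  proof (rule connected_equivalence_relation[OF conK ab, of "\<lambda>a b. \<exists>k. (S ^^ k) a b"])
    show "\<exists>k. (S ^^ k) x y" if "\<exists>k. (S ^^ k) y x" for x y using that relpowp_sym[of S, OF Ssym] by blast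
    show "\<exists>k. (S ^^ k) x z" if "\<exists>k. (S ^^ k) x y" "\<exists>k. (S ^^ k) y z" for x y z using that relpowp_trans by metis
    fix a assume a: "a \<in> K"
    have "\<exists>k. (S ^^ k) a x" if "x \<in> K \<inter> ball a (1/8)" for x
    proof -
      have "S a x" using that a by (simp add: S_def)
      then have "(S ^^ 1) a x" unfolding relpowp_1 .
      then show ?thesis by blast
    qed
    moreover have "openin (top_of_set K) (K \<inter> ball a (1/8))" by (intro openin_open_Int) simp
    ultimately show "\<exists>T. openin (top_of_set K) T \<and> a \<in> T \<and> (\<forall>x\<in>T. \<exists>k. (S ^^ k) a x)" using a
      by (intro exI[of _ "K \<inter> ball a (1/8)"]) auto
  qed
  obtain u0 where u0: "u0 \<in> K"
  proof -
    obtain e :: 'a where "e \<in> Basis" using nonempty_Basis by blast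
    then have "e \<in> K" using M by (simp add: K_def)
    then show ?thesis using that by blast
  qed
  have "\<exists>N. \<forall>v\<in>K. \<exists>k\<le>N. (S ^^ k) u0 v"
  proof (rule compact_uniform_chain[OF comK])
    show "\<exists>k. (S ^^ k) u0 v" if "v \<in> K" for v by (rule link[OF u0 that])
    show "\<exists>U. open U \<and> p \<in> U \<and> (\<forall>q\<in>U \<inter> K. S p q)" if "p \<in> K" for p
      using that by (intro exI[of _ "ball p (1/8)"]) (auto simp: S_def)
  qed
  then obtain N where N: "\<And>v. v \<in> K \<Longrightarrow> \<exists>k\<le>N. (S ^^ k) u0 v" by blast
  show ?thesis
  proof (intro exI[of _ "N + N"] allI impI)
    fix \<Omega> :: "'a set" and p d \<rho> X X'
    assume ne: "frontier \<Omega> \<noteq> {}" and E: "frontier \<Omega> \<subseteq> cball p d" and d: "8 * d \<le> \<rho>" and \<rho>: "0 < \<rho>"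
      and X: "X \<in> \<Omega>" "\<rho> \<le> dist p X" "dist p X \<le> M * \<rho>" and X': "\<rho> \<le> dist p X'" "dist p X' \<le> M * \<rho>"
    let ?q = "\<lambda>u. p + \<rho> *\<^sub>R u"
    have st: "hstep \<Omega> (?q u) (?q v)" if uv: "S u v" "?q u \<in> \<Omega>" for u v
    proof (rule hstepI[OF uv(2)])
      obtain z where z: "z \<in> frontier \<Omega>" "dist (?q u) z = infdist (?q u) (frontier \<Omega>)" using frontier_nearest[OF ne] .
      have "\<rho> * 1 \<le> \<rho> * norm u" using uv \<rho> by (intro mult_left_mono) (auto simp: S_def K_def)
      then have "\<rho> \<le> dist p (?q u)" using \<rho> by (simp add: dist_norm)
      moreover have "dist p z \<le> d" using z E by auto
      \<comment> \<open>Half of the distance \<open>\<rho> - \<rho> / 8\<close> exceeds the step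
        length \<open>\<rho> / 8\<close>.\<close>
      ultimately have "infdist (?q u) (frontier \<Omega>) \<ge> \<rho> - \<rho> / 8"
        using dist_triangle[of p "?q u" z] z(2) d by (simp add: dist_commute)
      moreover have "dist (?q u) (?q v) = \<rho> * dist u v"
      proof -
        have "?q u - ?q v = \<rho> *\<^sub>R (u - v)" by (simp add: scaleR_diff_right)
        then show ?thesis using \<rho> by (simp add: dist_norm)
      qed
      moreover have "\<rho> * dist u v < \<rho> * (1/8)" using uv(1) \<rho> by (intro mult_strict_left_mono) (auto simp: S_def)
      ultimately show "dist (?q u) (?q v) < infdist (?q u) (frontier \<Omega>) / 2" using \<rho> by linarith
    qed
    have chain: "(S ^^ k) u v \<Longrightarrow> ?q u \<in> \<Omega> \<Longrightarrow> (hstep \<Omega> ^^ k) (?q u) (?q v) \<and> ?q v \<in> \<Omega>" for k u v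
    proof (induction k arbitrary: v)
      case (Suc k)
      then obtain y where y: "(S ^^ k) u y" "S y v" by auto
      then have "(hstep \<Omega> ^^ k) (?q u) (?q y)" "?q y \<in> \<Omega>" using Suc by auto
      moreover have "hstep \<Omega> (?q y) (?q v)" using st y calculation by blast
      moreover from this have "?q v \<in> \<Omega>" by (simp add: hstep_def)
      ultimately show ?case by auto
    qed auto
    define u where "u = (X - p) /\<^sub>R \<rho>"
    define u' where "u' = (X' - p) /\<^sub>R \<rho>"
    have u: "u \<in> K" "u' \<in> K" "?q u = X" "?q u' = X'"
    proof -
      have "norm u = dist p X / \<rho>" "norm u' = dist p X' / \<rho>"
        using \<rho> by (simp_all add: u_def u'_def dist_norm norm_minus_commute divide_inverse mult.commute)
      then show "u \<in> K" "u' \<in> K" using X X' \<rho> by (simp_all add: K_def pos_le_divide_eq pos_divide_le_eq)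
      show "?q u = X" "?q u' = X'" using \<rho> by (simp_all add: u_def u'_def)
    qed
    obtain k k' where k: "k \<le> N" "(S ^^ k) u0 u" "k' \<le> N" "(S ^^ k') u0 u'" using N u by meson
    have "(S ^^ (k + k')) u u'" using relpowp_trans[OF relpowp_sym[of S, OF Ssym k(2)] k(4)] .
    then have "(hstep \<Omega> ^^ (k + k')) X X' \<and> X' \<in> \<Omega>" using chain[of "k + k'" u u'] u X(1) by simp
    then show "hconn \<Omega> (N + N) X X'" unfolding hconn_def using X(1) k by (meson add_mono)
  qed
qed

section \<open>Frontiers that are too small to separate\<close>

lemma connected_avoids_frontier:
  assumes "connected T" "T \<inter> frontier \<Omega> = {}" "x \<in> T" "x \<in> \<Omega>"
  shows "T \<subseteq> \<Omega>"
  using connected_Int_frontier[OF assms(1), of \<Omega>] assms by blast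

text \<open>Otherwise the two half balls cut off by the hyperplane would lie on different sides of the
  boundary, so the boundary would contain an \<open>n\<close>-dimensional disc, hence a segment of the sphere.\<close>

lemma frontier_not_in_two_spheres:
  fixes \<Omega> :: "'a::euclidean_space set"
  assumes dim: "2 \<le> DIM('a)" and opn: "open \<Omega>" and s: "s > 0" and y: "y \<noteq> y'" and z: "z \<in> frontier \<Omega>"
    and ext: "W \<subseteq> ball z s" "open W" "W \<noteq> {}" "W \<inter> \<Omega> = {}"
    and sub: "frontier \<Omega> \<inter> ball z s \<subseteq> {p. dist p y = d \<and> dist p y' = d}"
  shows False
proof -
  \<comment> \<open>The hyperplane \<open>v \<bullet> p = \<kappa>\<close> is the perpendicular
    bisector of \<open>y\<close> and \<open>y'\<close>.\<close>
  define v where "v = y' - y"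
  define \<kappa> where "\<kappa> = ((norm y')\<^sup>2 - (norm y)\<^sup>2) / 2"
  have v0: "v \<noteq> 0" using y by (simp add: v_def)
  have bis: "v \<bullet> p = \<kappa>" if "dist p y = d" "dist p y' = d" for p
  proof -
    have "(norm (p - y))\<^sup>2 = (norm (p - y'))\<^sup>2" using that by (simp add: dist_norm)
    then show ?thesis unfolding v_def \<kappa>_def power2_norm_eq_inner by (simp add: inner_diff_left inner_diff_right inner_commute)
  qed
  define H where "H = (\<lambda>i. if i then ball z s \<inter> {p. v \<bullet> p < \<kappa>} else ball z s \<inter> {p. v \<bullet> p > \<kappa>})"
  have conH: "connected (H i)" for i
    unfolding H_def using convex_halfspace_lt[of v \<kappa>] convex_halfspace_gt[of \<kappa> v]
    by (auto intro!: convex_connected convex_Int)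
  have HE: "H i \<inter> frontier \<Omega> = {}" for i
    unfolding H_def using sub bis by (auto split: if_splits)
  have move: "\<exists>q. q \<in> O' \<inter> H i" if O': "open O'" "q \<in> O'" "q \<in> ball z s" "v \<bullet> q = \<kappa>" for O' q i
  proof -
    have "open (O' \<inter> ball z s)" using O' by auto
    then obtain e where e: "e > 0" "ball q e \<subseteq> O' \<inter> ball z s" using O' by (meson IntI open_contains_ball)
    define t where "t = e / (2 * norm v)"
    have t: "t > 0" "t * norm v = e / 2" using e v0 by (auto simp: t_def)
    have "q - t *\<^sub>R v \<in> ball q e" "q + t *\<^sub>R v \<in> ball q e" using t e by (auto simp: dist_norm)
    then have "q - t *\<^sub>R v \<in> O' \<inter> ball z s" "q + t *\<^sub>R v \<in> O' \<inter> ball z s" using e by blast+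
    moreover have "v \<bullet> (q - t *\<^sub>R v) < \<kappa>" "v \<bullet> (q + t *\<^sub>R v) > \<kappa>"
      using O'(4) t v0 by (auto simp: inner_diff_right inner_add_right)
    ultimately show ?thesis unfolding H_def by (cases i) auto
  qed
  have meets: "\<exists>i. O' \<inter> H i \<noteq> {}" if O': "open O'" "q \<in> O'" "q \<in> ball z s" for O' q
  proof (cases "v \<bullet> q" \<kappa> rule: linorder_cases)
    case less then have "q \<in> H True" using O' by (simp add: H_def)
    then show ?thesis using O' by blast
  next
    case equal then show ?thesis using move[OF O'] by blast
  next
    case greater then have "q \<in> H False" using O' by (simp add: H_def)
    then show ?thesis using O' by blast
  qed
  \<comment> \<open>One half ball meets \<open>\<Omega>\<close> and so lies in it; the half ball
    that meets \<open>W\<close> avoids \<open>\<Omega>\<close>. Every point of the bisecting disc is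
    a limit of both.\<close>
  have "z \<in> closure \<Omega>" using z by (simp add: frontier_def)
  then obtain q where "q \<in> \<Omega>" "q \<in> ball z s" using s by (metis closure_approachable dist_commute mem_ball)
  then obtain i where i: "\<Omega> \<inter> H i \<noteq> {}" using meets opn by blast
  then have Hi: "H i \<subseteq> \<Omega>" using connected_avoids_frontier[OF conH HE] by blast
  obtain j where j: "W \<inter> H j \<noteq> {}" using meets ext by blast
  have Hj: "H j \<inter> \<Omega> = {}"
  proof (rule ccontr)
    assume "H j \<inter> \<Omega> \<noteq> {}"
    then have "H j \<subseteq> \<Omega>" using connected_avoids_frontier[OF conH HE] by blast
    then show False using j ext(4) by blast
  qed
  have disc: "p \<in> frontier \<Omega>" if p: "p \<in> ball z s" "v \<bullet> p = \<kappa>" for p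
  proof -
    have "p \<notin> \<Omega>" using move[OF opn _ p, of j] Hj by blast
    moreover have "p \<in> closure \<Omega>"
      unfolding closure_approachable
    proof (intro allI impI)
      fix e :: real assume "e > 0"
      then obtain q where "q \<in> ball p e \<inter> H i" using move[of "ball p e" p i] p by auto
      then show "\<exists>q\<in>\<Omega>. dist q p < e" using Hi by (auto simp: dist_commute)
    qed
    ultimately show ?thesis using opn by (simp add: frontier_def interior_open)
  qed
  \<comment> \<open>A direction along the bisector. The points \<open>z + t w\<close> and
    \<open>z - t w\<close> and their midpoint \<open>z\<close> would all have distance
    \<open>d\<close> from \<open>y\<close>, which the parallelogram law forbids.\<close>
  obtain w where w: "w \<noteq> 0" "orthogonal v w" using orthogonal_to_vector_exists[OF dim] by metis
  define t where "t = s / (2 * norm w)"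
  have t: "t > 0" "t * norm w = s / 2" using s w by (auto simp: t_def)
  have zb: "v \<bullet> z = \<kappa>" "dist z y = d" using sub z s bis by auto
  have "dist (z + t *\<^sub>R w) y = d" "dist (z - t *\<^sub>R w) y = d"
  proof -
    have "z + t *\<^sub>R w \<in> ball z s" "z - t *\<^sub>R w \<in> ball z s" using t s by (auto simp: dist_norm)
    moreover have "v \<bullet> (z + t *\<^sub>R w) = \<kappa>" "v \<bullet> (z - t *\<^sub>R w) = \<kappa>"
      using zb(1) w(2) by (simp_all add: inner_add_right inner_diff_right orthogonal_def)
    ultimately have "z + t *\<^sub>R w \<in> frontier \<Omega> \<inter> ball z s" "z - t *\<^sub>R w \<in> frontier \<Omega> \<inter> ball z s"
      using disc by blast+
    then show "dist (z + t *\<^sub>R w) y = d" "dist (z - t *\<^sub>R w) y = d" using sub by blast+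
  qed
  then have "(norm ((z - y) + t *\<^sub>R w))\<^sup>2 + (norm ((z - y) - t *\<^sub>R w))\<^sup>2 = 2 * (norm (z - y))\<^sup>2"
    using zb(2) by (simp add: dist_norm algebra_simps)
  moreover have "(norm ((z - y) + t *\<^sub>R w))\<^sup>2 + (norm ((z - y) - t *\<^sub>R w))\<^sup>2 = 2 * (norm (z - y))\<^sup>2 + 2 * (norm (t *\<^sub>R w))\<^sup>2"
    unfolding power2_norm_eq_inner by (simp add: inner_diff_left inner_diff_right inner_add_left inner_add_right inner_commute)
  ultimately show False using t w by simp
qed

text \<open>A punctured ball is connected in dimension at least 2, so around an isolated boundary
  point \<open>\<Omega>\<close> would fill it and leave no room for the open set
  \<open>W\<close>.\<close>

lemma frontier_not_isolated:
  fixes \<Omega> :: "'a::euclidean_space set"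
  assumes dim: "2 \<le> DIM('a)" and opn: "open \<Omega>" and s: "s > 0" and z: "z \<in> frontier \<Omega>"
    and ext: "W \<subseteq> ball z s" "open W" "W \<noteq> {}" "W \<inter> \<Omega> = {}"
  obtains z' where "z' \<in> frontier \<Omega>" "z' \<in> ball z s" "z' \<noteq> z"
proof -
  have "\<exists>z'. z' \<in> frontier \<Omega> \<and> z' \<in> ball z s \<and> z' \<noteq> z"
  proof (rule ccontr)
    assume "\<not> ?thesis"
    then have E: "(ball z s - {z}) \<inter> frontier \<Omega> = {}" by blast
    have con: "connected (ball z s - {z})" by (intro connected_open_delete dim) auto
    have "z \<in> closure \<Omega>" "z \<notin> \<Omega>" using z opn by (auto simp: frontier_def interior_open)
    then obtain q where q: "q \<in> \<Omega>" "q \<in> ball z s" "q \<noteq> z" using s by (metis closure_approachable dist_commute mem_ball)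
    then have sub: "ball z s - {z} \<subseteq> \<Omega>" using connected_avoids_frontier[OF con E, of q] by blast
    have "W \<subseteq> {z}" using sub ext by blast
    then have "W = {z}" using ext(3) by blast
    then show False using ext(2) not_open_singleton by blast
  qed
  then show thesis using that by blast
qed

section \<open>The Harnack chain condition\<close>


lemma ennreal_scale:
  assumes "0 < s" "0 < d"
  obtains r :: real where "0 < r" "r \<le> s" "ennreal r < d"
proof -
  have "(0::ennreal) < min (ennreal s) d" using assms by simp
  then obtain r' where r': "0 < r'" "r' < min (ennreal s) d" using dense by blast
  obtain r where rr: "r' = ennreal r" "0 \<le> r" using r'(2) by (cases r') auto
  have "r > 0" using r'(1) rr by simp
  moreover have "r < s" using r'(2) rr assms by (simp add: ennreal_less_iff)
  ultimately show thesis using that[of r] r' rr by simp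
qed

locale john_corkscrew_domain =
  fixes \<Omega> :: "'a::euclidean_space set" and n :: nat and Da c D :: real
  assumes n: "n \<ge> 1" and dim: "DIM('a) = Suc n" and opn: "open \<Omega>" and ne: "frontier \<Omega> \<noteq> {}"
    and adr: "adr_const n Da (frontier \<Omega>)" "Da \<ge> 1"
    and c: "0 < c" "c < 1"
    and ext: "\<And>y \<rho>. y \<in> frontier \<Omega> \<Longrightarrow> 0 < \<rho> \<Longrightarrow> ennreal \<rho> < ediam (frontier \<Omega>) \<Longrightarrow> \<exists>X. ball X (c * \<rho>) \<subseteq> ball y \<rho> \<inter> interior (- \<Omega>)"
    and D: "D \<ge> 1"
    and john: "\<And>x r. x \<in> frontier \<Omega> \<Longrightarrow> 0 < r \<Longrightarrow> ennreal r < ediam (frontier \<Omega>) \<Longrightarrow>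
      \<exists>Y. ball Y (r / D) \<subseteq> \<Omega> \<and> john_target \<Omega> D x r (D * r) Y"
begin

abbreviation E :: "'a set" where "E \<equiv> frontier \<Omega>"

definition A :: real where "A = 4 * (6 + 2 * real DIM('a))"

lemma A_ge: "A \<ge> 1" by (simp add: A_def)

lemma dim2: "2 \<le> DIM('a)" using dim n by simp

lemma john_center:
  assumes "x \<in> E" "0 < r" "ennreal r < ediam E"
  obtains Y where "john_target \<Omega> D x r (D * r) Y" "r / D \<le> infdist Y E"
proof -
  obtain Y where Y: "ball Y (r / D) \<subseteq> \<Omega>" "john_target \<Omega> D x r (D * r) Y" using john assms by blast
  obtain z where z: "z \<in> E" "dist Y z = infdist Y E" using frontier_nearest[OF ne] .
  have "z \<notin> \<Omega>" using z(1) opn by (simp add: frontier_def interior_open)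
  then have "r / D \<le> infdist Y E" using Y(1) z(2) by (metis mem_ball not_le subsetD)
  with Y(2) show thesis by (rule that)
qed

lemma key:
  assumes "0 < b"
  shows "\<exists>N. \<forall>x\<in>E. \<forall>r>0. \<forall>X Y. ennreal (A * r) < ediam E \<longrightarrow> X \<in> \<Omega> \<longrightarrow> dist x X \<le> r \<longrightarrow>
      b * r \<le> infdist X E \<longrightarrow> b * r \<le> infdist Y E \<longrightarrow> john_target \<Omega> D x (A * r) (L * r) Y \<longrightarrow> hconn \<Omega> N X Y"
  by (rule harnack_to_john_target[OF dim opn adr c _ D assms A_def]) (rule ext)

text \<open>Both points are joined to one John centre of the ball of radius
  \<open>A * r\<close>.\<close>

lemma small_scale_harnack:
  assumes b: "0 < b"
  shows "\<exists>N. \<forall>x\<in>E. \<forall>r>0. \<forall>X\<in>\<Omega>. \<forall>X'\<in>\<Omega>. ennreal (A * r) < ediam E \<longrightarrow> dist x X \<le> r \<longrightarrow> dist x X' \<le> r \<longrightarrow>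
      b * r \<le> infdist X E \<longrightarrow> b * r \<le> infdist X' E \<longrightarrow> hconn \<Omega> N X X'"
proof -
  define b' where "b' = min b (A / D)"
  have b': "0 < b'" "b' \<le> b" "b' \<le> A / D" using b A_ge D by (auto simp: b'_def)
  obtain N where N: "\<And>x r X Y. x \<in> E \<Longrightarrow> r > 0 \<Longrightarrow> ennreal (A * r) < ediam E \<Longrightarrow> X \<in> \<Omega> \<Longrightarrow> dist x X \<le> r \<Longrightarrow>
      b' * r \<le> infdist X E \<Longrightarrow> b' * r \<le> infdist Y E \<Longrightarrow> john_target \<Omega> D x (A * r) (D * A * r) Y \<Longrightarrow> hconn \<Omega> N X Y"
    using key[OF b'(1), of "D * A"] by blast
  show ?thesis
  proof (intro exI[of _ "N + N"] ballI allI impI)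
    fix x r X X' assume *: "x \<in> E" "0 < r" "X \<in> \<Omega>" "X' \<in> \<Omega>" "ennreal (A * r) < ediam E" "dist x X \<le> r" "dist x X' \<le> r"
      "b * r \<le> infdist X E" "b * r \<le> infdist X' E"
    have "0 < A * r" using * A_ge by simp
    from john_center[OF *(1) this *(5)] obtain Y where Y: "john_target \<Omega> D x (A * r) (D * (A * r)) Y" "A * r / D \<le> infdist Y E" by blast
    have "b' * r \<le> A / D * r" "b' * r \<le> b * r" by (rule mult_right_mono; use b' * in simp)+
    moreover have "A / D * r = A * r / D" by simp
    ultimately have b2: "b' * r \<le> infdist Y E" "b' * r \<le> infdist X E" "b' * r \<le> infdist X' E"
      using Y(2) *(8,9) by linarith+
    have "hconn \<Omega> N X Y" using N[OF *(1,2,5,3,6) b2(2,1)] Y(1) by (simp add: mult.assoc)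
    moreover have "hconn \<Omega> N X' Y" using N[OF *(1,2,5,4,7) b2(3,1)] Y(1) by (simp add: mult.assoc)
    ultimately show "hconn \<Omega> (N + N) X X'" using hconn_trans hconn_sym by blast
  qed
qed

text \<open>A ball of radius \<open>A * \<epsilon>\<close> around \<open>z\<close> fits into
  \<open>ball x r\<close>, so \<open>Y\<close> is also a target for \<open>z\<close> at scale
  \<open>\<epsilon>\<close>, with the larger length constant \<open>D * r / \<epsilon>\<close>. The
  lower bound \<open>b\<close> depends on \<open>X\<close>, hence the chain length is not
  controlled.\<close>

lemma linked_to_john_center:
  assumes x: "x \<in> E" and r: "0 < r" "ennreal r < ediam E" and Y: "john_target \<Omega> D x r (D * r) Y" "r / D \<le> infdist Y E"
    and z: "z \<in> E" "dist x z < r"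
  obtains \<epsilon> where "\<epsilon> > 0" "\<And>X. X \<in> \<Omega> \<Longrightarrow> X \<in> ball z \<epsilon> \<Longrightarrow> hlinked \<Omega> X Y"
proof -
  define \<epsilon> where "\<epsilon> = (r - dist x z) / A"
  have e: "\<epsilon> > 0" "A * \<epsilon> = r - dist x z" using z A_ge by (auto simp: \<epsilon>_def)
  have eA: "ennreal (A * \<epsilon>) < ediam E" by (rule le_less_trans[OF ennreal_leI r(2)]) (use e in simp)
  have sub: "ball z (A * \<epsilon>) \<subseteq> ball x r" unfolding e(2)
  proof
    fix y assume "y \<in> ball z (r - dist x z)"
    then show "y \<in> ball x r" using dist_triangle[of x y z] by simp
  qed
  have jt: "john_target \<Omega> D z (A * \<epsilon>) (D * r / \<epsilon> * \<epsilon>) Y"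
    using Y(1) sub e(1) unfolding john_target_def by auto
  have "hlinked \<Omega> X Y" if X: "X \<in> \<Omega>" "X \<in> ball z \<epsilon>" for X
  proof -
    define b where "b = min (infdist X E) (r / D) / \<epsilon>"
    have b: "0 < b" "b * \<epsilon> \<le> infdist X E" "b * \<epsilon> \<le> infdist Y E"
      using infdist_frontier_pos[OF opn ne X(1)] r D e Y(2) by (auto simp: b_def)
    have dz: "dist z X \<le> \<epsilon>" using X(2) by simp
    show ?thesis unfolding hlinked_def
      using key[OF b(1), of "D * r / \<epsilon>"] z(1) e(1) eA X(1) dz b(2,3) jt by meson
  qed
  with e(1) show thesis by (rule that)
qed

text \<open>A relation between boundary points. It is not reflexive by definition:
  \<open>near_linked z z\<close> says that all points of \<open>\<Omega>\<close> close to
  \<open>z\<close> are joined to each other.\<close>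

definition near_linked :: "'a \<Rightarrow> 'a \<Rightarrow> bool" where
  "near_linked z z' \<longleftrightarrow> (\<exists>\<epsilon>>0. \<forall>X\<in>\<Omega> \<inter> ball z \<epsilon>. \<forall>X'\<in>\<Omega> \<inter> ball z' \<epsilon>. hlinked \<Omega> X X')"

lemma near_frontier:
  assumes "z \<in> E" "e > 0"
  obtains X where "X \<in> \<Omega>" "X \<in> ball z e"
proof -
  have "z \<in> closure \<Omega>" using assms by (simp add: frontier_def)
  then show thesis using assms(2) that by (metis closure_approachable dist_commute mem_ball)
qed

lemma near_linked_trans:
  assumes "near_linked u v" "near_linked v w" and v: "v \<in> E"
  shows "near_linked u w"
proof -
  obtain e where e: "e > 0" "\<And>X X'. X \<in> \<Omega> \<inter> ball u e \<Longrightarrow> X' \<in> \<Omega> \<inter> ball v e \<Longrightarrow> hlinked \<Omega> X X'"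
    using assms(1) unfolding near_linked_def by blast
  obtain e' where e': "e' > 0" "\<And>X X'. X \<in> \<Omega> \<inter> ball v e' \<Longrightarrow> X' \<in> \<Omega> \<inter> ball w e' \<Longrightarrow> hlinked \<Omega> X X'"
    using assms(2) unfolding near_linked_def by blast
  obtain V where V: "V \<in> \<Omega>" "V \<in> ball v (min e e')" using near_frontier[OF v, of "min e e'"] e e' by auto
  show ?thesis unfolding near_linked_def
  proof (intro exI[of _ "min e e'"] conjI ballI)
    fix X X' assume "X \<in> \<Omega> \<inter> ball u (min e e')" "X' \<in> \<Omega> \<inter> ball w (min e e')"
    then have "hlinked \<Omega> X V" "hlinked \<Omega> V X'" using e(2)[of X V] e'(2)[of V X'] V by auto
    then show "hlinked \<Omega> X X'" by (rule hlinked_trans)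
  qed (use e e' in auto)
qed

text \<open>A radius strictly between the distance and the diameter gives a ball around
  \<open>z\<close> that contains \<open>z'\<close>, and its John centre is joined to points near
  both.\<close>

lemma near_linked_close:
  assumes z: "z \<in> E" "z' \<in> E" and d: "ennreal (dist z z') < ediam E"
  shows "near_linked z z'"
proof -
  obtain r where r: "dist z z' < r" "ennreal r < ediam E"
  proof -
    obtain r' where r': "ennreal (dist z z') < r'" "r' < ediam E" using dense[OF d] by blast
    obtain r where "r' = ennreal r" "0 \<le> r" using r'(2) by (cases r') auto
    then show thesis using that[of r] r' by (simp add: ennreal_less_iff)
  qed
  have r0: "r > 0" using r(1) zero_le_dist[of z z'] by linarith
  obtain Y where Y: "john_target \<Omega> D z r (D * r) Y" "r / D \<le> infdist Y E" using john_center[OF z(1) r0 r(2)] .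
  obtain e where e: "e > 0" "\<And>X. X \<in> \<Omega> \<Longrightarrow> X \<in> ball z e \<Longrightarrow> hlinked \<Omega> X Y"
    using linked_to_john_center[OF z(1) r0 r(2) Y z(1)] r0 by auto
  obtain e' where e': "e' > 0" "\<And>X. X \<in> \<Omega> \<Longrightarrow> X \<in> ball z' e' \<Longrightarrow> hlinked \<Omega> X Y"
    using linked_to_john_center[OF z(1) r0 r(2) Y z(2) r(1)] by auto
  show ?thesis unfolding near_linked_def
  proof (intro exI[of _ "min e e'"] conjI ballI)
    fix X X' assume "X \<in> \<Omega> \<inter> ball z (min e e')" "X' \<in> \<Omega> \<inter> ball z' (min e e')"
    then have "hlinked \<Omega> X Y" "hlinked \<Omega> Y X'" using e(2)[of X] hlinked_sym[OF e'(2)[of X']] by auto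
    then show "hlinked \<Omega> X X'" by (rule hlinked_trans)
  qed (use e e' in auto)
qed

lemma exterior_ball_near:
  assumes z: "z \<in> E" and s: "0 < s" and pos: "ediam E > 0"
  obtains W where "W \<subseteq> ball z s" "open W" "W \<noteq> {}" "W \<inter> \<Omega> = {}"
proof -
  obtain r where r: "0 < r" "r \<le> s" "ennreal r < ediam E" using ennreal_scale[OF s pos] .
  obtain X where X: "ball X (c * r) \<subseteq> ball z r \<inter> interior (- \<Omega>)" using ext[OF z r(1,3)] by blast
  show thesis
  proof
    show "ball X (c * r) \<subseteq> ball z s" using X r(2) subset_ball[OF r(2), of z] by blast
    have "0 < c * r" using c r by simp
    then show "ball X (c * r) \<noteq> {}" by simp
    show "ball X (c * r) \<inter> \<Omega> = {}" using X interior_subset[of "- \<Omega>"] by blast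
  qed simp
qed

text \<open>Only pairs at a distance equal to the diameter \<open>d\<close> remain. If such a pair
  is not linked, boundary points near \<open>z1\<close> and boundary points near \<open>z2\<close>
  are exactly \<open>d\<close> apart, as a closer pair would link \<open>z1\<close> to
  \<open>z2\<close>. Two boundary points near \<open>z2\<close> then confine the boundary near
  \<open>z1\<close> to two spheres.\<close>

lemma near_linked_all:
  assumes z: "z1 \<in> E" "z2 \<in> E"
  shows "near_linked z1 z2"
proof (cases "ennreal (dist z1 z2) < ediam E")
  case True
  then show ?thesis by (rule near_linked_close[OF z])
next
  case far: False
  have le: "ennreal (dist u v) \<le> ediam E" if "u \<in> E" "v \<in> E" for u v by (rule dist_le_ediam[OF that])
  define d where "d = dist z1 z2"
  have ed: "ediam E = ennreal d" using far le[OF z] by (simp add: d_def)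
  have close: "near_linked u v" if "u \<in> E" "v \<in> E" "dist u v < d" for u v
    by (rule near_linked_close[OF that(1,2)]) (use that in \<open>simp add: ed ennreal_less_iff\<close>)
  have le_d: "dist u v \<le> d" if "u \<in> E" "v \<in> E" for u v
    using le[OF that] unfolding ed by (simp add: d_def)
  show ?thesis
  proof (cases "d = 0")
    case True
    \<comment> \<open>The boundary is a single point. No scale lies below its diameter 0, so
      connectedness of the punctured space in dimension at least 2 is used directly.\<close>
    then have z12: "z1 = z2" by (simp add: d_def)
    show ?thesis
    proof (cases "\<Omega> = - {z1}")
      case True
      have "connected \<Omega>" unfolding True using dim2 by (rule connected_punctured_universe)
      then have "hlinked \<Omega> a b" if "a \<in> \<Omega>" "b \<in> \<Omega>" for a b
        using hlinked_connected[OF opn ne _ order_refl that] by blast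
      then show ?thesis unfolding near_linked_def by (intro exI[of _ 1]) auto
    next
      case False
      have "u = z1" if "u \<in> E" for u using le_d[OF that z(1)] True by simp
      then have E: "E = {z1}" using z(1) by blast
      have con: "connected (- {z1})" using dim2 by (rule connected_punctured_universe)
      have "z1 \<notin> \<Omega>" using z(1) opn by (simp add: frontier_def interior_open)
      obtain X where "X \<in> \<Omega>" using near_frontier[OF z(1), of 1] by auto
      then have "- {z1} \<subseteq> \<Omega>" using connected_avoids_frontier[OF con, of \<Omega> X] E \<open>z1 \<notin> \<Omega>\<close> by auto
      then show ?thesis using False \<open>z1 \<notin> \<Omega>\<close> by auto
    qed
  next
    case False
    then have d0: "d > 0" by (simp add: d_def)
    then have pos: "ediam E > 0" by (simp add: ed)
    show ?thesis
    proof (rule ccontr)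
      assume no: "\<not> near_linked z1 z2"
      \<comment> \<open>If \<open>dist w y < d\<close>, all consecutive distances along
        \<open>z1\<close>, \<open>w\<close>, \<open>y\<close>, \<open>z2\<close> are below
        \<open>d\<close>, and transitivity links \<open>z1\<close> to \<open>z2\<close>.\<close>
      have cross: "dist w y = d" if w: "w \<in> E" "dist z1 w < d" and y: "y \<in> E" "dist y z2 < d" for w y
      proof (rule ccontr)
        assume "dist w y \<noteq> d"
        then have "dist w y < d" using le_d[OF w(1) y(1)] by simp
        then have "near_linked w z2" using near_linked_trans[OF close[OF w(1) y(1)] close[OF y(1) z(2) y(2)] y(1)] by blast
        then show False using near_linked_trans[OF close[OF z(1) w] _ w(1)] no by blast
      qed
      obtain W where W: "W \<subseteq> ball z2 d" "open W" "W \<noteq> {}" "W \<inter> \<Omega> = {}" using exterior_ball_near[OF z(2) d0 pos] .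
      obtain y where y: "y \<in> E" "y \<in> ball z2 d" "y \<noteq> z2" using frontier_not_isolated[OF dim2 opn d0 z(2) W] .
      obtain W' where W': "W' \<subseteq> ball z1 d" "open W'" "W' \<noteq> {}" "W' \<inter> \<Omega> = {}" using exterior_ball_near[OF z(1) d0 pos] .
      show False
      proof (rule frontier_not_in_two_spheres[OF dim2 opn d0 y(3) z(1) W', of d])
        show "E \<inter> ball z1 d \<subseteq> {p. dist p y = d \<and> dist p z2 = d}"
          using cross y d0 z by (auto simp: dist_commute)
      qed
    qed
  qed
qed

text \<open>The ball around \<open>X\<close> up to its nearest boundary point lies in
  \<open>\<Omega>\<close> and comes arbitrarily close to that point, which reduces the claim to
  points near the boundary.\<close>

lemma hlinked_all:
  assumes "X \<in> \<Omega>" "X' \<in> \<Omega>"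
  shows "hlinked \<Omega> X X'"
proof -
  have near: "\<exists>z\<in>E. \<forall>e>0. \<exists>X1\<in>\<Omega> \<inter> ball z e. hlinked \<Omega> X X1" if X: "X \<in> \<Omega>" for X
  proof -
    obtain z where z: "z \<in> E" "dist X z = infdist X E" using frontier_nearest[OF ne] .
    have \<delta>: "infdist X E > 0" by (rule infdist_frontier_pos[OF opn ne X])
    have sub: "ball X (infdist X E) \<subseteq> \<Omega>" using mem_of_dist_less[OF X] by auto
    have "\<exists>X1\<in>\<Omega> \<inter> ball z e. hlinked \<Omega> X X1" if e: "e > 0" for e
    proof -
      have "z \<in> closure (ball X (infdist X E))" using \<delta> z by (simp add: closure_ball)
      then obtain X1 where X1: "X1 \<in> ball X (infdist X E)" "dist X1 z < e" using e by (metis closure_approachable)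
      then have "hlinked \<Omega> X X1" using hlinked_connected[OF opn ne connected_ball sub] \<delta> by simp
      moreover have "X1 \<in> \<Omega> \<inter> ball z e" using X1 sub by (auto simp: dist_commute)
      ultimately show ?thesis by blast
    qed
    then show ?thesis using z(1) by blast
  qed
  obtain z where z: "z \<in> E" "\<And>e. e > 0 \<Longrightarrow> \<exists>X1\<in>\<Omega> \<inter> ball z e. hlinked \<Omega> X X1" using near[OF assms(1)] by blast
  obtain z' where z': "z' \<in> E" "\<And>e. e > 0 \<Longrightarrow> \<exists>X1\<in>\<Omega> \<inter> ball z' e. hlinked \<Omega> X' X1" using near[OF assms(2)] by blast
  obtain e where e: "e > 0" "\<And>a b. a \<in> \<Omega> \<inter> ball z e \<Longrightarrow> b \<in> \<Omega> \<inter> ball z' e \<Longrightarrow> hlinked \<Omega> a b"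
    using near_linked_all[OF z(1) z'(1)] unfolding near_linked_def by blast
  obtain X1 X1' where "X1 \<in> \<Omega> \<inter> ball z e" "hlinked \<Omega> X X1" "X1' \<in> \<Omega> \<inter> ball z' e" "hlinked \<Omega> X' X1'"
    using z(2)[OF e(1)] z'(2)[OF e(1)] by blast
  then show ?thesis using e(2) hlinked_trans hlinked_sym by meson
qed

text \<open>The condition \<open>\<eta> \<le> sdist \<Omega> X\<close> encodes membership in
  \<open>\<Omega>\<close> together with the distance bound, and is closed. Compactness thus makes
  the qualitative chains of \<open>hlinked_all\<close> uniform.\<close>

lemma compact_harnack:
  assumes \<eta>: "\<eta> > 0"
  shows "\<exists>N. \<forall>X\<in>cball p R. \<forall>X'\<in>cball p R. \<eta> \<le> sdist \<Omega> X \<longrightarrow> \<eta> \<le> sdist \<Omega> X' \<longrightarrow> hconn \<Omega> N X X'"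
proof -
  define K where "K = cball p R \<inter> {x. \<eta> \<le> sdist \<Omega> x}"
  have "continuous_on UNIV (sdist \<Omega>)"
    unfolding continuous_on_iff
  proof (intro ballI allI impI)
    fix u :: 'a and e :: real assume "e > 0"
    then show "\<exists>d>0. \<forall>v\<in>UNIV. dist v u < d \<longrightarrow> dist (sdist \<Omega> v) (sdist \<Omega> u) < e"
      using sdist_lipschitz[of \<Omega>] by (intro exI[of _ e]) (auto simp: dist_real_def intro: le_less_trans)
  qed
  then have "closed {x. \<eta> \<le> sdist \<Omega> x}" by (intro closed_Collect_le continuous_intros)
  then have comK: "compact K" unfolding K_def by (intro compact_Int_closed) auto
  have KO: "K \<subseteq> \<Omega>" unfolding K_def using sdist_pos_iff[OF opn ne] \<eta> by force
  show ?thesis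
  proof (cases "K = {}")
    case True
    then show ?thesis unfolding K_def by blast
  next
    case False
    then obtain u where u: "u \<in> K" by blast
    have "\<exists>N. \<forall>v\<in>K. \<exists>k\<le>N. (hstep \<Omega> ^^ k) u v"
    proof (rule compact_uniform_chain[OF comK])
      show "\<exists>k. (hstep \<Omega> ^^ k) u v" if "v \<in> K" for v
        using hlinked_all[of u v] that u KO unfolding hlinked_def hconn_def by blast
      show "\<exists>U. open U \<and> q \<in> U \<and> (\<forall>v\<in>U \<inter> K. hstep \<Omega> q v)" if "q \<in> K" for q
        using that KO infdist_frontier_pos[OF opn ne, of q]
        by (intro exI[of _ "ball q (infdist q E / 2)"]) (auto intro!: hstepI)
    qed
    then obtain N where N: "\<And>v. v \<in> K \<Longrightarrow> \<exists>k\<le>N. (hstep \<Omega> ^^ k) u v" by blast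
    have "hconn \<Omega> N u v" if "v \<in> K" for v
      using N[OF that] that u KO unfolding hconn_def by blast
    then have "hconn \<Omega> (N + N) X X'" if "X \<in> K" "X' \<in> K" for X X' using that hconn_trans hconn_sym by blast
    then show ?thesis unfolding K_def by blast
  qed
qed

text \<open>Four regimes: points one step apart; \<open>\<rho>\<close> small compared with the
  diameter \<open>d\<close> of the boundary; \<open>\<rho> \<ge> 8 * d\<close>, where chains run in
  an annulus; and \<open>\<rho>\<close> comparable to \<open>d\<close>, where compactness
  applies.\<close>

theorem harnack: "harnack_chain \<Omega>"
proof (rule harnack_chainI[OF opn ne])
  fix \<Lambda> :: real assume \<Lambda>: "\<Lambda> \<ge> 1"
  obtain p where p: "p \<in> E" using ne by blast
  \<comment> \<open>For an infinite diameter this is the default 0, but then every scale is below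
    the diameter and the regimes that use \<open>d\<close> are never entered.\<close>
  define d where "d = enn2real (ediam E)"
  have d0: "d \<ge> 0" by (simp add: d_def)
  \<comment> \<open>The compact regime has \<open>d \<le> 4 * A * \<Lambda> * \<rho>\<close>, that
    is \<open>\<eta> \<le> \<rho>\<close>; the value 1 only keeps \<open>\<eta>\<close> positive
    when \<open>d = 0\<close>, where that regime does not occur.\<close>
  define \<eta> where "\<eta> = (if d = 0 then 1 else d / (4 * A * \<Lambda>))"
  have \<eta>: "\<eta> > 0" using d0 A_ge \<Lambda> by (auto simp: \<eta>_def)
  have pos: "0 < 1 / (4 * \<Lambda>)" and L3: "1 \<le> 3 * \<Lambda>" using \<Lambda> by auto
  obtain N1 where N1: "\<And>x r X X'. x \<in> E \<Longrightarrow> r > 0 \<Longrightarrow> X \<in> \<Omega> \<Longrightarrow> X' \<in> \<Omega> \<Longrightarrow> ennreal (A * r) < ediam E \<Longrightarrow> dist x X \<le> r \<Longrightarrow> dist x X' \<le> r \<Longrightarrow>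
      1 / (4 * \<Lambda>) * r \<le> infdist X E \<Longrightarrow> 1 / (4 * \<Lambda>) * r \<le> infdist X' E \<Longrightarrow> hconn \<Omega> N1 X X'"
    using small_scale_harnack[OF pos] by blast
  obtain N2 where N2: "\<And>\<rho> X X'. E \<subseteq> cball p d \<Longrightarrow> 8 * d \<le> \<rho> \<Longrightarrow> 0 < \<rho> \<Longrightarrow> X \<in> \<Omega> \<Longrightarrow> \<rho> \<le> dist p X \<Longrightarrow> dist p X \<le> 3 * \<Lambda> * \<rho> \<Longrightarrow>
      \<rho> \<le> dist p X' \<Longrightarrow> dist p X' \<le> 3 * \<Lambda> * \<rho> \<Longrightarrow> hconn \<Omega> N2 X X'"
    using annulus_chain[OF dim2 L3] ne by meson
  obtain N3 where N3: "\<And>X X'. dist p X \<le> 17 * \<Lambda> * d \<Longrightarrow> dist p X' \<le> 17 * \<Lambda> * d \<Longrightarrow> \<eta> \<le> sdist \<Omega> X \<Longrightarrow> \<eta> \<le> sdist \<Omega> X' \<Longrightarrow> hconn \<Omega> N3 X X'"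
    using compact_harnack[OF \<eta>, of p "17 * \<Lambda> * d"] unfolding Ball_def mem_cball by blast
  show "\<exists>N. \<forall>\<rho>>0. \<forall>X\<in>\<Omega>. \<forall>X'\<in>\<Omega>. infdist X E \<ge> \<rho> \<and> infdist X' E \<ge> \<rho> \<and> dist X X' < \<Lambda> * \<rho> \<longrightarrow> hconn \<Omega> N X X'"
  proof (intro exI[of _ "1 + N1 + N2 + N3"] allI ballI impI)
    fix \<rho> :: real and X X' assume \<rho>: "\<rho> > 0" and X: "X \<in> \<Omega>" "X' \<in> \<Omega>"
      and *: "infdist X E \<ge> \<rho> \<and> infdist X' E \<ge> \<rho> \<and> dist X X' < \<Lambda> * \<rho>"
    have \<Lambda>\<rho>: "\<Lambda> * \<rho> \<ge> \<rho>" using \<Lambda> \<rho> by simp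
    have "hconn \<Omega> 1 X X' \<or> hconn \<Omega> N1 X X' \<or> hconn \<Omega> N2 X X' \<or> hconn \<Omega> N3 X X'"
    proof (cases "dist X X' < max (infdist X E) (infdist X' E) / 2")
      case True
      then have "hstep \<Omega> X X'" using X by (simp add: hstep_def)
      then show ?thesis using hconn_step by blast
    next
      case False
      \<comment> \<open>Without a single step, both boundary distances are at most
        \<open>2 * dist X X'\<close>, so both points are within
        \<open>4 * \<Lambda> * \<rho>\<close> of one boundary point.\<close>
      then have \<delta>: "infdist X E \<le> 2 * (\<Lambda> * \<rho>)" "infdist X' E \<le> 2 * (\<Lambda> * \<rho>)" using * by auto
      obtain x where x: "x \<in> E" "dist X x = infdist X E" using frontier_nearest[OF ne] .
      have dx: "dist x X \<le> 4 * \<Lambda> * \<rho>" "dist x X' \<le> 4 * \<Lambda> * \<rho>"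
        using x(2) \<delta> * dist_triangle[of x X' X] \<Lambda>\<rho> \<rho> by (auto simp: dist_commute)
      show ?thesis
      proof (cases "ennreal (A * (4 * \<Lambda> * \<rho>)) < ediam E")
        case True
        have "1 / (4 * \<Lambda>) * (4 * \<Lambda> * \<rho>) = \<rho>" using \<Lambda> by simp
        then have "hconn \<Omega> N1 X X'" using N1[OF x(1) _ X True dx] * \<rho> \<Lambda> by simp
        then show ?thesis by blast
      next
        case False
        then have le: "ediam E \<le> ennreal (A * (4 * \<Lambda> * \<rho>))" by simp
        then have ed: "ediam E = ennreal d" unfolding d_def using le_less_trans[OF le ennreal_less_top] by simp
        have dle: "d \<le> A * (4 * \<Lambda> * \<rho>)" using le unfolding ed using A_ge \<Lambda> \<rho> by (subst (asm) ennreal_le_iff) auto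
        have Ed: "dist u v \<le> d" if "u \<in> E" "v \<in> E" for u v
          using dist_le_ediam[OF that] unfolding ed using d0 by simp
        then have Ep: "E \<subseteq> cball p d" using p by auto
        have lo: "\<rho> \<le> dist p X" "\<rho> \<le> dist p X'" using * infdist_le[OF p, of X] infdist_le[OF p, of X'] by (auto simp: dist_commute)
        obtain x' where x': "x' \<in> E" "dist X' x' = infdist X' E" using frontier_nearest[OF ne] .
        have up: "dist p X \<le> 2 * (\<Lambda> * \<rho>) + d" "dist p X' \<le> 2 * (\<Lambda> * \<rho>) + d"
          using dist_triangle[of p X x] dist_triangle[of p X' x'] Ed[OF p x(1)] Ed[OF p x'(1)] x(2) x'(2) \<delta> by (auto simp: dist_commute)
        show ?thesis
        proof (cases "8 * d \<le> \<rho>")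
          case True
          \<comment> \<open>Here \<open>2 * \<Lambda> * \<rho> + d\<close> is at most
            \<open>3 * \<Lambda> * \<rho>\<close>, the outer radius of the annulus.\<close>
          have "hconn \<Omega> N2 X X'" by (rule N2[OF Ep True \<rho> X(1)]) (use lo up True \<Lambda>\<rho> \<rho> in auto)
          then show ?thesis by blast
        next
          case False
          then have dp: "d > 0" using \<rho> d0 by auto
          have "\<eta> \<le> \<rho>" using dle dp A_ge \<Lambda> by (simp add: \<eta>_def field_simps)
          then have s: "\<eta> \<le> sdist \<Omega> X" "\<eta> \<le> sdist \<Omega> X'" using X * by (auto simp: sdist_def)
          \<comment> \<open>The bound \<open>2 * \<Lambda> * \<rho> + d\<close> with
            \<open>\<rho> < 8 * d\<close> gives the radius
            \<open>17 * \<Lambda> * d\<close>.\<close>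
          have "\<Lambda> * \<rho> \<le> \<Lambda> * (8 * d)" using False \<Lambda> by (intro mult_left_mono) auto
          moreover have "d \<le> \<Lambda> * d" using \<Lambda> dp by simp
          ultimately have "dist p X \<le> 17 * \<Lambda> * d" "dist p X' \<le> 17 * \<Lambda> * d" using up by linarith+
          then have "hconn \<Omega> N3 X X'" using N3 s by blast
          then show ?thesis by blast
        qed
      qed
    qed
    then show "hconn \<Omega> (1 + N1 + N2 + N3) X X'" by (auto elim: hconn_mono)
  qed
qed

end

lemma harnack_chain_of_local_john:
  fixes \<Omega> :: "'a::euclidean_space set"
  assumes n: "n \<ge> 1" and dim: "DIM('a) = n + 1" and opn: "open \<Omega>" and adr: "ahlfors_david_regular n (frontier \<Omega>)"
    and john: "local_john \<Omega>" and ext: "exterior_corkscrew \<Omega>"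
  shows "harnack_chain \<Omega>"
proof (cases "frontier \<Omega> = {}")
  case True
  \<comment> \<open>\<open>infdist\<close> to the empty set is 0, so no point has distance at least
    \<open>\<rho> > 0\<close>.\<close>
  then show ?thesis unfolding harnack_chain_def by (intro exI[of _ 1] conjI exI[of _ "\<lambda>_. 0"]) (auto simp: infdist_def)
next
  case False
  obtain Da where Da: "Da \<ge> 1" "adr_const n Da (frontier \<Omega>)" using adr unfolding ahlfors_david_regular_def adr_const_def by blast
  obtain c where c: "0 < c" "c < 1" "\<And>y \<rho>. y \<in> frontier \<Omega> \<Longrightarrow> 0 < \<rho> \<Longrightarrow> ennreal \<rho> < ediam (frontier \<Omega>) \<Longrightarrow> \<exists>X. ball X (c * \<rho>) \<subseteq> ball y \<rho> \<inter> interior (- \<Omega>)"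
    using ext unfolding exterior_corkscrew_def corkscrew_wrt_def by blast
  obtain D where D: "D \<ge> 1" and J: "\<And>x r. x \<in> frontier \<Omega> \<Longrightarrow> r > 0 \<Longrightarrow> ennreal r < ediam (frontier \<Omega>) \<Longrightarrow>
          (\<exists>Y \<in> ball x r \<inter> \<Omega>. ball Y (r / D) \<subseteq> \<Omega> \<and>
             (\<forall>z \<in> ball x r \<inter> frontier \<Omega>. \<exists>\<gamma>. path_into \<Omega> \<gamma> z Y \<and> nontangential (frontier \<Omega>) D \<gamma> \<and>
                curve_length \<gamma> 0 1 \<le> ennreal (D * r)))"
    using john unfolding local_john_def local_john_wrt_def by blast
  interpret john_corkscrew_domain \<Omega> n Da c D
  proof
    show "\<exists>Y. ball Y (r / D) \<subseteq> \<Omega> \<and> john_target \<Omega> D x r (D * r) Y"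
      if "x \<in> frontier \<Omega>" "0 < r" "ennreal r < ediam (frontier \<Omega>)" for x r
      using J[OF that] unfolding john_target_def by blast
  qed (use n dim opn False Da c D in auto)
  show ?thesis by (rule harnack)
qed

section \<open>The two-sided condition and the exterior domain\<close>

lemma local_john_imp_corkscrew:
  assumes "local_john_wrt E U"
  shows "corkscrew_wrt E U"
proof -
  obtain D where D: "D \<ge> 1" and J: "\<And>x r. x \<in> E \<Longrightarrow> r > 0 \<Longrightarrow> ennreal r < ediam E \<Longrightarrow> \<exists>Y \<in> ball x r \<inter> U. ball Y (r / D) \<subseteq> U"
    using assms unfolding local_john_wrt_def by blast
  show ?thesis unfolding corkscrew_wrt_def
  \<comment> \<open>The John condition is applied at radius \<open>r / 2\<close>: its centre lies
    within \<open>r / 2\<close> of \<open>x\<close> and its ball has radius at most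
    \<open>r / 2\<close>, so the ball stays inside \<open>ball x r\<close>.\<close>
  proof (intro exI[of _ "1 / (2 * D)"] conjI ballI allI impI)
    fix x r assume x: "x \<in> E" "0 < r" "ennreal r < ediam E"
    have "ennreal (r/2) < ediam E" by (rule le_less_trans[OF ennreal_leI x(3)]) (use x in simp)
    then obtain Y where Y: "Y \<in> ball x (r/2)" "ball Y (r / 2 / D) \<subseteq> U" using J[OF x(1), of "r/2"] x by auto
    have "r / 2 / D \<le> r / 2" using D x by (simp add: field_simps)
    then have "ball Y (r / 2 / D) \<subseteq> ball x r" using Y(1) by (intro ball_subset_ball_iff[THEN iffD2]) (auto simp: dist_commute)
    then show "\<exists>X. ball X (1 / (2 * D) * r) \<subseteq> ball x r \<inter> U" using Y(2) by (intro exI[of _ Y]) (simp add: mult.commute)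
  qed (use D in auto)
qed

text \<open>Exterior corkscrew balls at small scales accumulate at every boundary point. A positive
  diameter ensures that such scales exist: the punctured space has a one-point boundary but an empty
  exterior.\<close>

lemma frontier_exterior:
  fixes \<Omega> :: "'a::euclidean_space set"
  assumes opn: "open \<Omega>" and ext: "exterior_corkscrew \<Omega>" and pos: "ediam (frontier \<Omega>) > 0"
  shows "frontier (interior (- \<Omega>)) = frontier \<Omega>"
proof
  show "frontier (interior (- \<Omega>)) \<subseteq> frontier \<Omega>" using frontier_interior_subset[of "- \<Omega>"] by simp
  obtain c where c: "0 < c" "c < 1" "\<And>y \<rho>. y \<in> frontier \<Omega> \<Longrightarrow> 0 < \<rho> \<Longrightarrow> ennreal \<rho> < ediam (frontier \<Omega>) \<Longrightarrow> \<exists>X. ball X (c * \<rho>) \<subseteq> ball y \<rho> \<inter> interior (- \<Omega>)"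
    using ext unfolding exterior_corkscrew_def corkscrew_wrt_def by blast
  show "frontier \<Omega> \<subseteq> frontier (interior (- \<Omega>))"
  proof
    fix x assume x: "x \<in> frontier \<Omega>"
    have "x \<in> closure (interior (- \<Omega>))"
      unfolding closure_approachable
    proof (intro allI impI)
      fix e :: real assume e: "e > 0"
      obtain r where r: "0 < r" "r \<le> e" "ennreal r < ediam (frontier \<Omega>)" using ennreal_scale[OF e pos] .
      obtain X where X: "ball X (c * r) \<subseteq> ball x r \<inter> interior (- \<Omega>)" using c(3)[OF x r(1,3)] by blast
      moreover have "X \<in> ball X (c * r)" using c r by simp
      ultimately have "X \<in> interior (- \<Omega>)" "X \<in> ball x r" by blast+
      then have "X \<in> interior (- \<Omega>)" "dist X x < e" using r(2) by (auto simp: dist_commute)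
      then show "\<exists>y\<in>interior (- \<Omega>). dist y x < e" by blast
    qed
    moreover have "x \<notin> interior (- \<Omega>)" using x by (simp add: frontier_def interior_closure)
    ultimately show "x \<in> frontier (interior (- \<Omega>))" by (simp add: frontier_def)
  qed
qed

lemma chord_arc_domainI:
  fixes \<Omega> :: "'a::euclidean_space set"
  assumes "n \<ge> 1" "DIM('a) = n + 1" "open \<Omega>" "ahlfors_david_regular n (frontier \<Omega>)" "local_john \<Omega>" "exterior_corkscrew \<Omega>"
  shows "chord_arc_domain n \<Omega>"
  using assms harnack_chain_of_local_john[OF assms] local_john_imp_corkscrew[of "frontier \<Omega>" \<Omega>]
  unfolding chord_arc_domain_def corkscrew_def local_john_def by blast

text \<open>When the two boundaries agree, the roles of the sides can be exchanged: the John
  condition of \<open>\<Omega>\<close> yields the exterior corkscrews of the exterior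
  domain.\<close>

lemma chord_arc_exterior:
  fixes \<Omega> :: "'a::euclidean_space set"
  assumes n: "n \<ge> 1" and dim: "DIM('a) = n + 1" and opn: "open \<Omega>" and adr: "ahlfors_david_regular n (frontier \<Omega>)"
    and john: "local_john \<Omega>" "local_john_wrt (frontier \<Omega>) (interior (- \<Omega>))"
  shows "chord_arc_domain n (interior (- \<Omega>))"
proof (rule chord_arc_domainI[OF n dim])
  let ?O = "interior (- \<Omega>)"
  have ext: "exterior_corkscrew \<Omega>" unfolding exterior_corkscrew_def using local_john_imp_corkscrew[OF john(2)] .
  have "ahlfors_david_regular n (frontier ?O) \<and> local_john ?O \<and> exterior_corkscrew ?O"
  proof (cases "ediam (frontier \<Omega>) > 0")
    case True
    note fr = frontier_exterior[OF opn ext True]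
    \<comment> \<open>Corkscrew balls in \<open>\<Omega>\<close> are therefore exterior corkscrew
      balls for \<open>?O\<close>.\<close>
    have "\<Omega> \<subseteq> interior (- ?O)"
      by (rule interior_maximal[OF _ opn]) (use interior_subset[of "- \<Omega>"] in blast)
    then have "exterior_corkscrew ?O"
      using local_john_imp_corkscrew[OF john(1)[unfolded local_john_def]]
      unfolding exterior_corkscrew_def corkscrew_wrt_def fr by (meson Int_mono order_refl order_trans)
    then show ?thesis using adr john(2) unfolding local_john_def fr by blast
  next
    case False
    \<comment> \<open>The boundary of \<open>?O\<close> may be strictly smaller here, but its
      diameter is still 0, so the conditions over scales below the diameter hold vacuously.\<close>
    have "frontier ?O \<subseteq> frontier \<Omega>" using frontier_interior_subset[of "- \<Omega>"] by simp
    then have "ediam (frontier ?O) \<le> ediam (frontier \<Omega>)" by (rule ediam_mono)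
    then have z: "\<not> ennreal r < ediam (frontier ?O)" for r using False by auto
    have "ahlfors_david_regular n (frontier ?O)" unfolding ahlfors_david_regular_def using z by (auto intro: exI[of _ 1])
    moreover have "local_john ?O" unfolding local_john_def local_john_wrt_def using z by (auto intro: exI[of _ 1])
    moreover have "exterior_corkscrew ?O" unfolding exterior_corkscrew_def corkscrew_wrt_def using z by (auto intro: exI[of _ "1/2"])
    ultimately show ?thesis by blast
  qed
  then show "ahlfors_david_regular n (frontier ?O)" "local_john ?O" "exterior_corkscrew ?O" by auto
qed simp

theorem theorem1p2:
  fixes n :: nat
  assumes "n \<ge> 1" and "DIM('a::euclidean_space) = n + 1"
  shows "(\<forall>\<Omega> :: 'a set. open \<Omega> \<and> ahlfors_david_regular n (frontier \<Omega>) \<and>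
             local_john \<Omega> \<and> exterior_corkscrew \<Omega> \<longrightarrow> harnack_chain \<Omega>) \<and>
         (\<forall>\<Omega> :: 'a set. open \<Omega> \<and> ahlfors_david_regular n (frontier \<Omega>) \<and>
             two_sided_local_john \<Omega> \<longrightarrow> two_sided_chord_arc_domain n \<Omega>)"
proof (intro conjI allI impI; elim conjE)
  fix \<Omega> :: "'a set"
  assume "open \<Omega>" "ahlfors_david_regular n (frontier \<Omega>)" "local_john \<Omega>" "exterior_corkscrew \<Omega>"
  then show "harnack_chain \<Omega>" by (rule harnack_chain_of_local_john[OF assms])
next
  fix \<Omega> :: "'a set"
  assume O: "open \<Omega>" "ahlfors_david_regular n (frontier \<Omega>)" and "two_sided_local_john \<Omega>"
  then have john: "local_john \<Omega>" "local_john_wrt (frontier \<Omega>) (interior (- \<Omega>))" by (auto simp: two_sided_local_john_def)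
  have "exterior_corkscrew \<Omega>" unfolding exterior_corkscrew_def by (rule local_john_imp_corkscrew[OF john(2)])
  then show "two_sided_chord_arc_domain n \<Omega>"
    unfolding two_sided_chord_arc_domain_def
    using chord_arc_domainI[OF assms O john(1)] chord_arc_exterior[OF assms O john] by blast
qed

end
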